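(* For every $k\in\mathbb Z$ there is a canonical isomorphism of abelian groups $K_0(\mathcal F_k)\to(V_F)_k$ which maps $[P(\mathbf x)]$ to $\mathbf x$ for $\mathbf x\in\mathcal{IM}_k$. Taking the union over $k$, one has $K_0(\mathcal F)\cong V_F$.
   Context: $\mathbf{k}$ is a field of characteristic zero; modules are left modules, unital with respect to the given idempotents. $\mathcal{M}$ is the set of sequences $\mathbf{x}=(x_1,x_2,\dots)$ of even integers with $x_i=x_{i-1}+2$ for $i\gg0$; $\mathcal{M}_k$ is the subset with $x_i=2i+2k$ for $i\gg0$; $\mathcal{IM}\subset\mathcal M$ and $\mathcal{IM}_k\subset\mathcal M_k$ consist of the strictly increasing sequences. $V_F$ is the free abelian group on $\mathcal{IM}$ and $(V_F)_k$ the free abelian group on $\mathcal{IM}_k$. The DG algebra $R$: $\odot$ is concatenation of sequences / horizontal juxtaposition of diagrams. $R$ is the graded $\mathbf{k}$-algebra generated by diagrams (read bottom to top; all labels even): idempotents $\mathbf 1_{\mathbf x}$ ($\mathbf x\in\mathcal M$, vertical strands), degree $0$; crossings $cr_{i,j}(\mathbf a,\mathbf x)$ with bottom $\mathbf a\odot(j,i)\odot\mathbf x$, top $\mathbf a\odot(i,j)\odot\mathbf x$, degree $1$ if $i<j$ and $-1$ if $i\ge j$; dots $dot_i(\mathbf a,\mathbf x)$ with bottom $\mathbf a\odot(i+2)\odot\mathbf x$, top $\mathbf a\odot(i)\odot\mathbf x$, degree $0$ ($\mathbf a$ a finite even sequence, $\mathbf x\in\mathcal M$). $fg$ is vertical concatenation,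 $f$ at the bottom, $g$ at the top, zero unless labels match. Local relations (with arbitrary vertical strands added left and right): vertical strands are idempotents and disjoint diagrams supercommute; $dot_{i+2}\cdot dot_i=0$; $cr_{j,i}\cdot cr_{i,j}=(1-\delta_{i,j})\mathbf 1_{(i,j)}$; braid relation for all labels; dot-slide $dot_i\odot\mathbf 1_j=cr_{j,i+2}\cdot(\mathbf 1_j\odot dot_i)\cdot cr_{i,j}$ for all $i,j$. $R$ is then generated by the $\mathbf 1_{\mathbf x}$, the crossings, and the restricted dots $dot_i(\mathbf a,\mathbf x)$ with $x_n>i+2$ for all $n$. The differential (degree $+1$) satisfies $d(r_1r_2)=d(r_1)r_2+(-1)^{\deg r_1}r_1d(r_2)$, $d(cr_{i,i}(\mathbf a,\mathbf x))=\mathbf 1_{\mathbf a\odot(i,i)\odot\mathbf x}$, and is $0$ on the other generators of this smaller set. $R=\bigoplus_kR_k$, $R_k=\bigoplus_{\mathbf x,\mathbf y\in\mathcal M_k}\mathbf 1_{\mathbf x}R\mathbf 1_{\mathbf y}$. $P(\mathbf x)=R\cdot\mathbf 1_{\mathbf x}$. $DGP(R)$ is the smallest full DG subcategory of the DG category of DG $R$-modules containing $\{P(\mathbf x):\mathbf x\in\mathcal M\}$ and closed under grading shifts and mapping cones; $DGP(R_k)$ is defined in the same way using $\mathbf x\in\mathcal M_k$. $\mathcal F$ is the homotopy category of $DGP(R)$; it decomposes as a disjoint union of the $\mathcal F_k$, the homotopy categories of $DGP(R_k)$, and $K_0(\mathcal F)=\bigoplus_kK_0(\mathcal F_k)$.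
   Formalization: The listed relations of R and the prescribed d are incompatible (commuting two dots i+2→i on adjacent strands forces 2(1⊙dot_i)cr_{i,i+2}(1⊙dot_i)=0, which does not follow from them); R is taken as the quotient by the differential ideal they generate. *)

theory Defs
  imports Complex_Main "HOL-Library.Stream" "HOL-Algebra.Free_Abelian_Groups"
begin

section \<open>Sequences of even integers\<close>

text \<open>
  A sequence \<open>(x\<^sub>1, x\<^sub>2, \<dots>)\<close> is a stream, and streams are indexed from 0, so \<open>x\<^sub>i\<close> is \<open>x !! (i - 1)\<close>.
  Concatenation of a finite sequence with an infinite one is the library's \<open>a @- x\<close>.
\<close>

definition seqM :: "int stream set" where
  "seqM = {x. (\<forall>n. even (x !! n)) \<and> (\<exists>N. \<forall>n\<ge>N. x !! Suc n = x !! n + 2)}"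

definition seqMk :: "int \<Rightarrow> int stream set" where
  "seqMk k = {x \<in> seqM. \<exists>N. \<forall>n\<ge>N. x !! n = 2 * (int n + 1) + 2 * k}"

definition seqIM :: "int stream set" where
  "seqIM = {x \<in> seqM. strict_mono (snth x)}"

definition seqIMk :: "int \<Rightarrow> int stream set" where
  "seqIMk k = {x \<in> seqMk k. strict_mono (snth x)}"

abbreviation V_F :: "(int stream \<Rightarrow>\<^sub>0 int) monoid" where
  "V_F \<equiv> free_Abelian_group seqIM"

abbreviation V_Fk :: "int \<Rightarrow> (int stream \<Rightarrow>\<^sub>0 int) monoid" where
  "V_Fk k \<equiv> free_Abelian_group (seqIMk k)"


section \<open>The DG algebra \<open>R\<close>\<close>

text \<open>
  Elementary diagrams without the surrounding vertical strands: \<open>Cr i j\<close> goes from \<open>(j, i)\<close> at the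
  bottom to \<open>(i, j)\<close> at the top, \<open>Dot i\<close> goes from \<open>(i + 2)\<close> to \<open>(i)\<close>.
\<close>

datatype piece = Cr int int | Dot int

primrec src :: "piece \<Rightarrow> int list" where
  "src (Cr i j) = [j, i]"
| "src (Dot i) = [i + 2]"

primrec tgt :: "piece \<Rightarrow> int list" where
  "tgt (Cr i j) = [i, j]"
| "tgt (Dot i) = [i]"

primrec piece_deg :: "piece \<Rightarrow> int" where
  "piece_deg (Cr i j) = (if i < j then 1 else -1)"
| "piece_deg (Dot i) = 0"

text \<open>\<open>Local s a x\<close> is \<open>s\<close> with vertical strands \<open>a\<close> to its left and \<open>x\<close> to its right.\<close>

datatype gen = Strands "int stream" | Local piece "int list" "int stream"

primrec bot_seq :: "gen \<Rightarrow> int stream" where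
  "bot_seq (Strands x) = x"
| "bot_seq (Local s a x) = a @- src s @- x"

primrec top_seq :: "gen \<Rightarrow> int stream" where
  "top_seq (Strands x) = x"
| "top_seq (Local s a x) = a @- tgt s @- x"

primrec gen_deg :: "gen \<Rightarrow> int" where
  "gen_deg (Strands x) = 0"
| "gen_deg (Local s a x) = piece_deg s"

text \<open>
  \<open>R\<close> is presented as a (non-unital) DG algebra: a quotient of the algebra of formal expressions in the
  diagrams, with a formal differential \<open>TDiff\<close>.
\<close>

datatype 'k rterm =
    TGen gen
  | TZero
  | TAdd "'k rterm" "'k rterm"
  | TScale 'k "'k rterm"
  | TMul "'k rterm" "'k rterm"
  | TDiff "'k rterm"

definition ksgn :: "int \<Rightarrow> 'k::field_char_0" where
  "ksgn n = (if even n then 1 else -1)"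

text \<open>The sign automorphism \<open>r \<mapsto> (-1)\<^bsup>deg r\<^esup> r\<close> on expressions.\<close>

primrec tpar :: "'k::field_char_0 rterm \<Rightarrow> 'k rterm" where
  "tpar (TGen g) = TScale (ksgn (gen_deg g)) (TGen g)"
| "tpar TZero = TZero"
| "tpar (TAdd t u) = TAdd (tpar t) (tpar u)"
| "tpar (TScale c t) = TScale c (tpar t)"
| "tpar (TMul t u) = TMul (tpar t) (tpar u)"
| "tpar (TDiff t) = TScale (-1) (TDiff (tpar t))"

text \<open>
  The product \<open>TMul f g\<close> has \<open>f\<close> at the bottom and \<open>g\<close> at the top.

  Rule \<open>kill\<close> removes the symbols which are not diagrams of \<open>R\<close>, that is, those having an odd label or a
  wrong tail. In each of the local relations all labels have to be even for one symbol to survive, and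
  otherwise both sides vanish; so these relations need no side conditions on the labels.

  The values of the differential are prescribed on the idempotents, on the crossings, and on the dots
  \<open>dot\<^sub>i(a, x)\<close> for which all \<open>x\<^sub>n > i + 2\<close>. On the other dots they follow from \<open>dot_slide\<close>.

  The relation is closed under \<open>TDiff\<close>, so \<open>R\<close> is the quotient by the \<^emph>\<open>differential\<close> ideal generated by
  the relations. This matters in one place: on two neighbouring strands, the differential of the
  relation that two dots \<open>i + 2 \<rightarrow> i\<close> commute yields
  \<open>2 (1\<^bsub>i+2\<^esub> \<odot> dot\<^sub>i) cr\<^bsub>i,i+2\<^esub> (1\<^sub>i \<odot> dot\<^sub>i) = 0\<close>, which the other relations do not imply and without
  which the differential would not be defined on \<open>R\<close>.
\<close>

inductive req :: "'k::field_char_0 rterm \<Rightarrow> 'k rterm \<Rightarrow> bool" where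
  \<comment> \<open>congruence\<close>
  req_refl: "req t t"
| req_sym: "req t u \<Longrightarrow> req u t"
| req_trans: "req t u \<Longrightarrow> req u v \<Longrightarrow> req t v"
| cong_add: "req t t' \<Longrightarrow> req u u' \<Longrightarrow> req (TAdd t u) (TAdd t' u')"
| cong_scale: "req t t' \<Longrightarrow> req (TScale c t) (TScale c t')"
| cong_mul: "req t t' \<Longrightarrow> req u u' \<Longrightarrow> req (TMul t u) (TMul t' u')"
| cong_diff: "req t t' \<Longrightarrow> req (TDiff t) (TDiff t')"
  \<comment> \<open>associative algebra\<close>
| add_assoc: "req (TAdd (TAdd t u) v) (TAdd t (TAdd u v))"
| add_comm: "req (TAdd t u) (TAdd u t)"
| add_zero: "req (TAdd TZero t) t"
| scale_zero: "req (TScale 0 t) TZero"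
| scale_one: "req (TScale 1 t) t"
| scale_scale: "req (TScale c (TScale c' t)) (TScale (c * c') t)"
| scale_add_left: "req (TScale (c + c') t) (TAdd (TScale c t) (TScale c' t))"
| scale_add_right: "req (TScale c (TAdd t u)) (TAdd (TScale c t) (TScale c u))"
| mul_assoc: "req (TMul (TMul t u) v) (TMul t (TMul u v))"
| mul_add_left: "req (TMul (TAdd t u) v) (TAdd (TMul t v) (TMul u v))"
| mul_add_right: "req (TMul t (TAdd u v)) (TAdd (TMul t u) (TMul t v))"
| mul_scale_left: "req (TMul (TScale c t) u) (TScale c (TMul t u))"
| mul_scale_right: "req (TMul t (TScale c u)) (TScale c (TMul t u))"
  \<comment> \<open>derivation\<close>
| diff_add: "req (TDiff (TAdd t u)) (TAdd (TDiff t) (TDiff u))"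
| diff_scale: "req (TDiff (TScale c t)) (TScale c (TDiff t))"
| diff_mul: "req (TDiff (TMul t u)) (TAdd (TMul (TDiff t) u) (TMul (tpar t) (TDiff u)))"
  \<comment> \<open>relations between diagrams\<close>
| kill: "bot_seq g \<notin> seqM \<Longrightarrow> req (TGen g) TZero"
| idem_left: "req (TMul (TGen (Strands x)) (TGen g)) (if x = bot_seq g then TGen g else TZero)"
| idem_right: "req (TMul (TGen g) (TGen (Strands x))) (if x = top_seq g then TGen g else TZero)"
| supercomm: "req
    (TMul (TGen (Local s a (c @- src t @- x))) (TGen (Local t (a @ tgt s @ c) x)))
    (TScale (ksgn (piece_deg s * piece_deg t))
      (TMul (TGen (Local t (a @ src s @ c) x)) (TGen (Local s a (c @- tgt t @- x)))))"
| dot_dot: "req (TMul (TGen (Local (Dot (i + 2)) a x)) (TGen (Local (Dot i) a x))) TZero"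
| cr_cr: "req
    (TMul (TGen (Local (Cr j i) a x)) (TGen (Local (Cr i j) a x)))
    (if i = j then TZero else TGen (Strands (a @- [i, j] @- x)))"
| braid: "req
    (TMul (TMul (TGen (Local (Cr j k) a (i ## x))) (TGen (Local (Cr i k) (a @ [j]) x)))
      (TGen (Local (Cr i j) a (k ## x))))
    (TMul (TMul (TGen (Local (Cr i j) (a @ [k]) x)) (TGen (Local (Cr i k) a (j ## x))))
      (TGen (Local (Cr j k) (a @ [i]) x)))"
| dot_slide: "req
    (TGen (Local (Dot i) a (j ## x)))
    (TMul (TMul (TGen (Local (Cr j (i + 2)) a x)) (TGen (Local (Dot i) (a @ [j]) x)))
      (TGen (Local (Cr i j) a x)))"
  \<comment> \<open>values of the differential\<close>
| diff_idem: "req (TDiff (TGen (Strands x))) TZero"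
| diff_cr: "req (TDiff (TGen (Local (Cr i j) a x)))
    (if i = j then TGen (Strands (a @- [i, i] @- x)) else TZero)"
| diff_dot: "(\<forall>n. x !! n > i + 2) \<Longrightarrow> req (TDiff (TGen (Local (Dot i) a x))) TZero"

quotient_type (overloaded) 'k ralg = "('k::field_char_0) rterm" / req
  by (intro equivpI reflpI sympI transpI) (rule req_refl, erule req_sym, erule (1) req_trans)

lemma ksgn_add: "ksgn (m + n) = (ksgn m * ksgn n :: 'k::field_char_0)"
  by (simp add: ksgn_def)

lemma req_zero_scale: "req TZero (TScale c TZero)"
proof -
  have "req (TScale c TZero) (TScale c (TScale 0 TZero))"
    by (rule cong_scale, rule req_sym, rule scale_zero)
  moreover have "req (TScale c (TScale 0 TZero)) (TScale 0 TZero)"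
    by (metis scale_scale mult_zero_right)
  ultimately show ?thesis
    by (meson req_sym req_trans scale_zero)
qed

definition tpar_eigen :: "'k::field_char_0 \<Rightarrow> 'k rterm \<Rightarrow> bool" where
  "tpar_eigen c t \<longleftrightarrow> req (tpar t) (TScale c t)"

lemma tpar_eigen_gen: "c = ksgn (gen_deg g) \<Longrightarrow> tpar_eigen c (TGen g)"
  by (simp add: tpar_eigen_def req_refl)

lemma tpar_eigen_zero: "tpar_eigen c TZero"
  by (simp add: tpar_eigen_def req_zero_scale)

lemma tpar_eigen_scale: "tpar_eigen c t \<Longrightarrow> tpar_eigen c (TScale c' t)"
  unfolding tpar_eigen_def tpar.simps
  by (metis cong_scale mult.commute req_sym req_trans scale_scale)

lemma tpar_eigen_mul:
  assumes "tpar_eigen c t" "tpar_eigen c' u" "c'' = c * c'"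
  shows "tpar_eigen c'' (TMul t u)"
proof -
  have "req (TMul (tpar t) (tpar u)) (TMul (TScale c t) (TScale c' u))"
    using assms unfolding tpar_eigen_def by (blast intro: cong_mul)
  moreover have "req (TMul (TScale c t) (TScale c' u)) (TScale (c * c') (TMul t u))"
    by (meson cong_scale mul_scale_left mul_scale_right req_trans scale_scale)
  ultimately show ?thesis
    using assms(3) unfolding tpar_eigen_def tpar.simps by (blast intro: req_trans)
qed

lemma tpar_eigen_diff:
  assumes "tpar_eigen c t" "c' = - c"
  shows "tpar_eigen c' (TDiff t)"
proof -
  have "req (TDiff (tpar t)) (TScale c (TDiff t))"
    using assms unfolding tpar_eigen_def by (meson cong_diff diff_scale req_trans)
  then have "req (TScale (-1) (TDiff (tpar t))) (TScale (-1 * c) (TDiff t))"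
    by (meson cong_scale req_trans scale_scale)
  then show ?thesis
    using assms(2) unfolding tpar_eigen_def by simp
qed

lemma tpar_eigen_rel:
  "req t u \<Longrightarrow> tpar_eigen c t \<Longrightarrow> tpar_eigen c u \<Longrightarrow> req (tpar t) (tpar u)"
  unfolding tpar_eigen_def by (meson cong_scale req_sym req_trans)

lemmas tpar_eigen_intros =
  tpar_eigen_gen tpar_eigen_zero tpar_eigen_scale tpar_eigen_mul tpar_eigen_diff

lemma req_tpar: "req t u \<Longrightarrow> req (tpar t) (tpar u)"
proof (induction rule: req.induct)
  case (cong_diff t t')
  then show ?case by simp (intro cong_scale req.cong_diff)
next
  case (scale_zero t) show ?case by (simp add: req.scale_zero)
next
  case (mul_scale_right t c u) show ?case by (simp add: req.mul_scale_right)
next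
  case (diff_add t u)
  show ?case
    by simp (meson cong_scale req.diff_add scale_add_right req_trans)
next
  case (diff_scale c t)
  have "req (TScale (-1) (TDiff (TScale c (tpar t)))) (TScale (-1 * c) (TDiff (tpar t)))"
    by (meson cong_scale req.diff_scale scale_scale req_trans)
  moreover have "req (TScale (-1 * c) (TDiff (tpar t))) (TScale c (TScale (-1) (TDiff (tpar t))))"
    by (metis mult.commute req_sym scale_scale)
  ultimately show ?case by simp (blast intro: req_trans)
next
  case (diff_mul t u)
  let ?t = "tpar t" and ?u = "tpar u"
  have "req (TScale (-1) (TDiff (TMul ?t ?u)))
      (TScale (-1) (TAdd (TMul (TDiff ?t) ?u) (TMul (tpar ?t) (TDiff ?u))))"
    by (intro cong_scale req.diff_mul)
  moreover have "req (TScale (-1) (TAdd (TMul (TDiff ?t) ?u) (TMul (tpar ?t) (TDiff ?u))))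
     (TAdd (TScale (-1) (TMul (TDiff ?t) ?u)) (TScale (-1) (TMul (tpar ?t) (TDiff ?u))))"
    by (rule scale_add_right)
  moreover have "req
     (TAdd (TScale (-1) (TMul (TDiff ?t) ?u)) (TScale (-1) (TMul (tpar ?t) (TDiff ?u))))
     (TAdd (TMul (TScale (-1) (TDiff ?t)) ?u) (TMul (tpar ?t) (TScale (-1) (TDiff ?u))))"
    by (intro cong_add req_sym[OF mul_scale_left] req_sym[OF mul_scale_right])
  ultimately show ?case by simp (blast intro: req_trans)
next
  case (kill g)
  show ?case
    by (rule tpar_eigen_rel[OF req.kill[OF kill]]) (rule tpar_eigen_intros refl)+
next
  case (idem_left x g)
  show ?case
    by (rule tpar_eigen_rel[OF req.idem_left, where c = "ksgn (gen_deg g)"])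
       (auto intro!: tpar_eigen_intros simp: ksgn_def)
next
  case (idem_right g x)
  show ?case
    by (rule tpar_eigen_rel[OF req.idem_right, where c = "ksgn (gen_deg g)"])
       (auto intro!: tpar_eigen_intros simp: ksgn_def)
next
  case (supercomm s a c t x)
  show ?case
    by (rule tpar_eigen_rel[OF req.supercomm, where c = "ksgn (piece_deg s) * ksgn (piece_deg t)"];
        (rule tpar_eigen_intros refl)+; simp add: mult.commute)
next
  case (dot_dot i a x)
  show ?case
    by (rule tpar_eigen_rel[OF req.dot_dot]) (rule tpar_eigen_intros refl)+
next
  case (cr_cr j i a x)
  show ?case
    by (rule tpar_eigen_rel[OF req.cr_cr, where c = 1])
       (auto intro!: tpar_eigen_intros simp: ksgn_def)
next
  case (braid j k a i x)
  show ?case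
    by (rule tpar_eigen_rel[OF req.braid, where
          c = "ksgn (piece_deg (Cr j k)) * ksgn (piece_deg (Cr i k)) * ksgn (piece_deg (Cr i j))"];
        (rule tpar_eigen_intros refl)+; simp add: ksgn_def)
next
  case (dot_slide i a j x)
  show ?case
    by (rule tpar_eigen_rel[OF req.dot_slide, where c = 1];
        (rule tpar_eigen_intros refl)+; simp add: ksgn_def)
next
  case (diff_idem x)
  show ?case
    by (rule tpar_eigen_rel[OF req.diff_idem]) (rule tpar_eigen_intros refl)+
next
  case (diff_cr i j a x)
  show ?case
    by (rule tpar_eigen_rel[OF req.diff_cr, where c = 1])
       (auto intro!: tpar_eigen_intros simp: ksgn_def)
next
  case (diff_dot x i a)
  show ?case
    by (rule tpar_eigen_rel[OF req.diff_dot[OF diff_dot]]) (rule tpar_eigen_intros refl)+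
qed (unfold tpar.simps, (rule req.intros; assumption)+)

instantiation ralg :: (field_char_0) ring
begin

lift_definition zero_ralg :: "'a ralg" is TZero .
lift_definition plus_ralg :: "'a ralg \<Rightarrow> 'a ralg \<Rightarrow> 'a ralg" is TAdd by (rule cong_add)
lift_definition times_ralg :: "'a ralg \<Rightarrow> 'a ralg \<Rightarrow> 'a ralg" is TMul by (rule cong_mul)
lift_definition uminus_ralg :: "'a ralg \<Rightarrow> 'a ralg" is "TScale (-1)" by (rule cong_scale)

definition minus_ralg :: "'a ralg \<Rightarrow> 'a ralg \<Rightarrow> 'a ralg" where
  "minus_ralg r s = r + (- s)"

instance
proof
  fix r s t :: "'a ralg"
  show "r * s * t = r * (s * t)" by transfer (rule mul_assoc)
  show "(r + s) * t = r * t + s * t" by transfer (rule mul_add_left)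
  show "r * (s + t) = r * s + r * t" by transfer (rule mul_add_right)
  show "r + s + t = r + (s + t)" by transfer (rule add_assoc)
  show "r + s = s + r" by transfer (rule add_comm)
  show "0 + r = r" by transfer (rule add_zero)
  show "r - s = r + - s" by (rule minus_ralg_def)
  show "- r + r = 0"
  proof transfer
    fix t :: "'a rterm"
    have "req (TAdd (TScale (-1) t) t) (TAdd (TScale (-1) t) (TScale 1 t))"
      by (intro cong_add req_refl req_sym[OF scale_one])
    moreover have "req (TAdd (TScale (-1) t) (TScale 1 t)) (TScale (-1 + 1) t)"
      by (rule req_sym, rule scale_add_left)
    ultimately show "req (TAdd (TScale (-1) t) t) TZero"
      by (metis add.left_inverse req_trans scale_zero)
  qed
qed

end

lift_definition rgen :: "gen \<Rightarrow> 'k::field_char_0 ralg" is TGen .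
lift_definition rscale :: "'k::field_char_0 \<Rightarrow> 'k ralg \<Rightarrow> 'k ralg" is TScale by (rule cong_scale)
lift_definition rdiff :: "'k::field_char_0 ralg \<Rightarrow> 'k ralg" is TDiff by (rule cong_diff)
lift_definition rpar :: "'k::field_char_0 ralg \<Rightarrow> 'k ralg" is tpar by (rule req_tpar)

abbreviation ridem :: "int stream \<Rightarrow> 'k::field_char_0 ralg" where
  "ridem x \<equiv> rgen (Strands x)"

text \<open>The homogeneous component of degree \<open>n\<close> of \<open>R\<close>.\<close>

inductive rdeg :: "int \<Rightarrow> 'k::field_char_0 ralg \<Rightarrow> bool" where
  "rdeg (gen_deg g) (rgen g)"
| "rdeg n 0"
| "rdeg n r \<Longrightarrow> rdeg n s \<Longrightarrow> rdeg n (r + s)"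
| "rdeg n r \<Longrightarrow> rdeg n (rscale c r)"
| "rdeg m r \<Longrightarrow> rdeg n s \<Longrightarrow> rdeg (m + n) (r * s)"

text \<open>So \<open>rpar\<close> is indeed \<open>r \<mapsto> (-1)\<^bsup>deg r\<^esup> r\<close>.\<close>

lemma rpar_rdeg: "rdeg n r \<Longrightarrow> rpar r = rscale (ksgn n) r"
proof (induction rule: rdeg.induct)
  case (1 g) show ?case by transfer (simp add: req_refl)
next
  case (2 n) show ?case by transfer (simp add: req_zero_scale)
next
  case (3 n r s)
  have "rpar (r + s) = rpar r + rpar s" by transfer (simp add: req_refl)
  moreover have "rscale (ksgn n) (r + s) = rscale (ksgn n) r + rscale (ksgn n) s"
    by transfer (rule scale_add_right)
  ultimately show ?case using 3 by simp
next
  case (4 n r c)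
  have "rpar r = rscale (ksgn n) r \<Longrightarrow> rpar (rscale c r) = rscale (ksgn n) (rscale c r)"
    by transfer (fold tpar_eigen_def, rule tpar_eigen_scale)
  then show ?case using 4 by simp
next
  case (5 m r n s)
  have "rpar r = rscale (ksgn m) r \<Longrightarrow> rpar s = rscale (ksgn n) s \<Longrightarrow>
      rpar (r * s) = rscale (ksgn (m + n)) (r * s)"
    by transfer (fold tpar_eigen_def, erule (1) tpar_eigen_mul, rule ksgn_add)
  then show ?case using 5 by simp
qed


section \<open>DG modules\<close>

text \<open>
  Graded left \<open>R\<close>-modules with a differential of degree 1: carrier, homogeneous components, addition,
  zero, scalars, action of \<open>R\<close> and differential. The record does not impose the module axioms; they,
  and unitality with respect to the idempotents, hold for \<open>P(x)\<close> and are inherited by shifts and cones,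
  and no other objects are used below.
\<close>

record (overloaded) ('k, 'm) dgmod =
  mcar :: "'m set"
  mdeg :: "int \<Rightarrow> 'm set"
  madd :: "'m \<Rightarrow> 'm \<Rightarrow> 'm"
  mzero :: "'m"
  mscale :: "'k \<Rightarrow> 'm \<Rightarrow> 'm"
  mact :: "'k ralg \<Rightarrow> 'm \<Rightarrow> 'm"
  mdiff :: "'m \<Rightarrow> 'm"

text \<open>
  The homomorphisms of degree \<open>n\<close> in the DG category of left DG modules, with
  \<open>f (r m) = (-1)\<^bsup>n deg r\<^esup> r f(m)\<close>; functions are irrelevant outside the carrier. The differential is
  \<open>f \<mapsto> d \<circ> f - (-1)\<^sup>n f \<circ> d\<close>.
\<close>

definition dg_hom ::
  "('k::field_char_0, 'm) dgmod \<Rightarrow> ('k, 'n) dgmod \<Rightarrow> int \<Rightarrow> ('m \<Rightarrow> 'n) set" where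
  "dg_hom M N n = {f.
     (\<forall>x\<in>mcar M. f x \<in> mcar N) \<and>
     (\<forall>p. \<forall>x\<in>mdeg M p. f x \<in> mdeg N (p + n)) \<and>
     (\<forall>x\<in>mcar M. \<forall>y\<in>mcar M. f (madd M x y) = madd N (f x) (f y)) \<and>
     (\<forall>c. \<forall>x\<in>mcar M. f (mscale M c x) = mscale N c (f x)) \<and>
     (\<forall>q r. rdeg q r \<longrightarrow>
       (\<forall>x\<in>mcar M. f (mact M r x) = mscale N (ksgn (n * q)) (mact N r (f x))))}"

text \<open>Closed homomorphisms of degree 0, and the relation of differing by a boundary.\<close>

definition dg_Z0 ::
  "('k::field_char_0, 'm) dgmod \<Rightarrow> ('k, 'n) dgmod \<Rightarrow> ('m \<Rightarrow> 'n) set" where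
  "dg_Z0 M N = {f \<in> dg_hom M N 0. \<forall>x\<in>mcar M. f (mdiff M x) = mdiff N (f x)}"

definition homotopy_rel ::
  "('k::field_char_0, 'm) dgmod \<Rightarrow> ('k, 'n) dgmod \<Rightarrow> (('m \<Rightarrow> 'n) \<times> ('m \<Rightarrow> 'n)) set" where
  "homotopy_rel M N = {(f, g). f \<in> dg_Z0 M N \<and> g \<in> dg_Z0 M N \<and>
     (\<exists>h\<in>dg_hom M N (-1). \<forall>x\<in>mcar M.
        f x = madd N (g x) (madd N (mdiff N (h x)) (h (mdiff M x))))}"

abbreviation hclass ::
  "('k::field_char_0, 'm) dgmod \<Rightarrow> ('k, 'n) dgmod \<Rightarrow> ('m \<Rightarrow> 'n) \<Rightarrow> ('m \<Rightarrow> 'n) set" where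
  "hclass M N f \<equiv> homotopy_rel M N `` {f}"

text \<open>\<open>shift n M = M[n]\<close>, where \<open>M[n]\<^sup>p = M\<^bsup>n+p\<^esup>\<close> and both the action and the differential get signs.\<close>

definition shift :: "int \<Rightarrow> ('k::field_char_0, 'm) dgmod \<Rightarrow> ('k, 'm) dgmod" where
  "shift n M = M\<lparr>
     mdeg := (\<lambda>p. mdeg M (p + n)),
     mact := (\<lambda>r. mact M (if even n then r else rpar r)),
     mdiff := (\<lambda>x. mscale M (ksgn n) (mdiff M x))\<rparr>"

text \<open>
  Binary trees provide one type which contains the left ideals of \<open>R\<close> and is closed under forming
  pairs. All objects below have their elements in it.
\<close>

datatype 'a pairs = Leaf (leaf: 'a) | Pair (lft: "'a pairs") (rgt: "'a pairs")

type_synonym 'k dgobj = "('k, 'k ralg pairs) dgmod"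

text \<open>The mapping cone \<open>N \<oplus> M[1]\<close> of \<open>f: M \<rightarrow> N\<close>, with differential \<open>(y, x) \<mapsto> (d y + f x, - d x)\<close>.\<close>

definition cone :: "'k::field_char_0 dgobj \<Rightarrow> 'k dgobj \<Rightarrow> ('k ralg pairs \<Rightarrow> 'k ralg pairs) \<Rightarrow> 'k dgobj"
  where
  "cone M N f = (let M' = shift 1 M in \<lparr>
     mcar = {Pair y x | y x. y \<in> mcar N \<and> x \<in> mcar M'},
     mdeg = (\<lambda>p. {Pair y x | y x. y \<in> mdeg N p \<and> x \<in> mdeg M' p}),
     madd = (\<lambda>u v. Pair (madd N (lft u) (lft v)) (madd M' (rgt u) (rgt v))),
     mzero = Pair (mzero N) (mzero M'),
     mscale = (\<lambda>c u. Pair (mscale N c (lft u)) (mscale M' c (rgt u))),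
     mact = (\<lambda>r u. Pair (mact N r (lft u)) (mact M' r (rgt u))),
     mdiff = (\<lambda>u. Pair (madd N (mdiff N (lft u)) (f (rgt u))) (mdiff M' (rgt u)))\<rparr>)"

text \<open>\<open>P(x) = R \<cdot> 1\<^sub>x\<close>\<close>

definition projP :: "int stream \<Rightarrow> 'k::field_char_0 dgobj" where
  "projP x = \<lparr>
     mcar = {Leaf (r * ridem x) | r. True},
     mdeg = (\<lambda>p. {Leaf (r * ridem x) | r. rdeg p r}),
     madd = (\<lambda>u v. Leaf (leaf u + leaf v)),
     mzero = Leaf 0,
     mscale = (\<lambda>c u. Leaf (rscale c (leaf u))),
     mact = (\<lambda>r u. Leaf (r * leaf u)),
     mdiff = (\<lambda>u. Leaf (rdiff (leaf u)))\<rparr>"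

text \<open>
  The objects of the smallest full DG subcategory containing the \<open>P(x)\<close>, \<open>x \<in> S\<close>, and closed under
  shifts and mapping cones.
\<close>

inductive_set DGP :: "int stream set \<Rightarrow> 'k::field_char_0 dgobj set" for S where
  DGP_proj: "x \<in> S \<Longrightarrow> projP x \<in> DGP S"
| DGP_shift: "M \<in> DGP S \<Longrightarrow> shift n M \<in> DGP S"
| DGP_cone: "M \<in> DGP S \<Longrightarrow> N \<in> DGP S \<Longrightarrow> f \<in> dg_Z0 M N \<Longrightarrow> cone M N f \<in> DGP S"


section \<open>Triangulated categories and their Grothendieck groups\<close>

text \<open>
  A category and the part of a triangulated structure that enters \<open>K\<^sub>0\<close>. \<open>Comp A B C v u\<close> is the composite of
  \<open>u: A \<rightarrow> B\<close> and \<open>v: B \<rightarrow> C\<close>, and \<open>Tri\<close> consists of the distinguished triangles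
  \<open>A \<rightarrow> B \<rightarrow> C \<rightarrow> A[1]\<close>, given as \<open>(A, B, C, u, v, w)\<close>.
\<close>

record ('o, 'h) cat =
  Ob :: "'o set"
  Hom :: "'o \<Rightarrow> 'o \<Rightarrow> 'h set"
  Ident :: "'o \<Rightarrow> 'h"
  Comp :: "'o \<Rightarrow> 'o \<Rightarrow> 'o \<Rightarrow> 'h \<Rightarrow> 'h \<Rightarrow> 'h"

record ('o, 'h) tri_cat = "('o, 'h) cat" +
  Tri :: "('o \<times> 'o \<times> 'o \<times> 'h \<times> 'h \<times> 'h) set"

definition cat_iso :: "('o, 'h, 'z) cat_scheme \<Rightarrow> 'o \<Rightarrow> 'o \<Rightarrow> 'h set" where
  "cat_iso T A B = {u \<in> Hom T A B. \<exists>v\<in>Hom T B A.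
     Comp T A B A v u = Ident T A \<and> Comp T B A B u v = Ident T B}"

definition K0_relations :: "('o, 'h, 'z) tri_cat_scheme \<Rightarrow> ('o \<Rightarrow>\<^sub>0 int) set" where
  "K0_relations T =
     {frag_of A - frag_of B | A B. A \<in> Ob T \<and> B \<in> Ob T \<and> cat_iso T A B \<noteq> {}} \<union>
     {frag_of B - frag_of A - frag_of C | A B C. \<exists>u v w. (A, B, C, u, v, w) \<in> Tri T}"

definition K0_subgroup :: "('o, 'h, 'z) tri_cat_scheme \<Rightarrow> ('o \<Rightarrow>\<^sub>0 int) set" where
  "K0_subgroup T = generate (free_Abelian_group (Ob T)) (K0_relations T)"

definition K0 :: "('o, 'h, 'z) tri_cat_scheme \<Rightarrow> ('o \<Rightarrow>\<^sub>0 int) set monoid" where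
  "K0 T = free_Abelian_group (Ob T) Mod K0_subgroup T"

definition K0_class :: "('o, 'h, 'z) tri_cat_scheme \<Rightarrow> 'o \<Rightarrow> ('o \<Rightarrow>\<^sub>0 int) set" where
  "K0_class T A = K0_subgroup T #>\<^bsub>free_Abelian_group (Ob T)\<^esub> frag_of A"


section \<open>The homotopy category\<close>

type_synonym 'k hmap = "('k ralg pairs \<Rightarrow> 'k ralg pairs) set"

definition ho_comp ::
  "'k::field_char_0 dgobj \<Rightarrow> 'k dgobj \<Rightarrow> 'k dgobj \<Rightarrow> 'k hmap \<Rightarrow> 'k hmap \<Rightarrow> 'k hmap" where
  "ho_comp A B C v u = (\<Union>f\<in>u. \<Union>g\<in>v. hclass A C (g \<circ> f))"

text \<open>The shift functor on homotopy classes; it does not change the underlying function.\<close>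

definition ho_shift :: "'k::field_char_0 dgobj \<Rightarrow> 'k dgobj \<Rightarrow> 'k hmap \<Rightarrow> 'k hmap" where
  "ho_shift A B u = (\<Union>f\<in>u. hclass (shift 1 A) (shift 1 B) f)"

definition ho_cat :: "'k::field_char_0 dgobj set \<Rightarrow> ('k dgobj, 'k hmap) cat" where
  "ho_cat S = \<lparr>
     Ob = S,
     Hom = (\<lambda>M N. dg_Z0 M N // homotopy_rel M N),
     Ident = (\<lambda>M. hclass M M id),
     Comp = ho_comp\<rparr>"

text \<open>
  The distinguished triangles: all triangles isomorphic to a standard one
  \<open>X \<rightarrow> Y \<rightarrow> cone f \<rightarrow> X[1]\<close>, where \<open>f: X \<rightarrow> Y\<close> is closed of degree 0.
\<close>

definition ho_tri ::
  "'k::field_char_0 dgobj set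
    \<Rightarrow> ('k dgobj \<times> 'k dgobj \<times> 'k dgobj \<times> 'k hmap \<times> 'k hmap \<times> 'k hmap) set" where
  "ho_tri S = {(A, B, C, u, v, w). A \<in> S \<and> B \<in> S \<and> C \<in> S \<and>
     u \<in> Hom (ho_cat S) A B \<and> v \<in> Hom (ho_cat S) B C \<and> w \<in> Hom (ho_cat S) C (shift 1 A) \<and>
     (\<exists>X\<in>S. \<exists>Y\<in>S. \<exists>f\<in>dg_Z0 X Y.
      \<exists>\<alpha>\<in>cat_iso (ho_cat S) A X. \<exists>\<beta>\<in>cat_iso (ho_cat S) B Y. \<exists>\<gamma>\<in>cat_iso (ho_cat S) C (cone X Y f).
        ho_comp A B Y \<beta> u = ho_comp A X Y (hclass X Y f) \<alpha> \<and>
        ho_comp B C (cone X Y f) \<gamma> v =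
          ho_comp B Y (cone X Y f) (hclass Y (cone X Y f) (\<lambda>y. Pair y (mzero X))) \<beta> \<and>
        ho_comp C (shift 1 A) (shift 1 X) (ho_shift A X \<alpha>) w =
          ho_comp C (cone X Y f) (shift 1 X) (hclass (cone X Y f) (shift 1 X) rgt) \<gamma>)}"

definition homotopy_category :: "'k::field_char_0 dgobj set \<Rightarrow> ('k dgobj, 'k hmap) tri_cat" where
  "homotopy_category S = cat.extend (ho_cat S) (tri_cat.fields (ho_tri S))"

definition catF :: "('k::field_char_0 dgobj, 'k hmap) tri_cat" where
  "catF = homotopy_category (DGP seqM)"

definition catFk :: "int \<Rightarrow> ('k::field_char_0 dgobj, 'k hmap) tri_cat" where
  "catFk k = homotopy_category (DGP (seqMk k))"

end

theory Submission
  imports Defs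
begin

text \<open>
  In the Grothendieck group, a crossing of two different labels identifies \<open>P(\<dots>, i, j, \<dots>)\<close> with \<open>P(\<dots>, j, i, \<dots>)\<close>
  up to an odd shift, that is, up to sign, and the differential of the crossing of two equal labels makes
  \<open>P(\<dots>, i, i, \<dots>)\<close> contractible. Sorting therefore shows that the classes of the \<open>P(x)\<close> with \<open>x\<close> increasing generate.

  For their independence, let a set \<open>A\<close> of labels be given. There is a graded \<open>R\<close>-module with zero differential which has one
  basis vector for every rearrangement of \<open>A\<close>: the crossings of different labels permute the basis vectors up to
  sign, the other crossings and all dots act by zero. For an object \<open>M\<close>, the space of graded homomorphisms from
  \<open>M\<close> to this module is finite-dimensional, and its Euler characteristic is additive on cones and a homotopy
  invariant, since the supertrace of a null-homotopic map vanishes. On \<open>P(x)\<close> with \<open>x\<close> increasing it is 1 if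
  \<open>x\<close> enumerates \<open>A\<close>, and 0 otherwise.
\<close>

section \<open>The algebra \<open>R\<close>\<close>

text \<open>\<open>R\<close> is known only through generators and relations, so the independence
  cannot be read off from a basis of \<open>R\<close>; whatever is needed about its size is obtained
  by evaluating it on a representation. Letting \<open>TDiff\<close> act by zero disposes of the
  closure of the relations under the differential in one stroke. The price is that an idempotent
  with two equal neighbours must act by zero, which is why only sequences without repeated labels
  carry basis vectors.

  Euler characteristics are treated as supertraces with values in the ground field: homotopy
  invariance is then a formal computation with coordinates of homomorphisms, and no homology is
  formed. Integers are recovered because the characteristic is zero. Only parities enter, so the
  representation is graded modulo 2.

  The isomorphism is built from the free group to K0, where it is given on generators, and then
  inverted. The Euler characteristics do not refer to the set of sequences that generates the
  category; the same numbers therefore serve every \<open>F_k\<close> and \<open>F\<close> and show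
  that the isomorphisms are compatible.\<close>

lemma ksgn_simps [simp]:
  "ksgn 0 = (1::'k::field_char_0)" "ksgn 1 = (-1::'k)" "ksgn (- n) = (ksgn n :: 'k)"
  "ksgn n * ksgn n = (1::'k)" "ksgn n * (ksgn n * c) = (c::'k)"
  by (auto simp: ksgn_def)

lemma ksgn_cong: "even (m - n) \<Longrightarrow> ksgn m = (ksgn n :: 'k::field_char_0)"
  by (auto simp: ksgn_def)

lemma rscale_scale [simp]: "rscale c (rscale c' r) = rscale (c * c') r"
  by transfer (rule scale_scale)

lemma rscale_one [simp]: "rscale 1 r = r"
  by transfer (rule scale_one)

lemma rscale_zero_left [simp]: "rscale 0 r = 0"
  by transfer (rule scale_zero)

lemma rscale_minus_one: "rscale (-1) r = - r"
  by transfer (rule req_refl)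

lemma rscale_add_right: "rscale c (r + s) = rscale c r + rscale c s"
  by transfer (rule scale_add_right)

lemma rscale_add_left: "rscale (c + c') r = rscale c r + rscale c' r"
  by transfer (rule scale_add_left)

lemma rscale_mult_left [simp]: "rscale c r * s = rscale c (r * s)"
  by transfer (rule mul_scale_left)

lemma rscale_mult_right [simp]: "r * rscale c s = rscale c (r * s)"
  by transfer (rule mul_scale_right)

lemma rdiff_add [simp]: "rdiff (r + s) = rdiff r + rdiff s"
  by transfer (rule diff_add)

lemma rdiff_scale [simp]: "rdiff (rscale c r) = rscale c (rdiff r)"
  by transfer (rule diff_scale)

lemma rdiff_zero [simp]: "rdiff 0 = 0"
  by (metis rdiff_scale rscale_zero_left)

lemma rdiff_uminus [simp]: "rdiff (- r) = - rdiff r"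
  by (metis rdiff_scale rscale_minus_one)

lemma rdiff_mult: "rdiff (r * s) = rdiff r * s + rpar r * rdiff s"
  by transfer (rule diff_mul)

lemma rpar_add [simp]: "rpar (r + s) = rpar r + rpar s"
  by transfer (simp add: req_refl)

lemma rpar_mult [simp]: "rpar (r * s) = rpar r * rpar s"
  by transfer (simp add: req_refl)

lemma rpar_scale [simp]: "rpar (rscale c r) = rscale c (rpar r)"
  by transfer (simp add: req_refl)

lemma rpar_zero [simp]: "rpar 0 = 0"
  by transfer (simp add: req_refl)

lemma rpar_uminus [simp]: "rpar (- r) = - rpar r"
  by (metis rpar_scale rscale_minus_one)

lemma rpar_gen [simp]: "rpar (rgen g) = rscale (ksgn (gen_deg g)) (rgen g)"
  by transfer (simp add: req_refl)

lemma rpar_rdiff [simp]: "rpar (rdiff r) = - rdiff (rpar r)"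
  by transfer (simp add: req_refl)

text \<open>The case \<open>diff\<close> is there because a formal expression may contain
  \<open>TDiff\<close> anywhere; an element is not known beforehand to be a combination of products
  of diagrams.\<close>

lemma ralg_induct [case_names gen zero add scale mult diff]:
  assumes "\<And>g. P (rgen g)" "P 0" "\<And>r s. P r \<Longrightarrow> P s \<Longrightarrow> P (r + s)"
    "\<And>c r. P r \<Longrightarrow> P (rscale c r)" "\<And>r s. P r \<Longrightarrow> P s \<Longrightarrow> P (r * s)" "\<And>r. P r \<Longrightarrow> P (rdiff r)"
  shows "P r"
proof -
  have "P (abs_ralg t)" for t
  proof (induction t)
    case (TGen g) then show ?case using assms(1) by (simp add: rgen.abs_eq)
  next
    case TZero then show ?case using assms(2) by (simp add: zero_ralg.abs_eq)
  next
    case (TAdd t u) then show ?case using assms(3) by (metis plus_ralg.abs_eq)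
  next
    case (TScale c t) then show ?case using assms(4) by (metis rscale.abs_eq)
  next
    case (TMul t u) then show ?case using assms(5) by (metis times_ralg.abs_eq)
  next
    case (TDiff t) then show ?case using assms(6) by (metis rdiff.abs_eq)
  qed
  then show ?thesis by (metis Quotient_abs_rep Quotient_ralg)
qed

lemma rpar_rpar [simp]: "rpar (rpar r) = r"
  by (induction r rule: ralg_induct) auto

lemma ridem_left: "ridem x * rgen g = (if x = bot_seq g then rgen g else 0)"
  by transfer (rule idem_left)

lemma ridem_right: "rgen g * ridem x = (if x = top_seq g then rgen g else 0)"
  by transfer (rule idem_right)

lemma ridem_idem [simp]: "ridem x * ridem x = ridem x"
  by (simp add: ridem_left)

lemma rgen_kill: "bot_seq g \<notin> seqM \<Longrightarrow> rgen g = 0"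
  by transfer (rule kill)

lemma rdiff_ridem [simp]: "rdiff (ridem x) = 0"
  by transfer (rule diff_idem)

lemma rdiff_cr: "rdiff (rgen (Local (Cr i j) a x)) = (if i = j then ridem (a @- [i, i] @- x) else 0)"
  by transfer (rule diff_cr)

lemma rdiff_dot: "\<forall>n. x !! n > i + 2 \<Longrightarrow> rdiff (rgen (Local (Dot i) a x)) = 0"
  by transfer (rule diff_dot)

lemma rgen_cr_cr: "rgen (Local (Cr j i) a x) * rgen (Local (Cr i j) a x) =
    (if i = j then 0 else ridem (a @- [i, j] @- x))"
  by transfer (rule cr_cr)

lemma rgen_dot_slide: "rgen (Local (Dot i) a (j ## x)) =
    rgen (Local (Cr j (i + 2)) a x) * rgen (Local (Dot i) (a @ [j]) x) * rgen (Local (Cr i j) a x)"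
  by transfer (rule dot_slide)

lemma rdeg_ridem [simp]: "rdeg 0 (ridem x)"
  using rdeg.intros(1)[of "Strands x"] by simp

lemma rdeg_uminus: "rdeg n r \<Longrightarrow> rdeg n (- r)"
  by (metis rdeg.intros(4) rscale_minus_one)

lemma rdeg_rpar: "rdeg n r \<Longrightarrow> rdeg n (rpar r)"
  by (simp add: rpar_rdeg rdeg.intros(4))

section \<open>Sequences with an arithmetic tail\<close>

lemma seqM_shift: "a @- x \<in> seqM \<Longrightarrow> x \<in> seqM"
proof -
  assume *: "a @- x \<in> seqM"
  have e: "(a @- x) !! (length a + n) = x !! n" for n
    by (simp add: shift_snth_ge)
  from * obtain N where N: "\<And>n. n \<ge> N \<Longrightarrow> (a @- x) !! Suc n = (a @- x) !! n + 2"
    and "\<And>n. even ((a @- x) !! n)" unfolding seqM_def by blast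
  moreover from this e have "even (x !! n)" for n by metis
  moreover have "x !! Suc n = x !! n + 2" if "n \<ge> N" for n
    using N[of "length a + n"] e[of n] e[of "Suc n"] that by simp
  ultimately show ?thesis unfolding seqM_def by blast
qed

lemma seqM_even: "x \<in> seqM \<Longrightarrow> n \<in> sset x \<Longrightarrow> even n"
  by (auto simp: seqM_def sset_range)

lemma seqM_linear_tail:
  assumes "x \<in> seqM"
  obtains N where "\<And>n. x !! (N + n) = x !! N + 2 * int n"
proof -
  from assms obtain N where N: "\<And>n. n \<ge> N \<Longrightarrow> x !! Suc n = x !! n + 2"
    unfolding seqM_def by blast
  have "x !! (N + n) = x !! N + 2 * int n" for n
  proof (induction n)
    case (Suc n)
    then show ?case using N[of "N + n"] by (simp del: snth.simps)
  qed simp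
  then show thesis using that by blast
qed

lemma seqM_eventually_gt:
  assumes "x \<in> seqM"
  shows "\<exists>N. \<forall>n\<ge>N. x !! n > c"
proof -
  obtain N where N: "\<And>n. x !! (N + n) = x !! N + 2 * int n"
    using seqM_linear_tail[OF assms] by blast
  have "x !! n > c" if "n \<ge> N + nat (c - x !! N + 1)" for n
    using N[of "n - N"] that by simp
  then show ?thesis by blast
qed

section \<open>Homogeneity of the differential\<close>

lemma rdeg_rdiff_cr: "rdeg (piece_deg (Cr i j) + 1) (rdiff (rgen (Local (Cr i j) a x)))"
  by (auto simp: rdiff_cr intro: rdeg.intros)

lemma rdeg_rdiff_mult:
  assumes "rdeg m r" "rdeg (m + 1) (rdiff r)" "rdeg n s" "rdeg (n + 1) (rdiff s)"
  shows "rdeg (m + n + 1) (rdiff (r * s))"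
proof -
  have "rdeg ((m + 1) + n) (rdiff r * s)" "rdeg (m + (n + 1)) (rpar r * rdiff s)"
    using assms by (auto intro: rdeg.intros rdeg_rpar)
  then show ?thesis unfolding rdiff_mult
    by (intro rdeg.intros(3)) (simp_all add: ac_simps)
qed

text \<open>Only a dot whose right-hand labels all exceed \<open>i + 2\<close> has a prescribed
  derivative. Since labels grow along the tail, sliding the dot to the right past finitely many
  strands reaches such a dot; each slide flanks it by two crossings of known derivative, and the
  Leibniz rule carries the degree along.\<close>

lemma rdeg_rdiff_dot: "rdeg 1 (rdiff (rgen (Local (Dot i) a x)) :: 'k::field_char_0 ralg)"
proof -
  have main: "\<forall>n\<ge>N. x !! n > i + 2 \<Longrightarrow> rdeg 1 (rdiff (rgen (Local (Dot i) a x)) :: 'k ralg)" for N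
  proof (induction N arbitrary: a x)
    case 0
    then show ?case by (simp add: rdiff_dot rdeg.intros)
  next
    case (Suc N)
    show ?case
    proof (cases "bot_seq (Local (Dot i) a x) \<in> seqM")
      case False
      then show ?thesis by (simp add: rgen_kill rdeg.intros)
    next
      case True
      obtain j y where x: "x = j ## y" by (cases x) auto
      have "even (i + 2)" "even j"
        by (rule seqM_even[OF True]; simp add: x)+
      let ?c = "rgen (Local (Cr j (i + 2)) a y) :: 'k ralg" and ?d = "rgen (Local (Dot i) (a @ [j]) y) :: 'k ralg"
        and ?e = "rgen (Local (Cr i j) a y) :: 'k ralg"
      let ?m = "piece_deg (Cr j (i + 2))" and ?n = "piece_deg (Cr i j)"
      have "\<forall>n\<ge>N. y !! n > i + 2"
        using Suc.prems x by (metis Suc_le_mono snth_Stream)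
      then have d: "rdeg (0 + 1) (rdiff ?d)" unfolding add_0 by (rule Suc.IH)
      have g: "rdeg ?m ?c" "rdeg 0 ?d" "rdeg ?n ?e"
        using rdeg.intros(1)[of "Local (Cr j (i + 2)) a y"] rdeg.intros(1)[of "Local (Dot i) (a @ [j]) y"]
          rdeg.intros(1)[of "Local (Cr i j) a y"] by simp_all
      have "rdeg (?m + 0 + 1) (rdiff (?c * ?d))"
        by (rule rdeg_rdiff_mult[OF g(1) rdeg_rdiff_cr g(2) d])
      moreover have "rdeg (?m + 0) (?c * ?d)" using g by (intro rdeg.intros)
      ultimately have "rdeg (?m + 0 + ?n + 1) (rdiff (?c * ?d * ?e))"
        by - (rule rdeg_rdiff_mult[OF _ _ g(3) rdeg_rdiff_cr])
      \<comment> \<open>Evenness matters: as \<open>j = i + 1\<close> is excluded, exactly one of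
        \<open>j < i + 2\<close> and \<open>i < j\<close> holds, so the two crossings have opposite
        degrees.\<close>
      moreover have "?m + ?n = 0" using \<open>even (i + 2)\<close> \<open>even j\<close> by auto presburger+
      ultimately show ?thesis unfolding x rgen_dot_slide by simp
    qed
  qed
  show ?thesis
  proof (cases "bot_seq (Local (Dot i) a x) \<in> seqM")
    case False
    then show ?thesis by (simp add: rgen_kill rdeg.intros)
  next
    case True
    then have "x \<in> seqM" using seqM_shift by (metis bot_seq.simps(2))
    then show ?thesis using seqM_eventually_gt main by blast
  qed
qed

lemma rdeg_rdiff: "rdeg n r \<Longrightarrow> rdeg (n + 1) (rdiff r)"
proof (induction rule: rdeg.induct)
  case (1 g)
  show ?case
  proof (cases g)
    case (Strands x) then show ?thesis by (simp add: rdeg.intros)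
  next
    case (Local s a x)
    show ?thesis
    proof (cases s)
      case (Cr i j)
      then show ?thesis unfolding Local gen_deg.simps by (simp only: rdeg_rdiff_cr)
    next
      case (Dot i)
      then show ?thesis unfolding Local by (simp add: rdeg_rdiff_dot)
    qed
  qed
next
  case (5 m r n s)
  then show ?case by (metis rdeg_rdiff_mult)
qed (auto intro: rdeg.intros)

text \<open>Compatibility of a homomorphism with the action is stated for homogeneous scalars only;
  sums of homogeneous elements are the bridge to arbitrary scalars.\<close>

inductive rspan :: "'k::field_char_0 ralg \<Rightarrow> bool" where
  rspan_hom: "rdeg n r \<Longrightarrow> rspan r"
| rspan_add: "rspan r \<Longrightarrow> rspan s \<Longrightarrow> rspan (r + s)"

lemma rspan_map:
  assumes "rspan r" "\<And>n s. rdeg n s \<Longrightarrow> rspan (f s)" "\<And>s t. f (s + t) = f s + f t"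
  shows "rspan (f r)"
  using assms(1) by induction (auto simp: assms intro: rspan_add)

text \<open>The case of \<open>rdiff\<close> is what requires the differential to be homogeneous of
  degree 1.\<close>

lemma rspan_all: "rspan r"
proof (induction r rule: ralg_induct)
  case (scale c r)
  then show ?case
    by (rule rspan_map[where f = "rscale c"]) (auto simp: rscale_add_right intro: rspan_hom rdeg.intros)
next
  case (mult r s)
  from mult(1) show ?case
  proof (rule rspan_map[where f = "\<lambda>r. r * s"])
    fix n r' assume "rdeg n (r' :: 'a ralg)"
    show "rspan (r' * s)"
      by (rule rspan_map[OF mult(2), where f = "\<lambda>s. r' * s"])
         (auto simp: distrib_left intro: rspan_hom rdeg.intros \<open>rdeg n r'\<close>)
  qed (simp add: distrib_right)
next
  case (diff r)
  then show ?case
    by (rule rspan_map[where f = rdiff]) (auto intro: rspan_hom rdeg_rdiff)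
qed (auto intro: rspan_hom rdeg.intros rspan_add)

lemma ralg_hom_induct [case_names hom add]:
  assumes "\<And>n r. rdeg n r \<Longrightarrow> P r" "\<And>r s. P r \<Longrightarrow> P s \<Longrightarrow> P (r + s)"
  shows "P r"
  using rspan_all[of r] by induction (auto intro: assms)

section \<open>Inversions of a sequence\<close>

definition before :: "'a stream \<Rightarrow> 'a \<Rightarrow> 'a \<Rightarrow> bool" where
  "before y c d \<longleftrightarrow> (\<exists>m n. m < n \<and> y !! m = c \<and> y !! n = d)"

text \<open>Inversions are recorded as pairs of labels, not of positions, so that a pair keeps its
  name while strands move. For distinct labels, an exchange of neighbours then alters the set by
  exactly one element.\<close>

definition invs :: "int stream \<Rightarrow> (int \<times> int) set" where
  "invs y = {(c, d). c < d \<and> before y d c}"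

lemma before_Stream: "before (s ## y) c d \<longleftrightarrow> c = s \<and> d \<in> sset y \<or> before y c d"
proof
  assume "before (s ## y) c d"
  then obtain m n where mn: "m < n" "(s ## y) !! m = c" "(s ## y) !! n = d"
    by (auto simp: before_def)
  then obtain n' where n': "n = Suc n'" by (cases n) auto
  show "c = s \<and> d \<in> sset y \<or> before y c d"
  proof (cases m)
    case 0
    then show ?thesis using mn n' by (auto simp: sset_range)
  next
    case (Suc m')
    then have "before y c d" unfolding before_def using mn n'
      by (intro exI[of _ m'] exI[of _ n']) auto
    then show ?thesis ..
  qed
next
  assume "c = s \<and> d \<in> sset y \<or> before y c d"
  then consider n where "c = s" "y !! n = d" | m n where "m < n" "y !! m = c" "y !! n = d"
    by (auto simp: before_def sset_range)
  then show "before (s ## y) c d"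
  proof cases
    case 1 then show ?thesis unfolding before_def
      by (intro exI[of _ 0] exI[of _ "Suc n"]) auto
  next
    case 2 then show ?thesis unfolding before_def
      by (intro exI[of _ "Suc m"] exI[of _ "Suc n"]) auto
  qed
qed

lemma before_swap:
  "{c, d} \<noteq> {i, j} \<Longrightarrow> before (a @- j ## i ## z) c d \<longleftrightarrow> before (a @- i ## j ## z) c d"
  by (induction a) (auto simp: before_Stream)

lemma inj_snth_Stream: "inj (snth (s ## y)) \<longleftrightarrow> s \<notin> sset y \<and> inj (snth y)"
proof
  assume *: "inj (snth (s ## y))"
  have "y !! n \<noteq> s" for n using injD[OF *, of "Suc n" 0] by auto
  moreover have "inj (snth y)"
    using * by (intro injI) (metis Suc_inject injD snth_Stream)
  ultimately show "s \<notin> sset y \<and> inj (snth y)" by (auto simp: sset_range)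
next
  assume *: "s \<notin> sset y \<and> inj (snth y)"
  show "inj (snth (s ## y))"
  proof (rule injI)
    fix m n assume "(s ## y) !! m = (s ## y) !! n"
    then show "m = n" using * by (cases m; cases n) (auto simp: sset_range dest: injD)
  qed
qed

lemma inj_snth_shift:
  "inj (snth (a @- y)) \<longleftrightarrow> distinct a \<and> set a \<inter> sset y = {} \<and> inj (snth y)"
  by (induction a) (auto simp: inj_snth_Stream)

lemma seqM_Stream: "s ## y \<in> seqM \<longleftrightarrow> even s \<and> y \<in> seqM"
proof
  assume "s ## y \<in> seqM"
  then show "even s \<and> y \<in> seqM"
    using seqM_shift[of "[s]" y] seqM_even[of "s ## y" s] by simp
next
  assume *: "even s \<and> y \<in> seqM"
  then obtain N where "\<And>n. n \<ge> N \<Longrightarrow> y !! Suc n = y !! n + 2" "\<And>n. even (y !! n)"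
    unfolding seqM_def by blast
  then have "(s ## y) !! Suc n = (s ## y) !! n + 2" if "n \<ge> Suc N" for n
    using that by (cases n) auto
  moreover have "even ((s ## y) !! n)" for n
    using * by (cases n) (auto simp: seqM_def)
  ultimately show "s ## y \<in> seqM" unfolding seqM_def by blast
qed

lemma seqM_shift_iff: "a @- y \<in> seqM \<longleftrightarrow> (\<forall>n\<in>set a. even n) \<and> y \<in> seqM"
  by (induction a) (auto simp: seqM_Stream)

lemma not_before_swap:
  assumes "inj (snth (a @- i ## j ## z))"
  shows "\<not> before (a @- i ## j ## z) j i"
proof -
  have "\<not> before z j i" if "j \<notin> sset z"
    using that by (force simp: before_def sset_range)
  with assms show ?thesis by (induction a) (auto simp: before_Stream inj_snth_shift inj_snth_Stream)
qed

lemma before_first: "before (a @- i ## j ## z) i j"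
  by (induction a) (auto simp: before_Stream)

text \<open>Inversions by position count repeated labels with multiplicity. They yield the
  finiteness of \<open>invs\<close> and are the measure that decreases while a sequence, possibly
  with repetitions, is sorted.\<close>

definition pinv :: "int stream \<Rightarrow> (nat \<times> nat) set" where
  "pinv y = {(m, n). m < n \<and> y !! n < y !! m}"

text \<open>The sequence increases from some position \<open>N\<close> on, so an inversion starts no
  later than \<open>N\<close>. The finitely many labels up to there are bounded, and eventually all
  labels exceed the bound.\<close>

lemma finite_pinv:
  assumes "y \<in> seqM"
  shows "finite (pinv y)"
proof -
  obtain N where N: "\<And>n. y !! (N + n) = y !! N + 2 * int n"
    using seqM_linear_tail[OF assms] by blast
  obtain D where D: "\<And>m. m \<le> N \<Longrightarrow> y !! m \<le> D"
    using finite_imageI[of "{..N}" "snth y"] by (metis Max_ge atMost_iff finite_atMost image_eqI)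
  obtain N' where N': "\<And>n. n \<ge> N' \<Longrightarrow> y !! n > D"
    using seqM_eventually_gt[OF assms] by blast
  have "pinv y \<subseteq> {..N} \<times> {..N'}"
  proof (rule subrelI)
    fix m n assume "(m, n) \<in> pinv y"
    then have mn: "m < n" "y !! n < y !! m" by (auto simp: pinv_def)
    have m: "m \<le> N"
      using N[of "m - N"] N[of "n - N"] mn by (cases "m \<le> N") auto
    have "n \<le> N'"
    proof (rule ccontr)
      assume "\<not> n \<le> N'"
      then have "y !! n > D" using N' by simp
      then show False using D[OF m] mn by simp
    qed
    then show "(m, n) \<in> {..N} \<times> {..N'}" using m by simp
  qed
  then show ?thesis by (rule finite_subset) simp
qed

lemma finite_invs: "y \<in> seqM \<Longrightarrow> finite (invs y)"
proof -
  assume "y \<in> seqM"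
  moreover have "invs y \<subseteq> (\<lambda>(m, n). (y !! n, y !! m)) ` pinv y"
    by (force simp: invs_def before_def pinv_def)
  ultimately show ?thesis using finite_pinv finite_surj by blast
qed

lemma invs_swap:
  assumes "i < j" "inj (snth (a @- i ## j ## z))"
  shows "invs (a @- j ## i ## z) = insert (i, j) (invs (a @- i ## j ## z))"
    and "(i, j) \<notin> invs (a @- i ## j ## z)"
proof -
  show "(i, j) \<notin> invs (a @- i ## j ## z)"
    using not_before_swap[OF assms(2)] by (simp add: invs_def)
  have "(c, d) \<in> invs (a @- j ## i ## z) \<longleftrightarrow> (c, d) = (i, j) \<or> (c, d) \<in> invs (a @- i ## j ## z)" for c d
  proof (cases "{c, d} = {i, j}")
    case True
    then show ?thesis using assms(1) before_first[of a j i z] by (auto simp: invs_def doubleton_eq_iff)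
  next
    case False
    then have "{d, c} \<noteq> {i, j}" by auto
    with False show ?thesis using before_swap[of d c i j a z] by (auto simp: invs_def)
  qed
  then show "invs (a @- j ## i ## z) = insert (i, j) (invs (a @- i ## j ## z))" by auto
qed

definition ninv :: "int stream \<Rightarrow> int" where
  "ninv y = int (card (invs y))"

lemma ninv_swap_less:
  assumes "i < j" "a @- i ## j ## z \<in> seqM" "inj (snth (a @- i ## j ## z))"
  shows "ninv (a @- j ## i ## z) = ninv (a @- i ## j ## z) + 1"
  using invs_swap[OF assms(1,3)] finite_invs[OF assms(2)] by (simp add: ninv_def)

definition rearr :: "int set \<Rightarrow> int stream set" where
  "rearr A = {y \<in> seqM. inj (snth y) \<and> sset y = A}"

lemma rearr_swap: "a @- i ## j ## z \<in> rearr A \<longleftrightarrow> a @- j ## i ## z \<in> rearr A"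
  by (auto simp: rearr_def seqM_shift_iff seqM_Stream inj_snth_shift inj_snth_Stream)

text \<open>All crossings have odd degree, so this parity is what makes the representation graded
  modulo 2.\<close>

lemma odd_ninv_swap:
  assumes "a @- i ## j ## z \<in> rearr A" "i \<noteq> j"
  shows "odd (ninv (a @- j ## i ## z) - ninv (a @- i ## j ## z))"
  using assms
proof (induction i j rule: linorder_wlog)
  case (le i j)
  then show ?case using ninv_swap_less[of i j a z] by (auto simp: rearr_def)
next
  case (sym i j)
  then have "odd (ninv (a @- i ## j ## z) - ninv (a @- j ## i ## z))"
    by (simp add: rearr_swap[of a i j])
  then show ?case by presburger
qed

section \<open>A sign for each exchange of two neighbours\<close>

text \<open>
  Disjoint crossings anticommute, but the braid relation has no sign. Ordering the inversions and
  letting a crossing act by wedging with its pair of labels gives the first sign; but as this reverses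
  the three factors of the braid relation, it must be corrected by a factor which changes
  under exactly one of the three crossings of a braid: whether the third label is smaller than the
  two exchanged ones.
\<close>

definition pair :: "int \<Rightarrow> int \<Rightarrow> int \<times> int" where
  "pair i j = (min i j, max i j)"

definition plt :: "int \<times> int \<Rightarrow> int \<times> int \<Rightarrow> bool" where
  "plt P Q \<longleftrightarrow> fst P < fst Q \<or> fst P = fst Q \<and> snd P < snd Q"

definition isgn :: "int stream \<Rightarrow> int \<times> int \<Rightarrow> 'k::field_char_0" where
  "isgn y P = ksgn (int (card {Q \<in> invs y. plt Q P}))"

definition lsgn :: "int list \<Rightarrow> int \<times> int \<Rightarrow> 'k::field_char_0" where
  "lsgn a P = ksgn (int (card {t \<in> set a. t < fst P}))"

lemma pair_commute: "pair i j = pair j i"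
  by (simp add: pair_def min.commute max.commute)

lemma isgn_square [simp]: "isgn y P * isgn y P = 1" "isgn y P * (isgn y P * c) = c"
  by (simp_all add: isgn_def)

lemma lsgn_square [simp]: "lsgn a P * lsgn a P = 1" "lsgn a P * (lsgn a P * c) = c"
  by (simp_all add: lsgn_def)

text \<open>The exchange adds or removes the single inversion \<open>pair i j\<close>, and
  \<open>isgn\<close> at \<open>P\<close> counts it exactly if it precedes \<open>P\<close>.\<close>

lemma isgn_swap:
  assumes "a @- i ## j ## z \<in> rearr A" "i \<noteq> j"
  shows "isgn (a @- j ## i ## z) P =
    (if plt (pair i j) P then -1 else 1) * (isgn (a @- i ## j ## z) P :: 'k::field_char_0)"
proof -
  have main: "isgn (a @- j ## i ## z) P =
      (if plt (pair i j) P then -1 else 1) * (isgn (a @- i ## j ## z) P :: 'k)"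
    if "i < j" "a @- i ## j ## z \<in> rearr A" for i j
  proof -
    let ?S = "{Q \<in> invs (a @- i ## j ## z). plt Q P}"
    have inj: "inj (snth (a @- i ## j ## z))" and M: "a @- i ## j ## z \<in> seqM"
      using that by (auto simp: rearr_def)
    have "finite ?S" using finite_invs[OF M] by simp
    moreover have "(i, j) \<notin> ?S" using invs_swap(2)[OF that(1) inj] by simp
    moreover have "{Q \<in> invs (a @- j ## i ## z). plt Q P} = (if plt (i, j) P then insert (i, j) ?S else ?S)"
      using invs_swap(1)[OF that(1) inj] by auto
    ultimately have "card {Q \<in> invs (a @- j ## i ## z). plt Q P} =
        (if plt (i, j) P then Suc (card ?S) else card ?S)"
      using card_insert_disjoint[of ?S "(i, j)"] by presburger
    then show ?thesis using that(1) by (simp add: isgn_def pair_def ksgn_def)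
  qed
  show ?thesis
  proof (cases "i < j")
    case True then show ?thesis using main assms by blast
  next
    case False
    then have "j < i" using assms by simp
    have "isgn (a @- i ## j ## z) P =
        (if plt (pair i j) P then -1 else 1) * (isgn (a @- j ## i ## z) P :: 'k)"
      using main[OF \<open>j < i\<close>] assms(1) rearr_swap[of a i j z] by (simp add: pair_commute)
    then show ?thesis by auto
  qed
qed

lemma lsgn_append:
  assumes "j \<notin> set a"
  shows "lsgn (a @ [j]) P = (if j < fst P then -1 else 1) * (lsgn a P :: 'k::field_char_0)"
proof -
  have "{t \<in> set (a @ [j]). t < fst P} =
      (if j < fst P then insert j {t \<in> set a. t < fst P} else {t \<in> set a. t < fst P})"
    by auto
  then show ?thesis using assms by (simp add: lsgn_def ksgn_def)
qed

lemma lsgn_cong: "set a = set b \<Longrightarrow> lsgn a P = lsgn b P"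
  by (simp add: lsgn_def)

lemma plt_linear: "P \<noteq> Q \<Longrightarrow> plt Q P \<longleftrightarrow> \<not> plt P Q"
  by (auto simp: plt_def prod_eq_iff)

lemma plt_irrefl [simp]: "\<not> plt P P"
  by (simp add: plt_def)

section \<open>A representation of \<open>R\<close> on the rearrangements of a set\<close>

text \<open>The coefficient with which the basis vector at the top \<open>(i, j)\<close> is sent to
  the one at the bottom \<open>(j, i)\<close>. Its first factor is the sign of wedging with, or
  contracting by, the exchanged pair in the exterior algebra on pairs of labels, with monomials
  ordered by \<open>plt\<close>.\<close>

definition csgn :: "int set \<Rightarrow> int \<Rightarrow> int \<Rightarrow> int list \<Rightarrow> int stream \<Rightarrow> 'k::field_char_0" where
  "csgn A i j a z = (if i \<noteq> j \<and> a @- j ## i ## z \<in> rearr A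
     then isgn (a @- j ## i ## z) (pair i j) * lsgn a (pair i j) else 0)"

primrec gcoef :: "int set \<Rightarrow> gen \<Rightarrow> 'k::field_char_0" where
  "gcoef A (Strands x) = (if x \<in> rearr A then 1 else 0)"
| "gcoef A (Local s a x) = (case s of Cr i j \<Rightarrow> csgn A i j a x | Dot i \<Rightarrow> 0)"

text \<open>A vector is the function of its coordinates. A diagram carries the coordinate at its top
  to its bottom, because in a left module the right factor of a product, which is the upper diagram,
  acts before the lower one.\<close>

primrec trho :: "int set \<Rightarrow> 'k::field_char_0 rterm \<Rightarrow> (int stream \<Rightarrow> 'k) \<Rightarrow> (int stream \<Rightarrow> 'k)" where
  "trho A (TGen g) = (\<lambda>v z. if z = bot_seq g then gcoef A g * v (top_seq g) else 0)"
| "trho A TZero = (\<lambda>v z. 0)"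
| "trho A (TAdd t u) = (\<lambda>v z. trho A t v z + trho A u v z)"
| "trho A (TScale c t) = (\<lambda>v z. c * trho A t v z)"
| "trho A (TMul t u) = (\<lambda>v. trho A t (trho A u v))"
| "trho A (TDiff t) = (\<lambda>v z. 0)"

lemma trho_add: "trho A t (\<lambda>z. v z + w z) = (\<lambda>z. trho A t v z + trho A t w z)"
proof (induction t arbitrary: v w)
  case (TGen g) show ?case by (simp add: fun_eq_iff distrib_left)
qed (simp_all add: ac_simps distrib_left)

lemma trho_scale: "trho A t (\<lambda>z. c * v z) = (\<lambda>z. c * trho A t v z)"
proof (induction t arbitrary: v)
  case (TGen g) show ?case by (simp add: fun_eq_iff)
qed (simp_all add: ac_simps distrib_left)

lemma trho_zero: "trho A t (\<lambda>z. 0) = (\<lambda>z. 0)"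
  using trho_scale[of A t 0 "\<lambda>z. 0"] by simp

text \<open>A pair does not precede itself in \<open>plt\<close>, so its own crossing leaves
  \<open>isgn\<close> unchanged. Both crossings therefore carry the same sign, and its square is
  1.\<close>

lemma csgn_inverse: "csgn A j i a x * csgn A i j a x =
    (if i \<noteq> j \<and> a @- i ## j ## x \<in> rearr A then 1 else (0::'k::field_char_0))"
proof (cases "i \<noteq> j \<and> a @- i ## j ## x \<in> rearr A")
  case True
  then have "isgn (a @- j ## i ## x) (pair i j) = (isgn (a @- i ## j ## x) (pair i j) :: 'k)"
    using isgn_swap[of a i j x A "pair i j"] by simp
  then show ?thesis using True rearr_swap[of a i j x]
    by (simp add: csgn_def pair_commute[of j i] algebra_simps)
qed (auto simp: csgn_def)

text \<open>The two pairs are disjoint, hence different, and one precedes the other; so exactly one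
  of the two crossings changes its \<open>isgn\<close> when their order is reversed. The factors
  \<open>lsgn\<close> agree, depending only on the set of labels to the left.\<close>

lemma csgn_far:
  "csgn A i j a (c @- k ## l ## x) * csgn A l k (a @ i # j # c) x =
   - (csgn A l k (a @ j # i # c) x * (csgn A i j a (c @- l ## k ## x) :: 'k::field_char_0))"
proof (cases "i \<noteq> j \<and> k \<noteq> l \<and> a @- j ## i ## c @- k ## l ## x \<in> rearr A")
  case True
  let ?P = "pair i j" and ?Q = "pair k l"
  have 1: "isgn (a @- i ## j ## c @- k ## l ## x) ?Q = (if plt ?P ?Q then -1 else 1) *
      (isgn (a @- j ## i ## c @- k ## l ## x) ?Q :: 'k)"
    using isgn_swap[of a j i "c @- k ## l ## x" A ?Q] True by (simp add: pair_commute)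
  have 2: "isgn (a @- j ## i ## c @- l ## k ## x) ?P = (if plt ?Q ?P then -1 else 1) *
      (isgn (a @- j ## i ## c @- k ## l ## x) ?P :: 'k)"
    using isgn_swap[of "a @ j # i # c" k l x A ?P] True by simp
  have 3: "a @- i ## j ## c @- k ## l ## x \<in> rearr A" "a @- j ## i ## c @- l ## k ## x \<in> rearr A"
    using True rearr_swap[of a j i "c @- k ## l ## x"] rearr_swap[of "a @ j # i # c" k l x] by auto
  have 4: "lsgn (a @ i # j # c) ?Q = (lsgn (a @ j # i # c) ?Q :: 'k)"
    by (rule lsgn_cong) auto
  have "{i, j} \<inter> {k, l} = {}"
    using True by (auto simp: rearr_def inj_snth_shift inj_snth_Stream)
  then have "?P \<noteq> ?Q" by (auto simp: pair_def min_def max_def split: if_splits)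
  then have 5: "plt ?Q ?P \<longleftrightarrow> \<not> plt ?P ?Q" by (rule plt_linear)
  show ?thesis using True 3
    by (simp add: csgn_def 1 2 4 5 pair_commute[of l k])
next
  case False
  then show ?thesis
    using rearr_swap[of a j i "c @- k ## l ## x"] rearr_swap[of "a @ j # i # c" k l x]
    by (auto simp: csgn_def)
qed

text \<open>Two signs cancel. Both sides run through the same three pairs in opposite order, and
  reversing three comparisons in \<open>plt\<close> contributes -1. The factors \<open>lsgn\<close>
  contribute another -1: exactly one label is below the other two, and it stands to the left of
  their crossing on exactly one side of the relation.\<close>

lemma csgn_braid:
  "csgn A j k a (i ## x) * csgn A i k (a @ [j]) x * csgn A i j a (k ## x) =
   csgn A i j (a @ [k]) x * csgn A i k a (j ## x) * (csgn A j k (a @ [i]) x :: 'k::field_char_0)"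
proof (cases "a @- k ## j ## i ## x \<in> rearr A")
  case True
  have d: "i \<noteq> j" "i \<noteq> k" "j \<noteq> k" "i \<notin> set a" "j \<notin> set a" "k \<notin> set a"
    using True by (auto simp: rearr_def inj_snth_shift inj_snth_Stream)
  have m: "a @- j ## k ## i ## x \<in> rearr A" "a @- j ## i ## k ## x \<in> rearr A"
    "a @- k ## i ## j ## x \<in> rearr A" "a @- i ## k ## j ## x \<in> rearr A"
    using True rearr_swap[of a k j "i ## x" A] rearr_swap[of "a @ [j]" k i x A]
      rearr_swap[of "a @ [k]" j i x A] rearr_swap[of a k i "j ## x" A] by auto
  let ?P = "pair j k" and ?Q = "pair i k" and ?W = "pair i j"
  have 1: "isgn (a @- j ## k ## i ## x) ?Q =
      (if plt ?P ?Q then -1 else 1) * (isgn (a @- k ## j ## i ## x) ?Q :: 'k)"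
    using isgn_swap[of a k j "i ## x" A ?Q] True d by (simp add: pair_commute)
  have 2: "isgn (a @- j ## i ## k ## x) ?W = (if plt ?Q ?W then -1 else 1) *
      ((if plt ?P ?W then -1 else 1) * (isgn (a @- k ## j ## i ## x) ?W :: 'k))"
  proof -
    have "isgn (a @- j ## k ## i ## x) ?W =
        (if plt ?P ?W then -1 else 1) * (isgn (a @- k ## j ## i ## x) ?W :: 'k)"
      using isgn_swap[of a k j "i ## x" A ?W] True d by (simp add: pair_commute)
    moreover have "isgn (a @- j ## i ## k ## x) ?W =
        (if plt ?Q ?W then -1 else 1) * (isgn (a @- j ## k ## i ## x) ?W :: 'k)"
      using isgn_swap[of "a @ [j]" k i x A ?W] m d by (simp add: pair_commute)
    ultimately show ?thesis by (simp only:)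
  qed
  have 3: "isgn (a @- k ## i ## j ## x) ?Q =
      (if plt ?W ?Q then -1 else 1) * (isgn (a @- k ## j ## i ## x) ?Q :: 'k)"
    using isgn_swap[of "a @ [k]" j i x A ?Q] True d by (simp add: pair_commute)
  have 4: "isgn (a @- i ## k ## j ## x) ?P = (if plt ?Q ?P then -1 else 1) *
      ((if plt ?W ?P then -1 else 1) * (isgn (a @- k ## j ## i ## x) ?P :: 'k))"
  proof -
    have "isgn (a @- k ## i ## j ## x) ?P =
        (if plt ?W ?P then -1 else 1) * (isgn (a @- k ## j ## i ## x) ?P :: 'k)"
      using isgn_swap[of "a @ [k]" j i x A ?P] True d by (simp add: pair_commute)
    moreover have "isgn (a @- i ## k ## j ## x) ?P =
        (if plt ?Q ?P then -1 else 1) * (isgn (a @- k ## i ## j ## x) ?P :: 'k)"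
      using isgn_swap[of a k i "j ## x" A ?P] m d by (simp add: pair_commute)
    ultimately show ?thesis by (simp only:)
  qed
  have ne: "?P \<noteq> ?Q" "?P \<noteq> ?W" "?Q \<noteq> ?W"
    using d by (auto simp: pair_def min_def max_def split: if_splits)
  have 5: "plt ?Q ?P \<longleftrightarrow> \<not> plt ?P ?Q" "plt ?W ?P \<longleftrightarrow> \<not> plt ?P ?W" "plt ?W ?Q \<longleftrightarrow> \<not> plt ?Q ?W"
    by (rule plt_linear, rule ne)+
  have 6: "(if j < fst ?Q then -1 else 1) =
      (if k < fst ?W then -1 else 1) * (if i < fst ?P then -1 else (1::'k)) * -1"
    using d by (auto simp: pair_def min_def)
  have 7: "(if plt ?P ?Q then -1 else 1) * (if plt ?Q ?W then -1 else 1) * (if plt ?P ?W then -1 else 1) =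
    (if plt ?W ?Q then -1 else 1) * (if plt ?Q ?P then -1 else 1) * (if plt ?W ?P then -1 else 1) * (-1::'k)"
    unfolding 5 by auto
  define q p w where "q = (isgn (a @- k ## j ## i ## x) ?Q :: 'k)"
    and "p = (isgn (a @- k ## j ## i ## x) ?P :: 'k)" and "w = (isgn (a @- k ## j ## i ## x) ?W :: 'k)"
  have L: "csgn A j k a (i ## x) * csgn A i k (a @ [j]) x * csgn A i j a (k ## x) =
     ((if plt ?P ?Q then -1 else 1) * (if plt ?Q ?W then -1 else 1) * (if plt ?P ?W then -1 else 1)) *
     (if j < fst ?Q then -1 else 1) * (p * q * w * lsgn a ?P * lsgn a ?Q * lsgn a ?W)"
    unfolding csgn_def using True m d
    by (simp add: 1 2 lsgn_append p_def q_def w_def del: mult_minus_left mult_minus_right)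
  have Rr: "csgn A i j (a @ [k]) x * csgn A i k a (j ## x) * csgn A j k (a @ [i]) x =
     ((if plt ?W ?Q then -1 else 1) * (if plt ?Q ?P then -1 else 1) * (if plt ?W ?P then -1 else 1)) *
     ((if k < fst ?W then -1 else 1) * (if i < fst ?P then -1 else 1)) *
     (p * q * w * lsgn a ?P * lsgn a ?Q * lsgn a ?W)"
    unfolding csgn_def using True m d
    by (simp add: 3 4 lsgn_append p_def q_def w_def del: mult_minus_left mult_minus_right)
  show ?thesis unfolding L Rr 7 6 by simp
next
  case False
  then show ?thesis using rearr_swap[of "a @ [k]" j i x A]
    by (auto simp: csgn_def)
qed

lemma gcoef_rearr: "gcoef A g \<noteq> 0 \<Longrightarrow> bot_seq g \<in> rearr A \<and> top_seq g \<in> rearr A"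
  using rearr_swap by (cases g) (auto simp: csgn_def split: piece.splits if_splits)

lemma trho_req: "req t u \<Longrightarrow> trho A t = trho A u"
proof (induction rule: req.induct)
  case (kill g)
  then have "gcoef A g = (0::'a)"
    using gcoef_rearr by (auto simp: rearr_def)
  then show ?case by (auto simp: fun_eq_iff)
next
  case (supercomm s a c t x)
  show ?case
  proof (cases s; cases t)
    fix i j k l assume "s = Cr i j" "t = Cr l k"
    then show ?thesis using csgn_far[of A i j a c k l x, where 'k = 'a]
      by (auto simp: fun_eq_iff ksgn_def simp flip: mult.assoc)
  qed (auto simp: fun_eq_iff)
next
  case (cr_cr j i a x)
  show ?case using csgn_inverse[of A j i a x, where 'k = 'a]
    by (auto simp: fun_eq_iff simp flip: mult.assoc)
next
  case (braid j k a i x)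
  show ?case using csgn_braid[of A j k a i x, where 'k = 'a]
    by (auto simp: fun_eq_iff simp flip: mult.assoc)
next
  case (diff_cr i j a x)
  \<comment> \<open>The derivative of the crossing of equal labels is an idempotent; like every
    derivative it has to act by zero, and it does because of the repeated label.\<close>
  have "a @- i ## i ## x \<notin> rearr A"
    by (auto simp: rearr_def inj_snth_shift inj_snth_Stream)
  then show ?case by (auto simp: fun_eq_iff)
next
  case (idem_left x g)
  show ?case using gcoef_rearr[of A g, where 'a = 'a] by (auto simp: fun_eq_iff)
next
  case (idem_right g x)
  show ?case using gcoef_rearr[of A g, where 'a = 'a] by (auto simp: fun_eq_iff)
next
  case (dot_dot i a x)
  show ?case by (auto simp: fun_eq_iff)
next
  case (dot_slide i a j x)
  show ?case by (auto simp: fun_eq_iff)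
qed (simp_all add: trho_add trho_scale trho_zero ac_simps distrib_left distrib_right)

lift_definition rho ::
  "int set \<Rightarrow> 'k::field_char_0 ralg \<Rightarrow> (int stream \<Rightarrow> 'k) \<Rightarrow> (int stream \<Rightarrow> 'k)" is trho
  by (rule trho_req)

lemma rho_simps [simp]:
  "rho A (rgen g) v = (\<lambda>z. if z = bot_seq g then gcoef A g * v (top_seq g) else 0)"
  "rho A 0 v = (\<lambda>z. 0)"
  "rho A (r + s) v = (\<lambda>z. rho A r v z + rho A s v z)"
  "rho A (rscale c r) v = (\<lambda>z. c * rho A r v z)"
  "rho A (r * s) v = rho A r (rho A s v)"
  "rho A (rdiff r) v = (\<lambda>z. 0)"
  by (transfer; simp)+

lemma rho_add: "rho A r (\<lambda>z. v z + w z) = (\<lambda>z. rho A r v z + rho A r w z)"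
  by transfer (rule trho_add)

lemma rho_scale: "rho A r (\<lambda>z. c * v z) = (\<lambda>z. c * rho A r v z)"
  by transfer (rule trho_scale)

definition repN :: "int set \<Rightarrow> ('k::field_char_0, int stream \<Rightarrow> 'k) dgmod" where
  "repN A = \<lparr>
     mcar = UNIV,
     mdeg = (\<lambda>p. {v. \<forall>y. v y \<noteq> 0 \<longrightarrow> even (p + ninv y)}),
     madd = (\<lambda>v w z. v z + w z),
     mzero = (\<lambda>z. 0),
     mscale = (\<lambda>c v z. c * v z),
     mact = rho A,
     mdiff = (\<lambda>v z. 0)\<rparr>"

lemma repN_simps [simp]:
  "mcar (repN A) = UNIV" "mdeg (repN A) p = {v. \<forall>y. v y \<noteq> 0 \<longrightarrow> even (p + ninv y)}"
  "madd (repN A) v w = (\<lambda>z. v z + w z)" "mscale (repN A) c v = (\<lambda>z. c * v z)"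
  "mact (repN A) = rho A"
  by (simp_all add: repN_def)

lemma rho_mdeg: "rdeg q r \<Longrightarrow> v \<in> mdeg (repN A) p \<Longrightarrow> rho A r v \<in> mdeg (repN A) (p + q)"
proof (induction arbitrary: v p rule: rdeg.induct)
  case (1 g)
  show ?case
  proof (cases g)
    case (Strands x)
    then show ?thesis using 1 by auto
  next
    case (Local s a x)
    show ?thesis
    proof (cases s)
      case (Cr i j)
      have "even (p + gen_deg g + ninv (bot_seq g))" if "csgn A i j a x * v (top_seq g) \<noteq> 0"
      proof -
        have *: "i \<noteq> j" "a @- j ## i ## x \<in> rearr A" "v (top_seq g) \<noteq> 0"
          using that by (auto simp: csgn_def split: if_splits)
        then have "even (p + ninv (a @- i ## j ## x))" using 1 Local Cr by auto
        moreover have "odd (ninv (a @- i ## j ## x) - ninv (a @- j ## i ## x))"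
          using odd_ninv_swap[of a j i x A] * by auto
        moreover have "odd (gen_deg g)" using Local Cr by (simp split: if_split)
        moreover have "bot_seq g = a @- j ## i ## x" using Local Cr by simp
        ultimately show ?thesis by auto
      qed
      then show ?thesis using Local Cr by (auto split: if_splits)
    qed (auto simp: Local)
  qed
next
  case (3 n r s)
  have "even (p + n + ninv y)" if "rho A r v y + rho A s v y \<noteq> 0" for y
  proof -
    have "rho A r v y \<noteq> 0 \<or> rho A s v y \<noteq> 0" using that by auto
    then show ?thesis using "3.IH"[OF "3.prems"] by auto
  qed
  then show ?case by simp
next
  case (5 m r n s)
  have "rho A r (rho A s v) \<in> mdeg (repN A) (p + n + m)"
    using 5 by blast
  then show ?case by (simp add: add.assoc add.commute[of m])
qed auto

section \<open>DG modules\<close>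

text \<open>The record type imposes no laws, so they are collected here, relative to the carrier,
  and proved for the objects by induction on their construction.\<close>

locale dg_module =
  fixes M :: "('k::field_char_0, 'm) dgmod"
  assumes add_closed: "x \<in> mcar M \<Longrightarrow> y \<in> mcar M \<Longrightarrow> madd M x y \<in> mcar M"
    and zero_closed: "mzero M \<in> mcar M"
    and scale_closed: "x \<in> mcar M \<Longrightarrow> mscale M c x \<in> mcar M"
    and act_closed: "x \<in> mcar M \<Longrightarrow> mact M r x \<in> mcar M"
    and diff_closed: "x \<in> mcar M \<Longrightarrow> mdiff M x \<in> mcar M"
    and deg_car: "x \<in> mdeg M p \<Longrightarrow> x \<in> mcar M"
    and deg_zero: "mzero M \<in> mdeg M p"
    and deg_add: "x \<in> mdeg M p \<Longrightarrow> y \<in> mdeg M p \<Longrightarrow> madd M x y \<in> mdeg M p"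
    and deg_scale: "x \<in> mdeg M p \<Longrightarrow> mscale M c x \<in> mdeg M p"
    and deg_diff: "x \<in> mdeg M p \<Longrightarrow> mdiff M x \<in> mdeg M (p + 1)"
    and add_assoc: "x \<in> mcar M \<Longrightarrow> y \<in> mcar M \<Longrightarrow> z \<in> mcar M \<Longrightarrow>
      madd M (madd M x y) z = madd M x (madd M y z)"
    and add_comm: "x \<in> mcar M \<Longrightarrow> y \<in> mcar M \<Longrightarrow> madd M x y = madd M y x"
    and add_zero: "x \<in> mcar M \<Longrightarrow> madd M (mzero M) x = x"
    and scale_zero: "x \<in> mcar M \<Longrightarrow> mscale M 0 x = mzero M"
    and scale_one: "x \<in> mcar M \<Longrightarrow> mscale M 1 x = x"
    and scale_scale: "x \<in> mcar M \<Longrightarrow> mscale M c (mscale M c' x) = mscale M (c * c') x"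
    and scale_add_left: "x \<in> mcar M \<Longrightarrow> mscale M (c + c') x = madd M (mscale M c x) (mscale M c' x)"
    and scale_add_right: "x \<in> mcar M \<Longrightarrow> y \<in> mcar M \<Longrightarrow>
      mscale M c (madd M x y) = madd M (mscale M c x) (mscale M c y)"
    and act_add: "x \<in> mcar M \<Longrightarrow> y \<in> mcar M \<Longrightarrow>
      mact M r (madd M x y) = madd M (mact M r x) (mact M r y)"
    and act_scale: "x \<in> mcar M \<Longrightarrow> mact M r (mscale M c x) = mscale M c (mact M r x)"
    and act_radd: "x \<in> mcar M \<Longrightarrow> mact M (r + s) x = madd M (mact M r x) (mact M s x)"
    and act_rscale: "x \<in> mcar M \<Longrightarrow> mact M (rscale c r) x = mscale M c (mact M r x)"
    and diff_add: "x \<in> mcar M \<Longrightarrow> y \<in> mcar M \<Longrightarrow>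
      mdiff M (madd M x y) = madd M (mdiff M x) (mdiff M y)"
    and diff_scale: "x \<in> mcar M \<Longrightarrow> mdiff M (mscale M c x) = mscale M c (mdiff M x)"
    and diff_act: "x \<in> mcar M \<Longrightarrow>
      mdiff M (mact M r x) = madd M (mact M (rdiff r) x) (mact M (rpar r) (mdiff M x))"
begin

lemmas closed = add_closed zero_closed scale_closed act_closed diff_closed

lemma add_left_comm: "x \<in> mcar M \<Longrightarrow> y \<in> mcar M \<Longrightarrow> z \<in> mcar M \<Longrightarrow>
    madd M x (madd M y z) = madd M y (madd M x z)"
  by (metis add_assoc add_comm)

lemmas add_ac = add_assoc add_comm add_left_comm

lemma add_zero_right: "x \<in> mcar M \<Longrightarrow> madd M x (mzero M) = x"
  by (metis add_comm add_zero zero_closed)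

lemma scale_mzero: "mscale M c (mzero M) = mzero M"
  by (metis mult_zero_right scale_scale scale_zero zero_closed)

lemma act_mzero: "mact M r (mzero M) = mzero M"
  by (metis act_closed act_scale scale_zero zero_closed)

lemma diff_mzero: "mdiff M (mzero M) = mzero M"
  by (metis diff_closed diff_scale scale_zero zero_closed)

lemmas mzeros = add_zero add_zero_right scale_mzero act_mzero diff_mzero

lemma add_neg: "x \<in> mcar M \<Longrightarrow> madd M x (mscale M (-1) x) = mzero M"
  by (metis add.right_inverse scale_add_left scale_one scale_zero)

lemma add_neg_cancel: "x \<in> mcar M \<Longrightarrow> y \<in> mcar M \<Longrightarrow> madd M (madd M x y) (mscale M (-1) y) = x"
  by (simp add: add_assoc scale_closed add_neg add_zero_right)

lemma act_uminus: "x \<in> mcar M \<Longrightarrow> mact M (- r) x = mscale M (-1) (mact M r x)"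
  by (metis act_rscale rscale_minus_one)

lemma act_rpar: "x \<in> mcar M \<Longrightarrow> rdeg q r \<Longrightarrow> mact M (rpar r) x = mscale M (ksgn q) (mact M r x)"
  by (simp add: rpar_rdeg act_rscale)

end

lemma dg_module_projP: "dg_module (projP x)"
proof (unfold_locales, goal_cases)
  case (10 u p)
  then show ?case
    by (auto simp: projP_def rdiff_mult) (metis rdeg_rdiff)
next
  case (1 u v)
  then show ?case by (auto simp: projP_def) (metis distrib_right)
next
  case (2)
  then show ?case by (auto simp: projP_def) (metis mult_zero_left)
next
  case (3 u c)
  then show ?case by (auto simp: projP_def) (metis rscale_mult_left)
next
  case (4 u r)
  then show ?case by (auto simp: projP_def) (metis mult.assoc)
next
  case (5 u)
  then show ?case by (auto simp: projP_def rdiff_mult)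
next
  case (7 p)
  then show ?case by (auto simp: projP_def) (metis mult_zero_left rdeg.intros(2))
next
  case (8 u p v)
  then show ?case by (auto simp: projP_def) (metis distrib_right rdeg.intros(3))
next
  case (9 u p c)
  then show ?case by (auto simp: projP_def) (metis rscale_mult_left rdeg.intros(4))
qed (auto simp: projP_def algebra_simps rscale_add_left rscale_add_right rdiff_mult)

lemma dg_module_repN: "dg_module (repN A)"
proof (unfold_locales, goal_cases)
  case (8 v p w)
  have "v y \<noteq> 0 \<or> w y \<noteq> 0" if "v y + w y \<noteq> 0" for y using that by auto
  with 8 show ?case by (auto simp: repN_def)
qed (auto simp: repN_def algebra_simps rho_add rho_scale rho_scale[of A _ 0, simplified])

lemma shift_simps [simp]:
  "mcar (shift n M) = mcar M" "mdeg (shift n M) p = mdeg M (p + n)"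
  "madd (shift n M) = madd M" "mzero (shift n M) = mzero M" "mscale (shift n M) = mscale M"
  "mact (shift n M) r = mact M (if even n then r else rpar r)"
  "mdiff (shift n M) x = mscale M (ksgn n) (mdiff M x)"
  by (simp_all add: shift_def)

lemma dg_module_shift:
  assumes "dg_module M"
  shows "dg_module (shift n M)"
proof -
  interpret dg_module M by fact
  show ?thesis
  proof (unfold_locales, goal_cases)
    case (10 x p)
    then show ?case using deg_diff[of x "p + n"] by (simp add: deg_scale ac_simps)
  next
    case (25 x r)
    then show ?case
      by (auto simp: closed diff_act scale_add_right act_uminus act_scale ksgn_def scale_one)
  qed (auto simp: closed deg_car deg_zero deg_add deg_scale
        add_assoc add_zero scale_zero scale_one scale_scale scale_add_left
        scale_add_right act_add act_scale act_radd act_rscale diff_add diff_scale mult.commute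
        intro: deg_car add_comm)
qed

section \<open>Homomorphisms of DG modules\<close>

lemma dg_hom_car: "f \<in> dg_hom M N n \<Longrightarrow> x \<in> mcar M \<Longrightarrow> f x \<in> mcar N"
  by (simp add: dg_hom_def)

lemma dg_hom_deg: "f \<in> dg_hom M N n \<Longrightarrow> x \<in> mdeg M p \<Longrightarrow> f x \<in> mdeg N (p + n)"
  by (simp add: dg_hom_def)

lemma dg_hom_add: "f \<in> dg_hom M N n \<Longrightarrow> x \<in> mcar M \<Longrightarrow> y \<in> mcar M \<Longrightarrow>
    f (madd M x y) = madd N (f x) (f y)"
  by (simp add: dg_hom_def)

lemma dg_hom_scale: "f \<in> dg_hom M N n \<Longrightarrow> x \<in> mcar M \<Longrightarrow> f (mscale M c x) = mscale N c (f x)"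
  by (simp add: dg_hom_def)

lemma dg_hom_act: "f \<in> dg_hom M N n \<Longrightarrow> x \<in> mcar M \<Longrightarrow> rdeg q r \<Longrightarrow>
    f (mact M r x) = mscale N (ksgn (n * q)) (mact N r (f x))"
  by (simp add: dg_hom_def)

lemma dg_homI:
  assumes "\<And>x. x \<in> mcar M \<Longrightarrow> f x \<in> mcar N" "\<And>p x. x \<in> mdeg M p \<Longrightarrow> f x \<in> mdeg N (p + n)"
    "\<And>x y. x \<in> mcar M \<Longrightarrow> y \<in> mcar M \<Longrightarrow> f (madd M x y) = madd N (f x) (f y)"
    "\<And>c x. x \<in> mcar M \<Longrightarrow> f (mscale M c x) = mscale N c (f x)"
    "\<And>q r x. x \<in> mcar M \<Longrightarrow> rdeg q r \<Longrightarrow> f (mact M r x) = mscale N (ksgn (n * q)) (mact N r (f x))"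
  shows "f \<in> dg_hom M N n"
  using assms by (simp add: dg_hom_def)

lemma dg_Z0_hom: "f \<in> dg_Z0 M N \<Longrightarrow> f \<in> dg_hom M N 0"
  by (simp add: dg_Z0_def)

lemma dg_Z0_diff: "f \<in> dg_Z0 M N \<Longrightarrow> x \<in> mcar M \<Longrightarrow> f (mdiff M x) = mdiff N (f x)"
  by (simp add: dg_Z0_def)

lemma dg_Z0I:
  assumes "f \<in> dg_hom M N 0" "\<And>x. x \<in> mcar M \<Longrightarrow> f (mdiff M x) = mdiff N (f x)"
  shows "f \<in> dg_Z0 M N"
  using assms by (simp add: dg_Z0_def)

lemma dg_Z0_act:
  assumes "dg_module M" "dg_module N" "f \<in> dg_Z0 M N" "x \<in> mcar M"
  shows "f (mact M r x) = mact N r (f x)"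
proof -
  interpret M: dg_module M by fact
  interpret N: dg_module N by fact
  note f = dg_Z0_hom[OF assms(3)]
  show ?thesis
  proof (induction r rule: ralg_hom_induct)
    case (hom n r)
    then show ?case using dg_hom_act[OF f assms(4)] dg_hom_car[OF f assms(4)]
      by (simp add: N.scale_one N.act_closed)
  next
    case (add r s)
    then show ?case using dg_hom_car[OF f assms(4)] assms(4)
      by (simp add: M.act_radd N.act_radd dg_hom_add[OF f] M.act_closed)
  qed
qed

section \<open>Mapping cones\<close>

lemma cone_simps [simp]:
  "u \<in> mcar (cone M N f) \<longleftrightarrow> (\<exists>y\<in>mcar N. \<exists>x\<in>mcar M. u = Pair y x)"
  "u \<in> mdeg (cone M N f) p \<longleftrightarrow> (\<exists>y\<in>mdeg N p. \<exists>x\<in>mdeg M (p + 1). u = Pair y x)"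
  "madd (cone M N f) (Pair y x) (Pair y' x') = Pair (madd N y y') (madd M x x')"
  "mzero (cone M N f) = Pair (mzero N) (mzero M)"
  "mscale (cone M N f) c (Pair y x) = Pair (mscale N c y) (mscale M c x)"
  "mact (cone M N f) r (Pair y x) = Pair (mact N r y) (mact M (rpar r) x)"
  "mdiff (cone M N f) (Pair y x) = Pair (madd N (mdiff N y) (f x)) (mscale M (-1) (mdiff M x))"
  by (auto simp: cone_def Let_def)

lemma dg_module_cone:
  assumes "dg_module M" "dg_module N" "f \<in> dg_Z0 M N"
  shows "dg_module (cone M N f)"
proof -
  interpret M: dg_module M by fact
  interpret N: dg_module N by fact
  note f = dg_Z0_hom[OF assms(3)]
  note [simp] = dg_hom_car[OF f] dg_hom_add[OF f] dg_hom_scale[OF f] dg_Z0_act[OF assms]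
    M.closed N.closed M.act_radd N.act_radd M.act_rscale N.act_rscale M.act_add N.act_add
    M.act_scale N.act_scale M.diff_act N.diff_act M.diff_add N.diff_add M.diff_scale N.diff_scale
    M.scale_add_left N.scale_add_left M.scale_add_right N.scale_add_right M.scale_scale N.scale_scale
    M.scale_zero N.scale_zero M.scale_one N.scale_one M.add_zero N.add_zero
    M.add_zero_right N.add_zero_right
  show ?thesis
  proof (unfold_locales, goal_cases)
    case (10 u p)
    then obtain y x where u: "y \<in> mdeg N p" "x \<in> mdeg M (p + 1)" "u = Pair y x" by auto
    then have "f x \<in> mdeg N (p + 1)" using dg_hom_deg[OF f, of x "p + 1"] by simp
    moreover have "mdiff M x \<in> mdeg M (2 + p)" "mdiff N y \<in> mdeg N (p + 1)"
      using u M.deg_diff[of x "p + 1"] by (auto intro: N.deg_diff)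
    ultimately show ?case using u
      by (auto intro: N.deg_add M.deg_scale)
  next
    \<comment> \<open>This is the Leibniz rule \<open>diff_act\<close>. On the summand
      \<open>M\<close>, the twisted action and the negated differential fit together because
      \<open>rpar (rdiff r) = - rdiff (rpar r)\<close>.\<close>
    case (25 u r)
    then obtain y x where u: "y \<in> mcar N" "x \<in> mcar M" "u = Pair y x" by auto
    have "mscale M (-1) (mact M (rdiff (rpar r)) x) = mact M (- rdiff (rpar r)) x"
      using u M.act_rscale[of x "-1" "rdiff (rpar r)"] by (simp add: rscale_minus_one)
    then show ?case using u by (auto simp: N.add_ac)
  qed (auto simp: N.add_ac M.add_ac M.deg_car N.deg_car M.deg_zero N.deg_zero mult.commute
       intro!: M.deg_add N.deg_add M.deg_scale N.deg_scale)
qed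

lemma DGP_dg_module: "M \<in> DGP S \<Longrightarrow> dg_module M"
  by (induction rule: DGP.induct) (simp_all add: dg_module_projP dg_module_shift dg_module_cone)

section \<open>Sums, multiples and composites of homomorphisms\<close>

lemma dg_hom_zero:
  assumes "dg_module N"
  shows "(\<lambda>_. mzero N) \<in> dg_hom M N n"
proof -
  interpret N: dg_module N by fact
  show ?thesis by (rule dg_homI) (simp_all add: N.closed N.deg_zero N.mzeros)
qed

lemma dg_hom_plus:
  assumes "dg_module N" "f \<in> dg_hom M N n" "g \<in> dg_hom M N n"
  shows "(\<lambda>x. madd N (f x) (g x)) \<in> dg_hom M N n"
proof -
  interpret N: dg_module N by fact
  note [simp] = dg_hom_car[OF assms(2)] dg_hom_car[OF assms(3)] dg_hom_add[OF assms(2)]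
    dg_hom_add[OF assms(3)] dg_hom_scale[OF assms(2)] dg_hom_scale[OF assms(3)]
    dg_hom_act[OF assms(2)] dg_hom_act[OF assms(3)]
  show ?thesis
    by (rule dg_homI)
       (simp_all add: N.closed N.deg_add dg_hom_deg[OF assms(2)] dg_hom_deg[OF assms(3)]
          N.act_add N.scale_add_right N.add_ac)
qed

lemma dg_hom_cmul:
  assumes "dg_module N" "f \<in> dg_hom M N n"
  shows "(\<lambda>x. mscale N c (f x)) \<in> dg_hom M N n"
proof -
  interpret N: dg_module N by fact
  note [simp] = dg_hom_car[OF assms(2)] dg_hom_add[OF assms(2)] dg_hom_scale[OF assms(2)]
    dg_hom_act[OF assms(2)]
  show ?thesis
    by (rule dg_homI)
       (simp_all add: N.closed N.deg_scale dg_hom_deg[OF assms(2)]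
          N.act_scale N.scale_add_right N.scale_scale mult.commute)
qed

lemma dg_hom_id:
  assumes "dg_module M"
  shows "id \<in> dg_hom M M 0"
proof -
  interpret M: dg_module M by fact
  show ?thesis by (rule dg_homI) (simp_all add: M.closed M.scale_one)
qed

lemma dg_hom_comp:
  fixes M :: "('k::field_char_0, 'm) dgmod" and N :: "('k, 'n) dgmod" and L :: "('k, 'l) dgmod"
  assumes "dg_module M" "dg_module N" "dg_module L" "f \<in> dg_hom M N m" "g \<in> dg_hom N L n"
  shows "g \<circ> f \<in> dg_hom M L (m + n)"
proof -
  interpret M: dg_module M by fact
  interpret N: dg_module N by fact
  interpret L: dg_module L by fact
  note [simp] = dg_hom_car[OF assms(4)] dg_hom_add[OF assms(4)] dg_hom_scale[OF assms(4)]
    dg_hom_act[OF assms(4)] dg_hom_car[OF assms(5)] dg_hom_add[OF assms(5)] dg_hom_scale[OF assms(5)]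
    dg_hom_act[OF assms(5)]
  show ?thesis
  proof (rule dg_homI)
    fix p x assume "x \<in> mdeg M p"
    then show "(g \<circ> f) x \<in> mdeg L (p + (m + n))"
      using dg_hom_deg[OF assms(5) dg_hom_deg[OF assms(4)], of x p] by (simp add: add.assoc)
  next
    fix q x and r :: "'k ralg" assume *: "x \<in> mcar M" "rdeg q r"
    then show "(g \<circ> f) (mact M r x) = mscale L (ksgn ((m + n) * q)) (mact L r ((g \<circ> f) x))"
      by (simp add: N.closed L.closed L.scale_scale distrib_right ksgn_add)
  qed (simp_all add: N.closed)
qed

lemma dg_Z0_id: "dg_module M \<Longrightarrow> id \<in> dg_Z0 M M"
  by (rule dg_Z0I) (simp_all add: dg_hom_id)

lemma dg_Z0_comp:
  assumes "dg_module M" "dg_module N" "dg_module L" "f \<in> dg_Z0 M N" "g \<in> dg_Z0 N L"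
  shows "g \<circ> f \<in> dg_Z0 M L"
  using dg_hom_comp[OF assms(1-3) dg_Z0_hom[OF assms(4)] dg_Z0_hom[OF assms(5)]] assms(4,5)
  by (intro dg_Z0I) (simp_all add: dg_Z0_diff dg_hom_car[OF dg_Z0_hom])

lemma dg_Z0_zero:
  assumes "dg_module N"
  shows "(\<lambda>_. mzero N) \<in> dg_Z0 M N"
proof -
  interpret N: dg_module N by fact
  show ?thesis by (rule dg_Z0I) (simp_all add: dg_hom_zero assms N.mzeros)
qed

section \<open>Homotopies\<close>

lemma homotopy_relI:
  assumes "f \<in> dg_Z0 M N" "g \<in> dg_Z0 M N" "h \<in> dg_hom M N (-1)"
    "\<And>x. x \<in> mcar M \<Longrightarrow> f x = madd N (g x) (madd N (mdiff N (h x)) (h (mdiff M x)))"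
  shows "(f, g) \<in> homotopy_rel M N"
  using assms by (auto simp: homotopy_rel_def)

lemma homotopy_relE:
  assumes "(f, g) \<in> homotopy_rel M N"
  obtains h where "f \<in> dg_Z0 M N" "g \<in> dg_Z0 M N" "h \<in> dg_hom M N (-1)"
    "\<And>x. x \<in> mcar M \<Longrightarrow> f x = madd N (g x) (madd N (mdiff N (h x)) (h (mdiff M x)))"
  using assms by (auto simp: homotopy_rel_def)

lemma homotopy_eqI:
  assumes "dg_module N" "f \<in> dg_Z0 M N" "g \<in> dg_Z0 M N" "\<And>x. x \<in> mcar M \<Longrightarrow> f x = g x"
  shows "(f, g) \<in> homotopy_rel M N"
proof -
  interpret N: dg_module N by fact
  show ?thesis
    by (rule homotopy_relI[OF assms(2,3) dg_hom_zero[OF assms(1)]])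
       (simp add: assms dg_hom_car[OF dg_Z0_hom[OF assms(3)]] N.mzeros N.closed)
qed

lemma homotopy_sym:
  assumes "dg_module M" "dg_module N" "(f, g) \<in> homotopy_rel M N"
  shows "(g, f) \<in> homotopy_rel M N"
proof -
  interpret M: dg_module M by fact
  interpret N: dg_module N by fact
  from assms(3) obtain h where f: "f \<in> dg_Z0 M N" and g: "g \<in> dg_Z0 M N" and h: "h \<in> dg_hom M N (-1)"
    and e: "\<And>x. x \<in> mcar M \<Longrightarrow> f x = madd N (g x) (madd N (mdiff N (h x)) (h (mdiff M x)))"
    by (rule homotopy_relE) blast
  show ?thesis
  proof (rule homotopy_relI[OF g f dg_hom_cmul[OF assms(2) h, of "-1"]])
    fix x assume x: "x \<in> mcar M"
    have c: "g x \<in> mcar N" "h x \<in> mcar N" "h (mdiff M x) \<in> mcar N"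
      using x g h by (simp_all add: dg_hom_car[OF dg_Z0_hom] dg_hom_car M.closed)
    have "madd N (mdiff N (mscale N (-1) (h x))) (mscale N (-1) (h (mdiff M x))) =
        mscale N (-1) (madd N (mdiff N (h x)) (h (mdiff M x)))"
      using c by (simp add: N.closed N.diff_scale N.scale_add_right)
    then show "g x = madd N (f x) (madd N (mdiff N (mscale N (-1) (h x))) (mscale N (-1) (h (mdiff M x))))"
      unfolding e[OF x] using c by (simp add: N.add_neg_cancel N.closed)
  qed
qed

lemma homotopy_trans:
  assumes "dg_module M" "dg_module N" "(f, g) \<in> homotopy_rel M N" "(g, l) \<in> homotopy_rel M N"
  shows "(f, l) \<in> homotopy_rel M N"
proof -
  interpret M: dg_module M by fact
  interpret N: dg_module N by fact
  from assms(3) obtain h where f: "f \<in> dg_Z0 M N" and h: "h \<in> dg_hom M N (-1)"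
    and e: "\<And>x. x \<in> mcar M \<Longrightarrow> f x = madd N (g x) (madd N (mdiff N (h x)) (h (mdiff M x)))"
    by (rule homotopy_relE) blast
  from assms(4) obtain h' where l: "l \<in> dg_Z0 M N" and h': "h' \<in> dg_hom M N (-1)"
    and e': "\<And>x. x \<in> mcar M \<Longrightarrow> g x = madd N (l x) (madd N (mdiff N (h' x)) (h' (mdiff M x)))"
    by (rule homotopy_relE) blast
  show ?thesis
  proof (rule homotopy_relI[OF f l dg_hom_plus[OF assms(2) h h']])
    fix x assume x: "x \<in> mcar M"
    have "l x \<in> mcar N" "h x \<in> mcar N" "h (mdiff M x) \<in> mcar N" "h' x \<in> mcar N" "h' (mdiff M x) \<in> mcar N"
      using x l h h' by (simp_all add: dg_hom_car[OF dg_Z0_hom] dg_hom_car M.closed)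
    then show "f x = madd N (l x) (madd N (mdiff N (madd N (h x) (h' x)))
        (madd N (h (mdiff M x)) (h' (mdiff M x))))"
      unfolding e[OF x] e'[OF x] by (simp add: N.closed N.diff_add N.add_ac)
  qed
qed

lemma homotopy_comp:
  assumes "dg_module M" "dg_module N" "dg_module L"
    "(f, f') \<in> homotopy_rel M N" "(g, g') \<in> homotopy_rel N L"
  shows "(g \<circ> f, g' \<circ> f') \<in> homotopy_rel M L"
proof -
  interpret M: dg_module M by fact
  interpret N: dg_module N by fact
  interpret L: dg_module L by fact
  from assms(4) obtain h where f: "f \<in> dg_Z0 M N" "f' \<in> dg_Z0 M N" and h: "h \<in> dg_hom M N (-1)"
    and e: "\<And>x. x \<in> mcar M \<Longrightarrow> f x = madd N (f' x) (madd N (mdiff N (h x)) (h (mdiff M x)))"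
    by (rule homotopy_relE) blast
  from assms(5) obtain k where g: "g \<in> dg_Z0 N L" "g' \<in> dg_Z0 N L" and k: "k \<in> dg_hom N L (-1)"
    and e': "\<And>x. x \<in> mcar N \<Longrightarrow> g x = madd L (g' x) (madd L (mdiff L (k x)) (k (mdiff N x)))"
    by (rule homotopy_relE) blast
  note [simp] = dg_hom_car[OF dg_Z0_hom[OF f(1)]] dg_hom_car[OF dg_Z0_hom[OF f(2)]] dg_hom_car[OF h]
    dg_hom_car[OF dg_Z0_hom[OF g(2)]] dg_hom_add[OF dg_Z0_hom[OF g(2)]] M.closed N.closed L.closed
  have "(g \<circ> f, g' \<circ> f) \<in> homotopy_rel M L"
  proof (rule homotopy_relI)
    show "k \<circ> f \<in> dg_hom M L (-1)"
      using dg_hom_comp[OF assms(1-3) dg_Z0_hom[OF f(1)] k] by simp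
  qed (simp_all add: dg_Z0_comp[OF assms(1-3)] f g e' dg_Z0_diff[OF f(1)])
  moreover have "(g' \<circ> f, g' \<circ> f') \<in> homotopy_rel M L"
  proof (rule homotopy_relI)
    show "g' \<circ> h \<in> dg_hom M L (-1)"
      using dg_hom_comp[OF assms(1-3) h dg_Z0_hom[OF g(2)]] by simp
  qed (simp_all add: dg_Z0_comp[OF assms(1-3)] f g e dg_Z0_diff[OF g(2)])
  ultimately show ?thesis using homotopy_trans[OF assms(1,3)] by blast
qed

lemma dg_Z0_shift:
  fixes M :: "('k::field_char_0, 'm) dgmod" and N :: "('k, 'n) dgmod"
  assumes "dg_module M" "f \<in> dg_Z0 M N"
  shows "f \<in> dg_Z0 (shift n M) (shift n N)"
proof -
  interpret M: dg_module M by fact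
  note f = dg_Z0_hom[OF assms(2)]
  show ?thesis
  proof (rule dg_Z0I, rule dg_homI)
    fix q x and r :: "'k ralg" assume "x \<in> mcar (shift n M)" "rdeg q r"
    then show "f (mact (shift n M) r x) = mscale (shift n N) (ksgn (0 * q)) (mact (shift n N) r (f x))"
      using dg_hom_act[OF f, of x q r] dg_hom_act[OF f, of x q "rpar r"] by (simp add: rdeg_rpar)
  next
    fix p x assume "x \<in> mdeg (shift n M) p"
    then show "f x \<in> mdeg (shift n N) (p + 0)"
      using dg_hom_deg[OF f, of x "p + n"] by simp
  qed (simp_all add: M.closed dg_Z0_diff[OF assms(2)] dg_hom_scale[OF f] dg_hom_add[OF f] dg_hom_car[OF f])
qed

lemma homotopy_shift:
  fixes M :: "('k::field_char_0, 'm) dgmod" and N :: "('k, 'n) dgmod"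
  assumes "dg_module M" "dg_module N" "(f, g) \<in> homotopy_rel M N"
  shows "(f, g) \<in> homotopy_rel (shift 1 M) (shift 1 N)"
proof -
  interpret M: dg_module M by fact
  interpret N: dg_module N by fact
  from assms(3) obtain h where f: "f \<in> dg_Z0 M N" and g: "g \<in> dg_Z0 M N" and h: "h \<in> dg_hom M N (-1)"
    and e: "\<And>x. x \<in> mcar M \<Longrightarrow> f x = madd N (g x) (madd N (mdiff N (h x)) (h (mdiff M x)))"
    by (rule homotopy_relE) blast
  note [simp] = dg_hom_car[OF dg_Z0_hom[OF g]] dg_hom_car[OF h] dg_hom_add[OF h] dg_hom_scale[OF h]
    M.closed N.closed
  show ?thesis
  proof (rule homotopy_relI[OF dg_Z0_shift[OF assms(1) f] dg_Z0_shift[OF assms(1) g]])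
    \<comment> \<open>Both differentials change sign under \<open>shift 1\<close>, and the homotopy
      has to compensate for this.\<close>
    show "(\<lambda>x. mscale N (-1) (h x)) \<in> dg_hom (shift 1 M) (shift 1 N) (-1)"
    proof (rule dg_homI)
      fix q x and r :: "'k ralg" assume "x \<in> mcar (shift 1 M)" "rdeg q r"
      then show "mscale N (-1) (h (mact (shift 1 M) r x)) =
          mscale (shift 1 N) (ksgn (-1 * q)) (mact (shift 1 N) r (mscale N (-1) (h x)))"
        using dg_hom_act[OF h, of x q "rpar r"]
        by (simp add: rdeg_rpar N.act_scale N.scale_scale)
    next
      fix p x assume "x \<in> mdeg (shift 1 M) p"
      then show "mscale N (-1) (h x) \<in> mdeg (shift 1 N) (p + -1)"
        using dg_hom_deg[OF h, of x "p + 1"] by (simp add: N.deg_scale)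
    qed (simp_all add: N.scale_add_right N.scale_scale)
  next
    fix x assume "x \<in> mcar (shift 1 M)"
    then show "f x = madd (shift 1 N) (g x) (madd (shift 1 N)
        (mdiff (shift 1 N) (mscale N (-1) (h x))) (mscale N (-1) (h (mdiff (shift 1 M) x))))"
      by (simp add: e N.diff_scale N.scale_scale N.scale_one)
  qed
qed

lemma equiv_homotopy:
  assumes "dg_module M" "dg_module N"
  shows "equiv (dg_Z0 M N) (homotopy_rel M N)"
proof (rule equivI)
  show "refl_on (dg_Z0 M N) (homotopy_rel M N)"
    by (auto simp: refl_on_def intro: homotopy_eqI[OF assms(2)])
  show "homotopy_rel M N \<subseteq> dg_Z0 M N \<times> dg_Z0 M N"
    by (auto simp: homotopy_rel_def)
  show "sym (homotopy_rel M N)" using homotopy_sym[OF assms] by (auto intro: symI)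
  show "trans (homotopy_rel M N)" using homotopy_trans[OF assms] by (auto intro: transI)
qed

text \<open>Isomorphism in the homotopy category, expressed through representatives and without
  reference to a set of objects.\<close>

definition heq :: "('k::field_char_0, 'm) dgmod \<Rightarrow> ('k, 'n) dgmod \<Rightarrow> bool" where
  "heq M N \<longleftrightarrow> (\<exists>f\<in>dg_Z0 M N. \<exists>g\<in>dg_Z0 N M.
     (g \<circ> f, id) \<in> homotopy_rel M M \<and> (f \<circ> g, id) \<in> homotopy_rel N N)"

lemma heq_isoI:
  assumes "dg_module M" "dg_module N" "f \<in> dg_Z0 M N" "g \<in> dg_Z0 N M"
    "\<And>x. x \<in> mcar M \<Longrightarrow> g (f x) = x" "\<And>x. x \<in> mcar N \<Longrightarrow> f (g x) = x"
  shows "heq M N"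
  unfolding heq_def using assms
  by (intro bexI[of _ f] bexI[of _ g] conjI homotopy_eqI dg_Z0_id dg_Z0_comp[OF assms(1,2,1)]
      dg_Z0_comp[OF assms(2,1,2)]) simp_all

definition contractible :: "('k::field_char_0, 'm) dgmod \<Rightarrow> bool" where
  "contractible M \<longleftrightarrow> (\<exists>h\<in>dg_hom M M (-1). \<forall>x\<in>mcar M. x = madd M (mdiff M (h x)) (h (mdiff M x)))"

lemma contractible_heq:
  assumes "dg_module M" "dg_module N" "contractible M" "contractible N"
  shows "heq M N"
proof -
  have *: "((\<lambda>_. mzero L), id) \<in> homotopy_rel L L" if L: "dg_module L" "contractible L"
    for L :: "('a, 'x) dgmod"
  proof -
    interpret L: dg_module L by fact
    obtain h where h: "h \<in> dg_hom L L (-1)" "\<forall>x\<in>mcar L. x = madd L (mdiff L (h x)) (h (mdiff L x))"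
      using L(2) by (auto simp: contractible_def)
    have "(id, (\<lambda>_. mzero L)) \<in> homotopy_rel L L"
      using h L(1)
      by (intro homotopy_relI[where h = h] dg_Z0_id dg_Z0_zero)
         (auto simp: L.closed L.add_zero dg_hom_car[OF h(1)])
    then show ?thesis using homotopy_sym[OF L(1,1)] by blast
  qed
  show ?thesis unfolding heq_def
  proof (intro bexI conjI)
    show "(\<lambda>_. mzero N) \<in> dg_Z0 M N" "(\<lambda>_. mzero M) \<in> dg_Z0 N M"
      using assms by (auto intro: dg_Z0_zero)
    show "((\<lambda>_. mzero M) \<circ> (\<lambda>_. mzero N), id) \<in> homotopy_rel M M"
      "((\<lambda>_. mzero N) \<circ> (\<lambda>_. mzero M), id) \<in> homotopy_rel N N"
      using *[of M] *[of N] assms by (auto simp: comp_def)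
  qed
qed

lemma contractible_cone_id:
  assumes "dg_module M"
  shows "contractible (cone M M id)"
proof -
  interpret M: dg_module M by fact
  show ?thesis unfolding contractible_def
  proof (intro bexI ballI)
    show "(\<lambda>u. Pair (mzero M) (lft u)) \<in> dg_hom (cone M M id) (cone M M id) (-1)"
      by (rule dg_homI)
         (auto simp: M.closed M.mzeros M.deg_zero M.act_rpar M.scale_scale M.act_scale M.scale_one)
  next
    fix u assume "u \<in> mcar (cone M M id)"
    then show "u = madd (cone M M id) (mdiff (cone M M id) (Pair (mzero M) (lft u)))
        (Pair (mzero M) (lft (mdiff (cone M M id) u)))"
      by (auto simp: M.closed M.mzeros M.add_ac M.add_neg M.add_neg_cancel)
  qed
qed

text \<open>A contractible \<open>Z\<close> stands in for a zero object, so that the triangle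
  \<open>M \<rightarrow> 0 \<rightarrow> M[1]\<close> can be realised by objects of
  \<open>DGP S\<close>.\<close>

lemma heq_cone_zero:
  assumes "dg_module M" "dg_module Z" "contractible Z"
  shows "heq (cone M Z (\<lambda>_. mzero Z)) (shift 1 M)"
proof -
  interpret M: dg_module M by fact
  interpret Z: dg_module Z by fact
  let ?C = "cone M Z (\<lambda>_. mzero Z)"
  have C: "dg_module ?C" by (rule dg_module_cone) (simp_all add: assms dg_Z0_zero)
  have S: "dg_module (shift 1 M)" using assms(1) by (rule dg_module_shift)
  obtain h where h: "h \<in> dg_hom Z Z (-1)" "\<And>x. x \<in> mcar Z \<Longrightarrow> madd Z (mdiff Z (h x)) (h (mdiff Z x)) = x"
    using assms(3) by (auto simp: contractible_def)
  note [simp] = M.closed Z.closed M.mzeros Z.mzeros dg_hom_car[OF h(1)] dg_hom_add[OF h(1)]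
    dg_hom_scale[OF h(1)] M.deg_zero Z.deg_zero
  have 1: "rgt \<in> dg_Z0 ?C (shift 1 M)"
    by (intro dg_Z0I dg_homI) (auto simp: M.scale_one)
  have 2: "Pair (mzero Z) \<in> dg_Z0 (shift 1 M) ?C"
    by (intro dg_Z0I dg_homI) (auto simp: M.scale_one)
  have 3: "(\<lambda>u. Pair (h (lft u)) (mzero M)) \<in> dg_hom ?C ?C (-1)"
    by (rule dg_homI) (auto simp: dg_hom_act[OF h(1)] dest: dg_hom_deg[OF h(1)])
  have 4: "(id, Pair (mzero Z) \<circ> rgt) \<in> homotopy_rel ?C ?C"
  proof (rule homotopy_relI[OF dg_Z0_id[OF C] dg_Z0_comp[OF C S C 1 2] 3])
    fix u assume "u \<in> mcar ?C"
    then show "id u = madd ?C ((Pair (mzero Z) \<circ> rgt) u) (madd ?C (mdiff ?C (Pair (h (lft u)) (mzero M)))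
       (Pair (h (lft (mdiff ?C u))) (mzero M)))"
      by (auto simp: h(2))
  qed
  show ?thesis unfolding heq_def
  proof (intro bexI[OF _ 1] bexI[OF _ 2] conjI)
    show "(Pair (mzero Z) \<circ> rgt, id) \<in> homotopy_rel ?C ?C" by (rule homotopy_sym[OF C C 4])
    show "(rgt \<circ> Pair (mzero Z), id) \<in> homotopy_rel (shift 1 M) (shift 1 M)"
      by (rule homotopy_eqI[OF S dg_Z0_comp[OF S C S 2 1] dg_Z0_id[OF S]]) simp
  qed
qed

text \<open>The identity map is an isomorphism, but the two records need not be equal: successive
  multiplications by signs combine only on the carrier.\<close>

lemma heq_shift_Suc:
  assumes "dg_module M"
  shows "heq (shift 1 (shift n M)) (shift (n + 1) M)"
proof -
  interpret M: dg_module M by fact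
  note S = dg_module_shift[OF assms]
  show ?thesis
    by (rule heq_isoI[OF S[THEN dg_module_shift] S, where f = id and g = id]; (intro dg_Z0I dg_homI)?)
       (auto simp: M.closed M.scale_one M.scale_scale ksgn_add ac_simps)
qed

lemma heq_shift_0:
  assumes "dg_module M"
  shows "heq (shift 0 M) M"
proof -
  interpret M: dg_module M by fact
  show ?thesis
    by (rule heq_isoI[OF dg_module_shift[OF assms] assms, where f = id and g = id]; (intro dg_Z0I dg_homI)?)
       (auto simp: M.closed M.scale_one)
qed

section \<open>The homotopy category\<close>

text \<open>All members of the union in \<open>ho_comp\<close> are one and the same class, since
  composition respects homotopy.\<close>

lemma ho_comp_hclass:
  assumes "dg_module A" "dg_module B" "dg_module C" "f \<in> dg_Z0 A B" "g \<in> dg_Z0 B C"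
  shows "ho_comp A B C (hclass B C g) (hclass A B f) = hclass A C (g \<circ> f)"
proof -
  note AB = equiv_homotopy[OF assms(1,2)] and BC = equiv_homotopy[OF assms(2,3)]
    and AC = equiv_homotopy[OF assms(1,3)]
  have "hclass A C (g' \<circ> f') = hclass A C (g \<circ> f)" if "f' \<in> hclass A B f" "g' \<in> hclass B C g" for f' g'
  proof -
    have "(g \<circ> f, g' \<circ> f') \<in> homotopy_rel A C"
      using that by (intro homotopy_comp[OF assms(1-3)]) simp_all
    then show ?thesis by (metis equiv_class_eq[OF AC])
  qed
  moreover have "f \<in> hclass A B f" "g \<in> hclass B C g"
    using equiv_class_self[OF AB assms(4)] equiv_class_self[OF BC assms(5)] .
  ultimately show ?thesis unfolding ho_comp_def by blast
qed

lemma ho_shift_hclass: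
  assumes "dg_module A" "dg_module B" "f \<in> dg_Z0 A B"
  shows "ho_shift A B (hclass A B f) = hclass (shift 1 A) (shift 1 B) f"
proof -
  note AB = equiv_homotopy[OF assms(1,2)]
    and S = equiv_homotopy[OF dg_module_shift[OF assms(1), of 1] dg_module_shift[OF assms(2), of 1]]
  have "hclass (shift 1 A) (shift 1 B) f' = hclass (shift 1 A) (shift 1 B) f" if "f' \<in> hclass A B f" for f'
  proof -
    have "(f, f') \<in> homotopy_rel (shift 1 A) (shift 1 B)"
      using that by (intro homotopy_shift[OF assms(1,2)]) simp
    then show ?thesis by (metis equiv_class_eq[OF S])
  qed
  moreover have "f \<in> hclass A B f" using equiv_class_self[OF AB assms(3)] .
  ultimately show ?thesis unfolding ho_shift_def by blast
qed

lemma ho_cat_simps: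
  "Hom (ho_cat S) A B = dg_Z0 A B // homotopy_rel A B" "Ident (ho_cat S) A = hclass A A id"
  "Comp (ho_cat S) = ho_comp"
  by (simp_all add: ho_cat_def)

lemma cat_iso_hclass:
  assumes "dg_module A" "dg_module B" "f \<in> dg_Z0 A B" "g \<in> dg_Z0 B A"
    "(g \<circ> f, id) \<in> homotopy_rel A A" "(f \<circ> g, id) \<in> homotopy_rel B B"
  shows "hclass A B f \<in> cat_iso (ho_cat S) A B"
  unfolding cat_iso_def
proof (intro CollectI conjI bexI)
  show "hclass A B f \<in> Hom (ho_cat S) A B" "hclass B A g \<in> Hom (ho_cat S) B A"
    using assms by (auto simp: ho_cat_simps intro: quotientI)
  show "Comp (ho_cat S) A B A (hclass B A g) (hclass A B f) = Ident (ho_cat S) A"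
    "Comp (ho_cat S) B A B (hclass A B f) (hclass B A g) = Ident (ho_cat S) B"
    using equiv_class_eq[OF equiv_homotopy[OF assms(1,1)] assms(5)]
      equiv_class_eq[OF equiv_homotopy[OF assms(2,2)] assms(6)]
    by (simp_all add: ho_cat_simps ho_comp_hclass assms)
qed

lemma heq_cat_iso:
  assumes "dg_module A" "dg_module B" "heq A B"
  shows "cat_iso (ho_cat S) A B \<noteq> {}"
proof -
  from assms(3) obtain f g where "f \<in> dg_Z0 A B" "g \<in> dg_Z0 B A"
    "(g \<circ> f, id) \<in> homotopy_rel A A" "(f \<circ> g, id) \<in> homotopy_rel B B"
    unfolding heq_def by blast
  then show ?thesis using cat_iso_hclass[OF assms(1,2)] by blast
qed

lemma cat_iso_heq:
  assumes "dg_module A" "dg_module B" "u \<in> cat_iso (ho_cat S) A B"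
  shows "heq A B"
proof -
  from assms(3) obtain v where u: "u \<in> dg_Z0 A B // homotopy_rel A B" and v: "v \<in> dg_Z0 B A // homotopy_rel B A"
    and vu: "ho_comp A B A v u = hclass A A id" and uv: "ho_comp B A B u v = hclass B B id"
    by (auto simp: cat_iso_def ho_cat_simps)
  obtain f where f: "f \<in> dg_Z0 A B" "u = hclass A B f" using u by (rule quotientE)
  obtain g where g: "g \<in> dg_Z0 B A" "v = hclass B A g" using v by (rule quotientE)
  have "hclass A A (g \<circ> f) = hclass A A id" "hclass B B (f \<circ> g) = hclass B B id"
    using vu uv f g assms by (simp_all add: ho_comp_hclass)
  then have "(g \<circ> f, id) \<in> homotopy_rel A A" "(f \<circ> g, id) \<in> homotopy_rel B B"
    using f g assms eq_equiv_class[OF _ equiv_homotopy] dg_Z0_id by blast+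
  then show ?thesis using f g unfolding heq_def by blast
qed

lemma homotopy_category_simps [simp]:
  "Ob (homotopy_category S) = S" "Tri (homotopy_category S) = ho_tri S"
  "cat_iso (homotopy_category S) = cat_iso (ho_cat S)"
  by (simp_all add: homotopy_category_def cat.extend_def tri_cat.fields_def ho_cat_def cat_iso_def fun_eq_iff)

lemma standard_triangle:
  assumes X: "dg_module X" and Y: "dg_module Y" and f: "f \<in> dg_Z0 X Y"
    and S: "X \<in> S" "Y \<in> S" "cone X Y f \<in> S"
  shows "(X, Y, cone X Y f, hclass X Y f, hclass Y (cone X Y f) (\<lambda>y. Pair y (mzero X)),
    hclass (cone X Y f) (shift 1 X) rgt) \<in> ho_tri S"
proof -
  interpret X: dg_module X by fact
  interpret Y: dg_module Y by fact
  let ?C = "cone X Y f"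
  note C = dg_module_cone[OF X Y f] and X1 = dg_module_shift[OF X, of 1]
  note [simp] = X.closed Y.closed X.mzeros Y.mzeros X.deg_zero dg_hom_car[OF dg_Z0_hom[OF f]]
  have "f (mzero X) = mzero Y"
    using dg_hom_scale[OF dg_Z0_hom[OF f], of "mzero X" 0] by (simp add: Y.scale_zero)
  then have i: "(\<lambda>y. Pair y (mzero X)) \<in> dg_Z0 Y ?C"
    by (intro dg_Z0I dg_homI) (auto simp: Y.scale_one)
  have p: "rgt \<in> dg_Z0 ?C (shift 1 X)"
    by (intro dg_Z0I dg_homI) (auto simp: X.scale_one)
  have iso: "hclass M M id \<in> cat_iso (ho_cat S) M M" if "dg_module M" for M
    using that by (intro cat_iso_hclass) (auto intro!: dg_Z0_id homotopy_eqI)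
  show ?thesis unfolding ho_tri_def mem_Collect_eq prod.case
    by (intro conjI S bexI[OF _ S(1)] bexI[OF _ S(2)] bexI[OF _ f] bexI[OF _ iso[OF X]]
        bexI[OF _ iso[OF Y]] bexI[OF _ iso[OF C]])
      (simp_all add: f i p ho_comp_hclass ho_shift_hclass X Y C X1 dg_Z0_id quotientI ho_cat_simps)
qed

text \<open>The relation which a triangle imposes on K0 involves only its objects. The commuting
  squares can be forgotten and the triangle replaced by a cone with equivalent terms.\<close>

lemma ho_tri_heq:
  assumes "\<And>M. M \<in> S \<Longrightarrow> dg_module M" "\<And>M N f. M \<in> S \<Longrightarrow> N \<in> S \<Longrightarrow> f \<in> dg_Z0 M N \<Longrightarrow> cone M N f \<in> S"
    "(A, B, C, u, v, w) \<in> ho_tri S"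
  obtains X Y f where "X \<in> S" "Y \<in> S" "f \<in> dg_Z0 X Y" "heq A X" "heq B Y" "heq C (cone X Y f)"
proof -
  from assms(3) obtain X Y f \<alpha> \<beta> \<gamma> where *: "A \<in> S" "B \<in> S" "C \<in> S" "X \<in> S" "Y \<in> S" "f \<in> dg_Z0 X Y"
    "\<alpha> \<in> cat_iso (ho_cat S) A X" "\<beta> \<in> cat_iso (ho_cat S) B Y" "\<gamma> \<in> cat_iso (ho_cat S) C (cone X Y f)"
    unfolding ho_tri_def by blast
  then show thesis
    using assms(1,2) by (intro that[of X Y f] cat_iso_heq[OF _ _ *(7)] cat_iso_heq[OF _ _ *(8)]
        cat_iso_heq[OF _ _ *(9)]) auto
qed

section \<open>Euler characteristics\<close>

definition par_sign :: "int \<Rightarrow> int" where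
  "par_sign n = (if even n then 1 else -1)"

lemma ksgn_par_sign: "ksgn n = (of_int (par_sign n) :: 'k::field_char_0)"
  by (simp add: ksgn_def par_sign_def)

datatype ('m, 'k) dgen = DGen (dm: 'm) (dy: "int stream") (de: int) (db: "'m \<Rightarrow> int stream \<Rightarrow> 'k")

text \<open>
  The graded space of homomorphisms from \<open>M\<close> to \<open>repN A\<close> has the basis \<open>db t\<close>, and \<open>f \<mapsto> f (dm t) (dy t)\<close> are the
  coordinates of \<open>f\<close>.
\<close>

definition dual_basis ::
  "int set \<Rightarrow> ('k::field_char_0, 'm) dgmod \<Rightarrow> ('m, 'k) dgen list \<Rightarrow> bool" where
  "dual_basis A M L \<longleftrightarrow>
     (\<forall>t\<in>set L. dm t \<in> mcar M \<and> db t \<in> dg_hom M (repN A) (de t) \<and> db t (dm t) (dy t) = 1) \<and>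
     (\<forall>n. \<forall>f\<in>dg_hom M (repN A) n.
        (\<forall>t\<in>set L. f (dm t) (dy t) \<noteq> 0 \<longrightarrow> even (n - de t)) \<and>
        (\<forall>x\<in>mcar M. \<forall>z. f x z = (\<Sum>t\<leftarrow>L. f (dm t) (dy t) * db t x z)))"

definition euler :: "('m, 'k) dgen list \<Rightarrow> int" where
  "euler L = (\<Sum>t\<leftarrow>L. par_sign (de t))"

text \<open>The supertrace of \<open>f \<mapsto> f \<circ> T\<close> on the homomorphisms to
  \<open>repN A\<close>: the summand for \<open>t\<close> is the coordinate of
  \<open>db t \<circ> T\<close> along \<open>db t\<close>. For \<open>T = id\<close> the
  normalisation of \<open>db t\<close> turns it into \<open>euler L\<close>.\<close>

definition supertrace :: "('m, 'k::field_char_0) dgen list \<Rightarrow> ('m \<Rightarrow> 'm) \<Rightarrow> 'k" where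
  "supertrace L T = (\<Sum>t\<leftarrow>L. ksgn (de t) * db t (T (dm t)) (dy t))"

lemma sum_ksgn: "(\<Sum>t\<leftarrow>L. ksgn (de t)) = of_int (euler L)"
  unfolding euler_def by (induction L) (simp_all add: ksgn_par_sign)

lemma dual_basisD:
  assumes "dual_basis A M L" "t \<in> set L"
  shows "dm t \<in> mcar M" "db t \<in> dg_hom M (repN A) (de t)" "db t (dm t) (dy t) = 1"
  using assms by (auto simp: dual_basis_def)

lemma dual_basis_parity:
  assumes "dual_basis A M L" "t \<in> set L" "f \<in> dg_hom M (repN A) n" "f (dm t) (dy t) \<noteq> 0"
  shows "even (n - de t)"
  using assms by (auto simp: dual_basis_def)

lemma dual_basis_expand:
  assumes "dual_basis A M L" "f \<in> dg_hom M (repN A) n" "x \<in> mcar M"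
  shows "f x z = (\<Sum>t\<leftarrow>L. f (dm t) (dy t) * db t x z)"
  using assms unfolding dual_basis_def by blast

lemma sum_list_swap:
  fixes f :: "'x \<Rightarrow> 'y \<Rightarrow> 'z::comm_monoid_add"
  shows "(\<Sum>x\<leftarrow>xs. \<Sum>y\<leftarrow>ys. f x y) = (\<Sum>y\<leftarrow>ys. \<Sum>x\<leftarrow>xs. f x y)"
  by (induction xs) (simp_all add: sum_list_addf)

lemma sum_list_cong: "(\<And>x. x \<in> set xs \<Longrightarrow> f x = g x) \<Longrightarrow> sum_list (map f xs) = sum_list (map g xs)"
  by (metis map_eq_conv)

text \<open>Cyclicity of the trace: each composite is expanded in the other list, and the double sum
  is read in either order. The signs agree because maps of degree 0 have nonzero entries only
  between elements of equal parity.\<close>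

lemma supertrace_commute:
  fixes M :: "('k::field_char_0, 'm) dgmod" and M' :: "('k, 'n) dgmod"
  assumes M: "dg_module M" "dual_basis A M L" and M': "dg_module M'" "dual_basis A M' L'"
    and f: "f \<in> dg_Z0 M M'" and g: "g \<in> dg_Z0 M' M"
  shows "supertrace L (g \<circ> f) = supertrace L' (f \<circ> g)"
proof -
  note N = dg_module_repN[of A, where 'a = 'k]
  have bg: "db t \<circ> g \<in> dg_hom M' (repN A) (de t)" if "t \<in> set L" for t
    using dg_hom_comp[OF M'(1) M(1) N dg_Z0_hom[OF g] dual_basisD(2)[OF M(2) that]] by simp
  have bf: "db u \<circ> f \<in> dg_hom M (repN A) (de u)" if "u \<in> set L'" for u
    using dg_hom_comp[OF M(1) M'(1) N dg_Z0_hom[OF f] dual_basisD(2)[OF M'(2) that]] by simp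
  have "supertrace L (g \<circ> f) = (\<Sum>t\<leftarrow>L. \<Sum>u\<leftarrow>L'. ksgn (de t) *
      (db t (g (dm u)) (dy u) * db u (f (dm t)) (dy t)))"
    unfolding supertrace_def
  proof (rule sum_list_cong)
    fix t assume t: "t \<in> set L"
    have "f (dm t) \<in> mcar M'" using dual_basisD(1)[OF M(2) t] dg_hom_car[OF dg_Z0_hom[OF f]] by blast
    from dual_basis_expand[OF M'(2) bg[OF t] this, of "dy t"]
    show "ksgn (de t) * db t ((g \<circ> f) (dm t)) (dy t) = (\<Sum>u\<leftarrow>L'. ksgn (de t) *
      (db t (g (dm u)) (dy u) * db u (f (dm t)) (dy t)))"
      by (simp add: sum_list_const_mult)
  qed
  also have "\<dots> = (\<Sum>u\<leftarrow>L'. \<Sum>t\<leftarrow>L. ksgn (de t) *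
      (db t (g (dm u)) (dy u) * db u (f (dm t)) (dy t)))"
    by (rule sum_list_swap)
  also have "\<dots> = (\<Sum>u\<leftarrow>L'. \<Sum>t\<leftarrow>L. ksgn (de u) *
      (db u (f (dm t)) (dy t) * db t (g (dm u)) (dy u)))"
  proof (intro sum_list_cong)
    fix u t assume u: "u \<in> set L'" and t: "t \<in> set L"
    show "ksgn (de t) * (db t (g (dm u)) (dy u) * db u (f (dm t)) (dy t)) =
        ksgn (de u) * (db u (f (dm t)) (dy t) * db t (g (dm u)) (dy u))"
    proof (cases "db t (g (dm u)) (dy u) = 0")
      case False
      then have "even (de t - de u)" using dual_basis_parity[OF M'(2) u bg[OF t]] by simp
      then show ?thesis using ksgn_cong[of "de t" "de u", where 'k = 'k] by simp
    qed simp
  qed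
  also have "\<dots> = supertrace L' (f \<circ> g)"
    unfolding supertrace_def
  proof (rule sum_list_cong)
    fix u assume u: "u \<in> set L'"
    have "g (dm u) \<in> mcar M" using dual_basisD(1)[OF M'(2) u] dg_hom_car[OF dg_Z0_hom[OF g]] by blast
    from dual_basis_expand[OF M(2) bf[OF u] this, of "dy u"]
    show "(\<Sum>t\<leftarrow>L. ksgn (de u) * (db u (f (dm t)) (dy t) * db t (g (dm u)) (dy u))) =
      ksgn (de u) * db u ((f \<circ> g) (dm u)) (dy u)"
      by (simp add: sum_list_const_mult)
  qed
  finally show ?thesis .
qed

text \<open>In \<open>f (d (r x))\<close> the term with \<open>rdiff r\<close> vanishes, because
  derivatives act by zero on \<open>repN A\<close>; the other term has the sign of a homomorphism of
  degree \<open>n + 1\<close>.\<close>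

lemma dg_hom_repN_diff:
  fixes M :: "('k::field_char_0, 'm) dgmod"
  assumes "dg_module M" "f \<in> dg_hom M (repN A) n"
  shows "f \<circ> mdiff M \<in> dg_hom M (repN A) (n + 1)"
proof -
  interpret M: dg_module M by fact
  note [simp] = dg_hom_add[OF assms(2)] dg_hom_scale[OF assms(2)] M.closed
  show ?thesis
  proof (rule dg_homI)
    fix p x assume "x \<in> mdeg M p"
    then show "(f \<circ> mdiff M) x \<in> mdeg (repN A) (p + (n + 1))"
      using dg_hom_deg[OF assms(2) M.deg_diff, of x p] by (simp add: ac_simps)
  next
    fix q x and r :: "'k ralg" assume x: "x \<in> mcar M" and r: "rdeg q r"
    have "f (mact M (rdiff r) x) = (\<lambda>_. 0)"
      using dg_hom_act[OF assms(2) x rdeg_rdiff[OF r]] by simp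
    moreover have "f (mact M (rpar r) (mdiff M x)) =
        (\<lambda>z. ksgn q * (ksgn (n * q) * rho A r (f (mdiff M x)) z))"
      using dg_hom_act[OF assms(2) M.diff_closed[OF x] r] r x by (simp add: M.act_rpar)
    moreover have "ksgn ((n + 1) * q) = (ksgn q * ksgn (n * q) :: 'k)"
      by (simp add: distrib_right ksgn_add)
    ultimately show "(f \<circ> mdiff M) (mact M r x) =
        mscale (repN A) (ksgn ((n + 1) * q)) (mact (repN A) r ((f \<circ> mdiff M) x))"
      using x by (simp add: M.diff_act mult.assoc)
  qed (auto simp: M.diff_add M.diff_scale)
qed

text \<open>Writing \<open>T = id + d h + h d\<close>, the identity contributes
  \<open>euler L\<close>. Composition with \<open>d\<close> changes the parity, so the contributions
  of \<open>d h\<close> and \<open>h d\<close> cancel, as in the supertrace of a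
  supercommutator.\<close>

lemma supertrace_homotopy:
  fixes M :: "('k::field_char_0, 'm) dgmod"
  assumes M: "dg_module M" "dual_basis A M L" and T: "(T, id) \<in> homotopy_rel M M"
  shows "supertrace L T = of_int (euler L)"
proof -
  interpret M: dg_module M by (fact M(1))
  note N = dg_module_repN[of A, where 'a = 'k]
  from T obtain h where h: "h \<in> dg_hom M M (-1)"
    and e: "\<And>x. x \<in> mcar M \<Longrightarrow> T x = madd M (id x) (madd M (mdiff M (h x)) (h (mdiff M x)))"
    by (rule homotopy_relE) blast
  have bd: "db t \<circ> mdiff M \<in> dg_hom M (repN A) (de t + 1)" if "t \<in> set L" for t
    by (rule dg_hom_repN_diff[OF M(1) dual_basisD(2)[OF M(2) that]])
  have bh: "db t \<circ> h \<in> dg_hom M (repN A) (-1 + de t)" if "t \<in> set L" for t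
    by (rule dg_hom_comp[OF M(1) M(1) N h dual_basisD(2)[OF M(2) that]])
  let ?D = "\<lambda>t u. db t (mdiff M (dm u)) (dy u)" and ?H = "\<lambda>t u. db t (h (dm u)) (dy u)"
  have "supertrace L T = (\<Sum>t\<leftarrow>L. ksgn (de t) + ((\<Sum>u\<leftarrow>L. ksgn (de t) * (?D t u * ?H u t)) +
      (\<Sum>u\<leftarrow>L. ksgn (de t) * (?H t u * ?D u t))))"
    unfolding supertrace_def
  proof (rule sum_list_cong)
    fix t assume t: "t \<in> set L"
    note b = dual_basisD[OF M(2) t]
    have c: "h (dm t) \<in> mcar M" "mdiff M (dm t) \<in> mcar M" "h (mdiff M (dm t)) \<in> mcar M"
      "mdiff M (h (dm t)) \<in> mcar M"
      using b(1) dg_hom_car[OF h] by (auto simp: M.closed)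
    have "db t (T (dm t)) (dy t) = 1 + (db t (mdiff M (h (dm t))) (dy t) + db t (h (mdiff M (dm t))) (dy t))"
      using b c by (simp add: e dg_hom_add[OF b(2)] M.closed)
    moreover have "db t (mdiff M (h (dm t))) (dy t) = (\<Sum>u\<leftarrow>L. ?D t u * ?H u t)"
      using dual_basis_expand[OF M(2) bd[OF t] c(1)] by simp
    moreover have "db t (h (mdiff M (dm t))) (dy t) = (\<Sum>u\<leftarrow>L. ?H t u * ?D u t)"
      using dual_basis_expand[OF M(2) bh[OF t] c(2)] by simp
    ultimately show "ksgn (de t) * db t (T (dm t)) (dy t) = ksgn (de t) +
       ((\<Sum>u\<leftarrow>L. ksgn (de t) * (?D t u * ?H u t)) + (\<Sum>u\<leftarrow>L. ksgn (de t) * (?H t u * ?D u t)))"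
      by (simp add: sum_list_const_mult distrib_left)
  qed
  also have "\<dots> = of_int (euler L) + ((\<Sum>t\<leftarrow>L. \<Sum>u\<leftarrow>L. ksgn (de t) * (?D t u * ?H u t)) +
      (\<Sum>t\<leftarrow>L. \<Sum>u\<leftarrow>L. ksgn (de t) * (?H t u * ?D u t)))"
    by (simp only: sum_list_addf sum_ksgn)
  \<comment> \<open>Interchanging the two indices matches the products with those of the first sum;
    only the signs remain to be compared.\<close>
  also have "(\<Sum>t\<leftarrow>L. \<Sum>u\<leftarrow>L. ksgn (de t) * (?H t u * ?D u t)) =
      (\<Sum>t\<leftarrow>L. \<Sum>u\<leftarrow>L. ksgn (de u) * (?H u t * ?D t u))"
    by (rule sum_list_swap)
  also have "(\<Sum>t\<leftarrow>L. \<Sum>u\<leftarrow>L. ksgn (de t) * (?D t u * ?H u t)) + \<dots> =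
      (\<Sum>t\<leftarrow>L. \<Sum>u\<leftarrow>L. ksgn (de t) * (?D t u * ?H u t) + ksgn (de u) * (?H u t * ?D t u))"
    by (simp only: sum_list_addf)
  also have "\<dots> = (\<Sum>t\<leftarrow>L. \<Sum>u\<leftarrow>L. 0)"
  proof (intro sum_list_cong)
    fix t u assume t: "t \<in> set L" and u: "u \<in> set L"
    show "ksgn (de t) * (?D t u * ?H u t) + ksgn (de u) * (?H u t * ?D t u) = 0"
    proof (cases "?D t u = 0")
      case False
      then have "even (de t + 1 - de u)" using dual_basis_parity[OF M(2) u bd[OF t]] by simp
      then have "ksgn (de u) = (- ksgn (de t) :: 'k)" by (auto simp: ksgn_def)
      then show ?thesis by simp
    qed simp
  qed
  finally show ?thesis by simp
qed

lemma euler_heq: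
  fixes M :: "('k::field_char_0, 'm) dgmod" and M' :: "('k, 'n) dgmod"
  assumes M: "dg_module M" "dual_basis A M L" and M': "dg_module M'" "dual_basis A M' L'"
    and "heq M M'"
  shows "euler L = euler L'"
proof -
  from assms(5) obtain f g where fg: "f \<in> dg_Z0 M M'" "g \<in> dg_Z0 M' M"
    "(g \<circ> f, id) \<in> homotopy_rel M M" "(f \<circ> g, id) \<in> homotopy_rel M' M'"
    unfolding heq_def by blast
  have "(of_int (euler L) :: 'k) = of_int (euler L')"
    using supertrace_homotopy[OF M fg(3)] supertrace_homotopy[OF M' fg(4)]
      supertrace_commute[OF M M' fg(1,2)] by simp
  then show ?thesis by simp
qed

lemma heq_refl: "dg_module M \<Longrightarrow> heq M M"
  by (rule heq_isoI[where f = id and g = id]) (auto intro: dg_Z0_id)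

text \<open>The twist of the action on \<open>shift n M\<close> accounts exactly for the passage
  from \<open>ksgn (m * q)\<close> to \<open>ksgn ((m + n) * q)\<close>.\<close>

lemma dg_hom_shift_iff:
  fixes M :: "('k::field_char_0, 'm) dgmod" and N :: "('k, 'n) dgmod"
  assumes "dg_module M" "dg_module N"
  shows "f \<in> dg_hom (shift n M) N (m + n) \<longleftrightarrow> f \<in> dg_hom M N m"
proof -
  interpret M: dg_module M by fact
  interpret N: dg_module N by fact
  show ?thesis
  proof
    assume f: "f \<in> dg_hom (shift n M) N (m + n)"
    show "f \<in> dg_hom M N m"
    proof (rule dg_homI)
      fix p x assume "x \<in> mdeg M p"
      then show "f x \<in> mdeg N (p + m)" using dg_hom_deg[OF f, of x "p - n"] by simp
    next
      fix q x and r :: "'k ralg" assume x: "x \<in> mcar M" and r: "rdeg q r"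
      show "f (mact M r x) = mscale N (ksgn (m * q)) (mact N r (f x))"
        using dg_hom_act[OF f, of x q r] dg_hom_act[OF f, of x q "rpar r"] dg_hom_car[OF f, of x] x r
        by (cases "even n"; cases "even m"; cases "even q")
           (simp_all add: rdeg_rpar N.act_rpar N.scale_scale N.scale_one N.closed ksgn_def)
    qed (use dg_hom_car[OF f] dg_hom_add[OF f] dg_hom_scale[OF f] in auto)
  next
    assume f: "f \<in> dg_hom M N m"
    show "f \<in> dg_hom (shift n M) N (m + n)"
    proof (rule dg_homI)
      fix p x assume "x \<in> mdeg (shift n M) p"
      then show "f x \<in> mdeg N (p + (m + n))" using dg_hom_deg[OF f, of x "p + n"] by (simp add: ac_simps)
    next
      fix q x and r :: "'k ralg" assume x: "x \<in> mcar (shift n M)" and r: "rdeg q r"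
      show "f (mact (shift n M) r x) = mscale N (ksgn ((m + n) * q)) (mact N r (f x))"
        using dg_hom_act[OF f, of x q r] dg_hom_act[OF f, of x q "rpar r"] dg_hom_car[OF f, of x] x r
        by (cases "even n"; cases "even m"; cases "even q")
           (simp_all add: rdeg_rpar N.act_rpar N.scale_scale N.scale_one N.closed ksgn_def)
    qed (use dg_hom_car[OF f] dg_hom_add[OF f] dg_hom_scale[OF f] in auto)
  qed
qed

section \<open>Dual bases for shifts, cones and projective modules\<close>

lemma dual_basis_shift:
  assumes M: "dg_module M" "dual_basis A M L"
  shows "dual_basis A (shift n M) (map (\<lambda>t. DGen (dm t) (dy t) (de t + n) (db t)) L)"
proof -
  note iff = dg_hom_shift_iff[OF M(1) dg_module_repN, of _ n]
  show ?thesis unfolding dual_basis_def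
  proof (intro conjI allI ballI impI)
    fix m f assume "f \<in> dg_hom (shift n M) (repN A) m"
    then have f: "f \<in> dg_hom M (repN A) (m - n)" using iff[where m = "m - n"] by simp
    {
      fix t assume t: "t \<in> set (map (\<lambda>t. DGen (dm t) (dy t) (de t + n) (db t)) L)" "f (dm t) (dy t) \<noteq> 0"
      then obtain t' where "t' \<in> set L" "t = DGen (dm t') (dy t') (de t' + n) (db t')" by auto
      then show "even (m - de t)" using dual_basis_parity[OF M(2) _ f, of t'] t by (simp add: algebra_simps)
    next
      fix x z assume "x \<in> mcar (shift n M)"
      then show "f x z = (\<Sum>t\<leftarrow>map (\<lambda>t. DGen (dm t) (dy t) (de t + n) (db t)) L. f (dm t) (dy t) * db t x z)"
        using dual_basis_expand[OF M(2) f] by (simp add: comp_def)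
    }
  qed (use dual_basisD[OF M(2)] in \<open>auto simp: iff\<close>)
qed

text \<open>The map \<open>f\<close> enters the cone only through its differential. The underlying
  graded module is the direct sum of \<open>N\<close> and \<open>shift 1 M\<close>, so homomorphisms
  split into two components and the lists can be concatenated.\<close>

lemma dual_basis_cone:
  fixes M :: "'k::field_char_0 dgobj" and N :: "'k dgobj"
  assumes M: "dg_module M" "dual_basis A M L" and N: "dg_module N" "dual_basis A N K" and f: "f \<in> dg_Z0 M N"
  shows "dual_basis A (cone M N f)
    (map (\<lambda>t. DGen (Pair (dm t) (mzero M)) (dy t) (de t) (db t \<circ> lft)) K @
     map (\<lambda>t. DGen (Pair (mzero N) (dm t)) (dy t) (de t + 1) (db t \<circ> rgt)) L)"
    (is "dual_basis A ?C ?L")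
proof -
  interpret M: dg_module M by (fact M(1))
  interpret N: dg_module N by (fact N(1))
  note R = dg_module_repN[of A, where 'a = 'k]
  note C = dg_module_cone[OF M(1) N(1) f] and M1 = dg_module_shift[OF M(1), of 1]
  note iff = dg_hom_shift_iff[OF M(1) R, of _ 1]
  note [simp] = M.closed N.closed M.mzeros N.mzeros M.deg_zero N.deg_zero
  have l: "lft \<in> dg_hom ?C N 0" "(\<lambda>y. Pair y (mzero M)) \<in> dg_hom N ?C 0"
    by (rule dg_homI; auto simp: N.scale_one)+
  have r: "rgt \<in> dg_hom ?C (shift 1 M) 0" "(\<lambda>x. Pair (mzero N) x) \<in> dg_hom (shift 1 M) ?C 0"
    by (rule dg_homI; auto simp: M.scale_one)+
  show ?thesis unfolding dual_basis_def
  proof (intro conjI allI ballI impI)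
    fix t assume "t \<in> set ?L"
    then show "dm t \<in> mcar ?C" "db t (dm t) (dy t) = 1"
      using dual_basisD[OF M(2)] dual_basisD[OF N(2)] by auto
    have "db s \<circ> lft \<in> dg_hom ?C (repN A) (de s)" if "s \<in> set K" for s
      using dg_hom_comp[OF C N(1) R l(1) dual_basisD(2)[OF N(2) that]] by simp
    moreover have "db s \<circ> rgt \<in> dg_hom ?C (repN A) (de s + 1)" if "s \<in> set L" for s
    proof -
      have "db s \<in> dg_hom (shift 1 M) (repN A) (de s + 1)" using dual_basisD(2)[OF M(2) that] iff by blast
      from dg_hom_comp[OF C M1 R r(1) this] show ?thesis by simp
    qed
    ultimately show "db t \<in> dg_hom ?C (repN A) (de t)" using \<open>t \<in> set ?L\<close> by auto
  next
    fix n F assume F: "F \<in> dg_hom ?C (repN A) n"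
    have F1: "F \<circ> (\<lambda>y. Pair y (mzero M)) \<in> dg_hom N (repN A) n"
      using dg_hom_comp[OF N(1) C R l(2) F] by simp
    have "F \<circ> (\<lambda>x. Pair (mzero N) x) \<in> dg_hom (shift 1 M) (repN A) n"
      using dg_hom_comp[OF M1 C R r(2) F] by simp
    then have F2: "F \<circ> (\<lambda>x. Pair (mzero N) x) \<in> dg_hom M (repN A) (n - 1)"
      using iff[where m = "n - 1"] by simp
    {
      fix t assume "t \<in> set ?L" "F (dm t) (dy t) \<noteq> 0"
      then show "even (n - de t)"
        using dual_basis_parity[OF N(2) _ F1] dual_basis_parity[OF M(2) _ F2]
        by (auto simp: algebra_simps)
    next
      fix u z assume "u \<in> mcar ?C"
      then obtain y x where u: "y \<in> mcar N" "x \<in> mcar M" "u = Pair y x" by auto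
      have "F u z = F (madd ?C (Pair y (mzero M)) (Pair (mzero N) x)) z" using u by simp
      also have "\<dots> = F (Pair y (mzero M)) z + F (Pair (mzero N) x) z"
        using u by (subst dg_hom_add[OF F]) auto
      also have "\<dots> = (\<Sum>t\<leftarrow>?L. F (dm t) (dy t) * db t u z)"
        using dual_basis_expand[OF N(2) F1 u(1), of z] dual_basis_expand[OF M(2) F2 u(2), of z] u(3)
        by (simp add: comp_def)
      finally show "F u z = (\<Sum>t\<leftarrow>?L. F (dm t) (dy t) * db t u z)" .
    }
  qed
qed

lemma projP_simps [simp]:
  "madd (projP x) u v = Leaf (leaf u + leaf v)" "mzero (projP x) = Leaf 0"
  "mscale (projP x) c u = Leaf (rscale c (leaf u))" "mact (projP x) r u = Leaf (r * leaf u)"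
  "mdiff (projP x) u = Leaf (rdiff (leaf u))"
  by (simp_all add: projP_def)

lemma projP_car: "u \<in> mcar (projP x) \<longleftrightarrow> (\<exists>r. u = Leaf (r * ridem x))"
  by (simp add: projP_def)

lemma projP_deg: "u \<in> mdeg (projP x) p \<longleftrightarrow> (\<exists>r. rdeg p r \<and> u = Leaf (r * ridem x))"
  by (auto simp: projP_def)

lemma rho_zero [simp]: "rho A r (\<lambda>z. 0) = (\<lambda>z. 0)"
  using rho_scale[of A r 0 "\<lambda>z. 0"] by simp

text \<open>For odd \<open>n\<close> the automorphism \<open>rpar\<close> expresses the sign
  depending on the degree of \<open>r\<close> for all \<open>r\<close> at once, homogeneous or
  not.\<close>

lemma dg_hom_projP_repN:
  fixes f :: "'k::field_char_0 ralg pairs \<Rightarrow> int stream \<Rightarrow> 'k"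
  assumes f: "f \<in> dg_hom (projP y) (repN A) n"
  shows "f (Leaf (r * ridem y)) = rho A (if even n then r else rpar r) (f (Leaf (ridem y)))"
proof (induction r rule: ralg_hom_induct)
  case (hom q r)
  have "Leaf (ridem y) \<in> mcar (projP y)" unfolding projP_car by (metis ridem_idem)
  from dg_hom_act[OF f this hom] show ?case
    by (cases "even n") (auto simp: rpar_rdeg[OF hom] ksgn_def fun_eq_iff)
next
  case (add r s)
  have "Leaf (r * ridem y) \<in> mcar (projP y)" "Leaf (s * ridem y) \<in> mcar (projP y)"
    unfolding projP_car by blast+
  from dg_hom_add[OF f this] add show ?case by (simp add: distrib_right)
qed

text \<open>A homomorphism is determined by its value at the idempotent, which is fixed by that
  idempotent: a multiple of the basis vector at \<open>y\<close>, or zero if \<open>y\<close> is not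
  in \<open>rearr A\<close>. The parity of that vector is that of \<open>ninv y\<close>, which gives
  the degree.\<close>

lemma dual_basis_projP:
  "dual_basis A (projP y :: 'k::field_char_0 dgobj) (if y \<in> rearr A
     then [DGen (Leaf (ridem y)) y (ninv y)
       (\<lambda>u. rho A (if even (ninv y) then leaf u else rpar (leaf u)) (\<lambda>z. if z = y then 1 else 0))]
     else [])"
proof -
  let ?P = "projP y :: 'k dgobj" and ?v = "(\<lambda>z. if z = y then 1 else 0) :: int stream \<Rightarrow> 'k"
  let ?b = "\<lambda>u. rho A (if even (ninv y) then leaf u else rpar (leaf u)) ?v"
  have 1: "Leaf (ridem y) \<in> mcar ?P" "Leaf (ridem y) \<in> mdeg ?P 0"
    unfolding projP_car projP_deg by (metis ridem_idem, metis ridem_idem rdeg_ridem)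
  have f1: "\<exists>c. f (Leaf (ridem y)) = (\<lambda>z. c * (if z = y \<and> y \<in> rearr A then 1 else 0))"
    if "f \<in> dg_hom ?P (repN A) n" for f n
  proof -
    have e: "(if even n then ridem y else rpar (ridem y)) = (ridem y :: 'k ralg)" by simp
    have "f (Leaf (ridem y)) = rho A (ridem y) (f (Leaf (ridem y)))"
      by (rule dg_hom_projP_repN[OF that, of "ridem y", unfolded ridem_idem e])
    moreover have "rho A (ridem y) w = (\<lambda>z. w y * (if z = y \<and> y \<in> rearr A then 1 else 0))" for w :: "int stream \<Rightarrow> 'k"
      by auto
    ultimately show ?thesis by metis
  qed
  show ?thesis
  proof (cases "y \<in> rearr A")
    case False
    have "f x z = 0" if f: "f \<in> dg_hom ?P (repN A) n" and x: "x \<in> mcar ?P" for f n x z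
    proof -
      obtain r where "x = Leaf (r * ridem y)" using x by (auto simp: projP_car)
      then show ?thesis
        using dg_hom_projP_repN[OF f, of r] f1[OF f] False by auto
    qed
    then show ?thesis using False by (simp add: dual_basis_def)
  next
    case True
    have v: "rho A (ridem y) ?v = ?v" using True by (auto simp: fun_eq_iff)
    have b: "?b \<in> dg_hom ?P (repN A) (ninv y)"
    proof (rule dg_homI)
      fix p u assume "u \<in> mdeg ?P p"
      then have "rdeg p (if even (ninv y) then leaf u else rpar (leaf u))"
        using rdeg.intros(5)[OF _ rdeg_ridem[of y], where 'k = 'k] by (auto simp: projP_deg intro!: rdeg_rpar)
      then have "?b u \<in> mdeg (repN A) (ninv y + p)" by (rule rho_mdeg) simp
      then show "?b u \<in> mdeg (repN A) (p + ninv y)" by (simp only: add.commute)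
    next
      fix q u and r :: "'k ralg" assume "rdeg q r"
      then show "?b (mact ?P r u) = mscale (repN A) (ksgn (ninv y * q)) (mact (repN A) r (?b u))"
        by (auto simp: rpar_rdeg ksgn_def fun_eq_iff)
    qed auto
    have bL: "?b (Leaf (ridem y)) y = 1" using v by (simp del: rho_simps(1))
    have par: "even (n - ninv y)" if "f \<in> dg_hom ?P (repN A) n" "f (Leaf (ridem y)) y \<noteq> 0" for f n
      using dg_hom_deg[OF that(1) 1(2)] that(2) by auto
    have expand: "f x z = f (Leaf (ridem y)) y * ?b x z"
      if f: "f \<in> dg_hom ?P (repN A) n" and x: "x \<in> mcar ?P" for f n x z
    proof -
      obtain r where r: "x = Leaf (r * ridem y)" using x by (auto simp: projP_car)
      let ?r = "\<lambda>n. if even n then r else rpar r"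
      obtain c where c: "f (Leaf (ridem y)) = (\<lambda>z. c * ?v z)" using f1[OF f] True by auto
      have "f x z = c * rho A (?r n) ?v z"
        unfolding r dg_hom_projP_repN[OF f, of r] c by (rule fun_cong[OF rho_scale])
      then have fx: "f x z = f (Leaf (ridem y)) y * rho A (?r n) ?v z" using c by simp
      have bx: "?b x = rho A (?r (ninv y)) ?v" unfolding r using v by (simp del: rho_simps(1))
      show ?thesis
      proof (cases "f (Leaf (ridem y)) y = 0")
        case False
        \<comment> \<open>A nonzero coordinate forces \<open>n\<close> and \<open>ninv y\<close> to
          have the same parity, so both homomorphisms twist \<open>r\<close> in the same
          way.\<close>
        then have "?r n = ?r (ninv y)" using par[OF f] by auto
        then show ?thesis using fx unfolding bx by (simp only:)
      qed (simp only: fx mult_zero_left)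
    qed
    have "dual_basis A ?P [DGen (Leaf (ridem y)) y (ninv y) ?b]"
      unfolding dual_basis_def
    proof (intro conjI allI ballI impI)
      fix t assume "t \<in> set [DGen (Leaf (ridem y)) y (ninv y) ?b]"
      then have t: "t = DGen (Leaf (ridem y)) y (ninv y) ?b" by (simp only: list.set empty_iff insert_iff simp_thms)
      show "dm t \<in> mcar ?P" "db t \<in> dg_hom ?P (repN A) (de t)" "db t (dm t) (dy t) = 1"
        unfolding t dgen.sel by (rule 1 b bL)+
      show "even (n - de t)" if "f \<in> dg_hom ?P (repN A) n" "f (dm t) (dy t) \<noteq> 0" for f n
        using par that unfolding t dgen.sel by blast
    next
      fix f n x z assume "f \<in> dg_hom ?P (repN A) n" "x \<in> mcar ?P"
      then show "f x z = (\<Sum>t\<leftarrow>[DGen (Leaf (ridem y)) y (ninv y) ?b]. f (dm t) (dy t) * db t x z)"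
        by (simp only: list.map sum_list.Cons sum_list.Nil dgen.sel add_0_right) (rule expand)
    qed
    then show ?thesis using True by (simp only: if_True)
  qed
qed

definition chi :: "int set \<Rightarrow> ('k::field_char_0, 'm) dgmod \<Rightarrow> int" where
  "chi A M = (SOME n. \<exists>L. dual_basis A M L \<and> n = euler L)"

text \<open>Homotopy invariance, applied to \<open>M\<close> and itself, shows that all dual bases
  give the same number.\<close>

lemma chi_eq: "dg_module M \<Longrightarrow> dual_basis A M L \<Longrightarrow> chi A M = euler L"
  unfolding chi_def by (rule some_equality) (auto intro: euler_heq heq_refl)

lemma DGP_dual_basis: "M \<in> DGP S \<Longrightarrow> \<exists>L. dual_basis A M L"
proof (induction rule: DGP.induct)
  case (DGP_proj x)
  show ?case using dual_basis_projP by blast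
next
  case (DGP_shift M n)
  then show ?case using dual_basis_shift[OF DGP_dg_module] by blast
next
  case (DGP_cone M N f)
  then obtain L K where "dual_basis A M L" "dual_basis A N K" by blast
  from dual_basis_cone[OF DGP_dg_module[OF DGP_cone(1)] this(1) DGP_dg_module[OF DGP_cone(2)] this(2) DGP_cone(3)]
  show ?case by blast
qed

lemma chi_heq:
  assumes "M \<in> DGP S" "N \<in> DGP S" "heq M N"
  shows "chi A M = chi A N"
proof -
  note m = DGP_dg_module[OF assms(1)] and n = DGP_dg_module[OF assms(2)]
  obtain L K where LK: "dual_basis A M L" "dual_basis A N K"
    using DGP_dual_basis[OF assms(1)] DGP_dual_basis[OF assms(2)] by blast
  show ?thesis
    using euler_heq[OF m LK(1) n LK(2) assms(3)] chi_eq[OF m LK(1)] chi_eq[OF n LK(2)] by simp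
qed

lemma chi_cone:
  assumes "M \<in> DGP S" "N \<in> DGP S" "f \<in> dg_Z0 M N"
  shows "chi A (cone M N f) = chi A N - chi A M"
proof -
  note m = DGP_dg_module[OF assms(1)] DGP_dg_module[OF assms(2)]
  obtain L K where LK: "dual_basis A M L" "dual_basis A N K"
    using DGP_dual_basis[OF assms(1)] DGP_dual_basis[OF assms(2)] by blast
  have "par_sign (n + 1) = - par_sign n" for n by (simp add: par_sign_def)
  then have "(\<Sum>t\<leftarrow>L. par_sign (de t + 1)) = - (\<Sum>t\<leftarrow>L. par_sign (de t))"
    by (simp add: uminus_sum_list_map comp_def)
  then show ?thesis
    using chi_eq[OF dg_module_cone[OF m assms(3)] dual_basis_cone[OF m(1) LK(1) m(2) LK(2) assms(3)]]
      chi_eq[OF m(1) LK(1)] chi_eq[OF m(2) LK(2)] by (simp add: euler_def comp_def)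
qed

lemma chi_projP: "chi A (projP y) = (if y \<in> rearr A then par_sign (ninv y) else 0)"
  using chi_eq[OF dg_module_projP dual_basis_projP, of A y] by (auto simp: euler_def)

section \<open>Relations between the projective modules\<close>

lemma rgen_idem:
  "ridem (bot_seq g) * rgen g = (rgen g :: 'k::field_char_0 ralg)"
  "rgen g * ridem (top_seq g) = (rgen g :: 'k ralg)"
  by (simp_all only: ridem_left ridem_right simp_thms if_True)

text \<open>Right multiplication by the crossing of the two equal labels, with the sign of the
  argument, is a contraction: the derivative of this crossing is the idempotent, so the Leibniz rule
  leaves exactly \<open>u\<close>.\<close>

lemma contractible_projP:
  "contractible (projP (a @- i ## i ## z) :: 'k::field_char_0 dgobj)"
proof -
  let ?y = "a @- i ## i ## z"
  let ?P = "projP ?y :: 'k dgobj"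
  define c :: "'k ralg" where "c = rgen (Local (Cr i i) a z)"
  have c: "ridem ?y * c = c" "c * ridem ?y = c" "rdeg (-1) c" "rdiff c = ridem ?y"
    using rgen_idem[of "Local (Cr i i) a z", where 'k = 'k] rdeg.intros(1)[of "Local (Cr i i) a z", where 'k = 'k]
    unfolding c_def by (simp_all add: rdiff_cr)
  have rc: "rpar (r * ridem ?y) * c = (rpar r * c) * ridem ?y" for r
    using c by (simp add: mult.assoc)
  let ?h = "\<lambda>u. Leaf (rpar (leaf u) * c)"
  have h: "?h \<in> dg_hom ?P ?P (-1)"
  proof (rule dg_homI)
    fix u assume "u \<in> mcar ?P"
    then obtain r where "u = Leaf (r * ridem ?y)" by (auto simp: projP_car)
    then show "?h u \<in> mcar ?P" unfolding projP_car by (metis rc pairs.sel(1))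
  next
    fix p u assume "u \<in> mdeg ?P p"
    then obtain r where r: "rdeg p r" "u = Leaf (r * ridem ?y)" by (auto simp: projP_deg)
    then have "rdeg (p + -1) (rpar r * c)" using c(3) by (intro rdeg.intros(5) rdeg_rpar)
    then show "?h u \<in> mdeg ?P (p + -1)" unfolding projP_deg r(2) by (metis rc pairs.sel(1))
  next
    fix q u and r :: "'k ralg" assume "rdeg q r"
    then show "?h (mact ?P r u) = mscale ?P (ksgn (-1 * q)) (mact ?P r (?h u))"
      by (simp add: rpar_rdeg mult.assoc)
  qed (simp_all add: distrib_right)
  have "u = madd ?P (mdiff ?P (?h u)) (?h (mdiff ?P u))" if "u \<in> mcar ?P" for u
    using that c by (auto simp: projP_car rdiff_mult mult.assoc)
  then show ?thesis unfolding contractible_def by (intro bexI[OF _ h] ballI)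
qed

text \<open>The maps are right multiplications by two mutually inverse crossings, and the shift is
  the degree of one of them. The sign \<open>rpar\<close> is inserted because an odd shift twists
  the action and negates the differential.\<close>

lemma heq_projP_swap:
  assumes "i \<noteq> j"
  shows "\<exists>n. odd n \<and> heq (projP (a @- i ## j ## z) :: 'k::field_char_0 dgobj) (shift n (projP (a @- j ## i ## z)))"
proof (intro exI conjI)
  let ?y = "a @- i ## j ## z" and ?w = "a @- j ## i ## z"
  let ?n = "piece_deg (Cr j i)"
  show "odd ?n" by simp
  let ?P = "projP ?y :: 'k dgobj" and ?Q = "projP ?w :: 'k dgobj"
  define c c' :: "'k ralg" where "c = rgen (Local (Cr j i) a z)" and "c' = rgen (Local (Cr i j) a z)"
  have n': "piece_deg (Cr i j) = - ?n" using assms by simp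
  have c: "ridem ?y * c = c" "c * ridem ?w = c" "rdeg ?n c" "rdiff c = 0"
    using rgen_idem[of "Local (Cr j i) a z", where 'k = 'k] rdeg.intros(1)[of "Local (Cr j i) a z", where 'k = 'k] assms
    by (simp_all add: c_def rdiff_cr)
  have c': "ridem ?w * c' = c'" "c' * ridem ?y = c'" "rdeg (- ?n) c'" "rdiff c' = 0"
    using rgen_idem[of "Local (Cr i j) a z", where 'k = 'k] rdeg.intros(1)[of "Local (Cr i j) a z", where 'k = 'k] assms n'
    by (simp_all add: c'_def rdiff_cr)
  have pc: "rpar c = - c" "rpar c' = - c'"
    using rpar_rdeg[OF c(3)] rpar_rdeg[OF c'(3)] by (simp_all add: ksgn_def rscale_minus_one)
  have cc: "c * c' = ridem ?y" "c' * c = ridem ?w"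
    using assms by (simp_all add: c_def c'_def rgen_cr_cr)
  have rc: "rpar (r * ridem ?y) * c = (rpar r * c) * ridem ?w" for r
    using c by (simp add: mult.assoc)
  have rc': "rpar (r * ridem ?w * c') = (rpar r * (- c')) * ridem ?y" for r
    using c' pc by (simp add: mult.assoc)
  \<comment> \<open>In \<open>?g\<close> the sign is applied after the multiplication by
    \<open>c'\<close>; in both composites the two signs then cancel, and the crossings combine to an
    idempotent.\<close>
  let ?f = "\<lambda>u. Leaf (rpar (leaf u) * c)" and ?g = "\<lambda>u. Leaf (rpar (leaf u * c'))"
  have f: "?f \<in> dg_Z0 ?P (shift ?n ?Q)"
  proof (intro dg_Z0I dg_homI)
    fix u assume "u \<in> mcar ?P"
    then obtain r where "u = Leaf (r * ridem ?y)" by (auto simp: projP_car)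
    then show "?f u \<in> mcar (shift ?n ?Q)" unfolding shift_simps projP_car by (metis rc pairs.sel(1))
  next
    fix p u assume "u \<in> mdeg ?P p"
    then obtain r where r: "rdeg p r" "u = Leaf (r * ridem ?y)" by (auto simp: projP_deg)
    then have "rdeg (p + ?n) (rpar r * c)" using c(3) by (intro rdeg.intros(5) rdeg_rpar)
    then show "?f u \<in> mdeg (shift ?n ?Q) (p + 0)" unfolding shift_simps projP_deg r(2) add_0_right
      by (metis rc pairs.sel(1))
  qed (use \<open>odd ?n\<close> in \<open>simp_all add: distrib_right mult.assoc rdiff_mult c ksgn_def rscale_minus_one del: piece_deg.simps\<close>)
  have g: "?g \<in> dg_Z0 (shift ?n ?Q) ?P"
  proof (intro dg_Z0I dg_homI)
    fix u assume "u \<in> mcar (shift ?n ?Q)"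
    then obtain r where "u = Leaf (r * ridem ?w)" by (auto simp: projP_car)
    then show "?g u \<in> mcar ?P" unfolding projP_car by (metis rc' pairs.sel(1))
  next
    fix p u assume "u \<in> mdeg (shift ?n ?Q) p"
    then obtain r where r: "rdeg (p + ?n) r" "u = Leaf (r * ridem ?w)" by (auto simp: projP_deg)
    then have "rdeg ((p + ?n) + - ?n) (rpar r * (- c'))" using c'(3) by (intro rdeg.intros(5) rdeg_rpar rdeg_uminus)
    then have "rdeg p (rpar r * (- c'))" by simp
    then show "?g u \<in> mdeg ?P (p + 0)" unfolding projP_deg r(2) add_0_right by (metis rc' pairs.sel(1))
  qed (use \<open>odd ?n\<close> in \<open>simp_all add: distrib_right mult.assoc rdiff_mult c' pc ksgn_def rscale_minus_one del: piece_deg.simps\<close>)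
  show "heq ?P (shift ?n ?Q)"
  proof (rule heq_isoI[OF dg_module_projP dg_module_shift[OF dg_module_projP] f g])
    fix u assume "u \<in> mcar ?P"
    then show "?g (?f u) = u" using cc c pc by (auto simp: projP_car mult.assoc)
  next
    fix u assume "u \<in> mcar (shift ?n ?Q)"
    then show "?f (?g u) = u" using cc c' pc by (auto simp: projP_car mult.assoc)
  qed
qed

section \<open>The Grothendieck group\<close>

text \<open>This is the condition under which \<open>generate\<close> yields a subgroup.\<close>

lemma K0_relations_homotopy_category:
  "K0_relations (homotopy_category S) \<subseteq> carrier (free_Abelian_group S)"
proof
  fix r assume "r \<in> K0_relations (homotopy_category S)"
  then consider A B where "A \<in> S" "B \<in> S" "r = frag_of A - frag_of B"
    | A B C where "A \<in> S" "B \<in> S" "C \<in> S" "r = frag_of B - frag_of A - frag_of C"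
    by (auto simp: K0_relations_def ho_tri_def)
  then show "r \<in> carrier (free_Abelian_group S)"
  proof cases
    case 1
    then show ?thesis using keys_diff[of "frag_of A" "frag_of B"] by auto
  next
    case 2
    have "Poly_Mapping.keys (frag_of B - frag_of A - frag_of C) \<subseteq>
        (Poly_Mapping.keys (frag_of B) \<union> Poly_Mapping.keys (frag_of A)) \<union> Poly_Mapping.keys (frag_of C)"
      by (rule order_trans[OF keys_diff Un_mono[OF keys_diff order_refl]])
    then show ?thesis using 2 by auto
  qed
qed

section \<open>Congruences modulo the relations of K0\<close>

abbreviation K0_rel :: "int stream set \<Rightarrow> ('k::field_char_0 dgobj \<Rightarrow>\<^sub>0 int) set" where
  "K0_rel S \<equiv> K0_subgroup (homotopy_category (DGP S))"

lemma subgroup_K0_rel: "subgroup (K0_rel S) (free_Abelian_group (DGP S))"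
  unfolding K0_subgroup_def homotopy_category_simps
  by (intro group.generate_is_subgroup group_free_Abelian_group K0_relations_homotopy_category)

lemma K0_rel_carrier: "c \<in> K0_rel S \<Longrightarrow> Poly_Mapping.keys c \<subseteq> DGP S"
  using subgroup.mem_carrier[OF subgroup_K0_rel, of c S] by simp

lemma K0_rel_zero: "0 \<in> K0_rel S"
  using subgroup.one_closed[OF subgroup_K0_rel, of S] by simp

lemma K0_rel_add: "a \<in> K0_rel S \<Longrightarrow> b \<in> K0_rel S \<Longrightarrow> a + b \<in> K0_rel S"
  using subgroup.m_closed[OF subgroup_K0_rel, of a S b] by simp

lemma K0_rel_minus: "a \<in> K0_rel S \<Longrightarrow> - a \<in> K0_rel S"
  using subgroup.m_inv_closed[OF subgroup_K0_rel, of a S] K0_rel_carrier[of a S] by simp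

lemma K0_rel_diff: "a \<in> K0_rel S \<Longrightarrow> b \<in> K0_rel S \<Longrightarrow> a - b \<in> K0_rel S"
  using K0_rel_add[OF _ K0_rel_minus, of a S b] by simp

lemma K0_rel_incl: "r \<in> K0_relations (homotopy_category (DGP S)) \<Longrightarrow> r \<in> K0_rel S"
  unfolding K0_subgroup_def by (rule generate.incl)

lemma K0_rel_heq:
  assumes "M \<in> DGP S" "N \<in> DGP S" "heq M N"
  shows "frag_of M - frag_of N \<in> K0_rel S"
proof (rule K0_rel_incl)
  have "cat_iso (ho_cat (DGP S)) M N \<noteq> {}"
    by (rule heq_cat_iso[OF DGP_dg_module[OF assms(1)] DGP_dg_module[OF assms(2)] assms(3)])
  then show "frag_of M - frag_of N \<in> K0_relations (homotopy_category (DGP S))"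
    using assms(1,2) unfolding K0_relations_def homotopy_category_simps by blast
qed

lemma K0_rel_cone:
  assumes "M \<in> DGP S" "N \<in> DGP S" "f \<in> dg_Z0 M N"
  shows "frag_of N - frag_of M - frag_of (cone M N f) \<in> K0_rel S"
proof (rule K0_rel_incl)
  show "frag_of N - frag_of M - frag_of (cone M N f) \<in> K0_relations (homotopy_category (DGP S))"
    using standard_triangle[OF DGP_dg_module[OF assms(1)] DGP_dg_module[OF assms(2)] assms(3)
        assms(1,2) DGP_cone[OF assms]]
    unfolding K0_relations_def homotopy_category_simps by blast
qed

text \<open>\<open>C\<close> is equivalent to the cone of its identity, both being contractible, and
  the triangle of that cone gives it the class \<open>[C] - [C]\<close>.\<close>

lemma K0_rel_contractible:
  assumes "C \<in> DGP S" "contractible C"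
  shows "frag_of C \<in> K0_rel S"
proof -
  let ?Z = "cone C C id"
  note m = DGP_dg_module[OF assms(1)] and i = dg_Z0_id[OF DGP_dg_module[OF assms(1)]]
  have Z: "?Z \<in> DGP S" by (rule DGP_cone[OF assms(1,1) i])
  have "heq C ?Z"
    by (rule contractible_heq[OF m DGP_dg_module[OF Z] assms(2) contractible_cone_id[OF m]])
  from K0_rel_diff[OF K0_rel_heq[OF assms(1) Z this] K0_rel_cone[OF assms(1,1) i]]
  show ?thesis by simp
qed

text \<open>The cone of the zero map from \<open>M\<close> to a contractible \<open>Z\<close> is
  equivalent to \<open>shift 1 M\<close>, and \<open>Z\<close> has class zero. The cone of the
  identity of \<open>M\<close> supplies such a \<open>Z\<close> inside the category.\<close>

lemma K0_rel_shift_1: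
  assumes "M \<in> DGP S"
  shows "frag_of (shift 1 M) + frag_of M \<in> K0_rel S"
proof -
  note m = DGP_dg_module[OF assms]
  let ?Z = "cone M M id"
  have Z: "?Z \<in> DGP S" by (rule DGP_cone[OF assms assms dg_Z0_id[OF m]])
  note zm = DGP_dg_module[OF Z] and zc = contractible_cone_id[OF m]
  let ?f = "\<lambda>_. mzero ?Z"
  note f = dg_Z0_zero[OF zm]
  have c: "cone M ?Z ?f \<in> DGP S" by (rule DGP_cone[OF assms Z f])
  have "(frag_of ?Z - (frag_of ?Z - frag_of M - frag_of (cone M ?Z ?f))) -
      (frag_of (cone M ?Z ?f) - frag_of (shift 1 M)) \<in> K0_rel S"
    by (intro K0_rel_diff K0_rel_contractible[OF Z zc] K0_rel_cone[OF assms Z f]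
        K0_rel_heq[OF c DGP_shift[OF assms] heq_cone_zero[OF m zm zc]])
  then show ?thesis by (simp add: algebra_simps)
qed

lemma K0_rel_shift:
  assumes "M \<in> DGP S"
  shows "frag_of (shift n M) - frag_cmul (par_sign n) (frag_of M) \<in> K0_rel S"
proof -
  note m = DGP_dg_module[OF assms]
  have step: "frag_of (shift (n + 1) M) + frag_of (shift n M) \<in> K0_rel S" for n
  proof -
    have "frag_of (shift 1 (shift n M)) + frag_of (shift n M) -
        (frag_of (shift 1 (shift n M)) - frag_of (shift (n + 1) M)) \<in> K0_rel S"
      by (intro K0_rel_diff K0_rel_shift_1 K0_rel_heq DGP_shift assms heq_shift_Suc m)
    then show ?thesis by (simp add: algebra_simps)
  qed
  show ?thesis
  proof (induction n rule: int_induct[where k = 0])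
    case base
    show ?case using K0_rel_heq[OF DGP_shift[OF assms] assms heq_shift_0[OF m]]
      by (simp add: par_sign_def)
  next
    case (step1 i)
    from K0_rel_diff[OF step[of i] step1(2)] show ?case
      by (cases "even i") (simp_all add: par_sign_def)
  next
    case (step2 i)
    from K0_rel_diff[OF step[of "i - 1"] step2(2)] show ?case
      by (cases "even i") (simp_all add: par_sign_def)
  qed
qed

section \<open>Generators\<close>

definition nswap :: "nat \<Rightarrow> nat \<Rightarrow> nat" where
  "nswap n m = (if m = n then Suc n else if m = Suc n then n else m)"

lemma snth_swap: "(a @- j ## i ## z) !! m = (a @- i ## j ## z) !! nswap (length a) m"
proof -
  have e: "(a @- s) !! (length a + l) = s !! l" for s :: "'a stream" and l
    by (simp add: shift_snth_ge)
  show ?thesis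
  proof (cases "m < length a")
    case True
    then show ?thesis by (simp add: nswap_def shift_snth_less)
  next
    case False
    then obtain l where m: "m = length a + l" by (metis le_add_diff_inverse not_less)
    consider "l = 0" | "l = 1" | l' where "l = Suc (Suc l')" by (metis One_nat_def not0_implies_Suc)
    then show ?thesis
    proof cases
      case 1
      then show ?thesis using e[of _ 0] e[of _ 1] by (simp add: m nswap_def snth_Stream del: snth.simps(2))
    next
      case 2
      then show ?thesis using e[of _ 0] e[of _ 1] by (simp add: m nswap_def snth_Stream del: snth.simps(2))
    next
      case 3
      then have "nswap (length a) m = m" by (simp add: m nswap_def)
      then show ?thesis unfolding m 3 e by (simp only: e) simp
    qed
  qed
qed

text \<open>Transposing the two positions embeds the inversions of the new sequence into those of
  the old one and misses the exchanged pair of positions.\<close>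

lemma card_pinv_swap:
  assumes "a @- i ## j ## z \<in> seqM" "j < i"
  shows "card (pinv (a @- j ## i ## z)) < card (pinv (a @- i ## j ## z))"
proof -
  let ?y = "a @- i ## j ## z" and ?w = "a @- j ## i ## z" and ?n = "length a"
  let ?P = "(?n, Suc ?n)" and ?F = "map_prod (nswap ?n) (nswap ?n)"
  have y: "?y !! ?n = i" "?y !! Suc ?n = j"
    using shift_snth_ge[of a ?n "i ## j ## z"] shift_snth_ge[of a "Suc ?n" "i ## j ## z"]
    by (simp_all del: snth.simps(2) add: Suc_diff_le snth_Stream)
  have fin: "finite (pinv ?y)" using assms(1) by (rule finite_pinv)
  have P: "?P \<in> pinv ?y" using assms(2) y by (simp add: pinv_def)
  have "inj (nswap ?n)" by (auto simp: inj_def nswap_def split: if_splits)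
  then have "inj ?F" by (simp add: prod.inj_map)
  moreover have "?F ` pinv ?w \<subseteq> pinv ?y - {?P}"
  proof
    fix Q assume "Q \<in> ?F ` pinv ?w"
    then obtain m l where ml: "(m, l) \<in> pinv ?w" and Q: "Q = ?F (m, l)" by (metis imageE surj_pair)
    then have *: "m < l" "?y !! nswap ?n l < ?y !! nswap ?n m"
      unfolding pinv_def snth_swap[of a j i z] by auto
    have "(m, l) \<noteq> ?P"
      using * y assms(2) by (auto simp: nswap_def)
    then have "nswap ?n m < nswap ?n l" "(nswap ?n m, nswap ?n l) \<noteq> ?P"
      using *(1) by (auto simp: nswap_def split: if_splits)
    then show "Q \<in> pinv ?y - {?P}" using * Q by (simp add: pinv_def)
  qed
  ultimately have "card (pinv ?w) \<le> card (pinv ?y - {?P})"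
    using fin by (intro card_inj_on_le[of ?F]) (auto intro: inj_on_subset)
  also have "\<dots> < card (pinv ?y)" using fin P by (rule card_Diff1_less)
  finally show ?thesis .
qed

lemma descent:
  assumes "\<not> strict_mono (snth (y :: int stream))"
  obtains a i j z where "y = a @- i ## j ## z" "j \<le> i"
proof -
  obtain n where n: "y !! Suc n \<le> y !! n"
    using assms unfolding strict_mono_Suc_iff by (auto simp: not_less)
  have e: "sdrop m y = y !! m ## sdrop (Suc m) y" for m
    using stream.collapse[of "sdrop m y"] unfolding sdrop_simps by (rule sym)
  have "y = stake n y @- sdrop n y" by (rule stake_sdrop[symmetric])
  also have "sdrop n y = y !! n ## y !! Suc n ## sdrop (Suc (Suc n)) y"
    using e[of n] e[of "Suc n"] by (simp only:)
  finally show thesis using n by (rule that)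
qed

text \<open>The common property of \<open>seqM\<close> and all \<open>seqMk k\<close>: sorting does
  not leave such a set. It allows one argument for \<open>F\<close> and every
  \<open>F_k\<close>.\<close>

definition swap_closed :: "int stream set \<Rightarrow> bool" where
  "swap_closed S \<longleftrightarrow> S \<subseteq> seqM \<and> (\<forall>a i j z. a @- i ## j ## z \<in> S \<longrightarrow> a @- j ## i ## z \<in> S)"

definition incr :: "int stream set \<Rightarrow> int stream set" where
  "incr S = {x \<in> S. strict_mono (snth x)}"

definition projP_frag :: "(int stream \<Rightarrow>\<^sub>0 int) \<Rightarrow> ('k::field_char_0 dgobj \<Rightarrow>\<^sub>0 int)" where
  "projP_frag v = frag_extend (\<lambda>x. frag_of (projP x)) v"

lemma projP_frag_simps [simp]:
  "projP_frag 0 = 0" "projP_frag (v - w) = projP_frag v - projP_frag w"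
  "projP_frag (v + w) = projP_frag v + projP_frag w" "projP_frag (frag_of x) = frag_of (projP x)"
  by (simp_all add: projP_frag_def frag_extend_diff frag_extend_add)

definition spanned :: "int stream set \<Rightarrow> ('k::field_char_0 dgobj \<Rightarrow>\<^sub>0 int) \<Rightarrow> bool" where
  "spanned S c \<longleftrightarrow> (\<exists>v. Poly_Mapping.keys v \<subseteq> incr S \<and> c - projP_frag v \<in> K0_rel S)"

lemma spanned_zero: "spanned S 0"
  unfolding spanned_def by (rule exI[of _ 0]) (simp add: K0_rel_zero)

lemma spanned_diff:
  assumes "spanned S c" "spanned S d"
  shows "spanned S (c - d)"
proof -
  from assms obtain v w where v: "Poly_Mapping.keys v \<subseteq> incr S" "c - projP_frag v \<in> K0_rel S"
    and w: "Poly_Mapping.keys w \<subseteq> incr S" "d - projP_frag w \<in> K0_rel S"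
    unfolding spanned_def by blast
  show ?thesis unfolding spanned_def
  proof (intro exI conjI)
    show "Poly_Mapping.keys (v - w) \<subseteq> incr S" using keys_diff[of v w] v w by blast
    show "(c - d) - projP_frag (v - w) \<in> K0_rel S"
      using K0_rel_diff[OF v(2) w(2)] by (simp add: algebra_simps)
  qed
qed

lemma spanned_minus: "spanned S c \<Longrightarrow> spanned S (- c)"
  using spanned_diff[OF spanned_zero] by fastforce

lemma spanned_cong:
  assumes "spanned S d" "c - d \<in> K0_rel S"
  shows "spanned S c"
proof -
  from assms(1) obtain v where v: "Poly_Mapping.keys v \<subseteq> incr S" "d - projP_frag v \<in> K0_rel S"
    unfolding spanned_def by blast
  have "c - projP_frag v \<in> K0_rel S" using K0_rel_add[OF assms(2) v(2)] by simp
  then show ?thesis unfolding spanned_def using v(1) by blast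
qed

lemma spanned_projP:
  assumes S: "swap_closed S" and "y \<in> S"
  shows "spanned S (frag_of (projP y :: 'k::field_char_0 dgobj))"
  using assms(2)
proof (induction "card (pinv y)" arbitrary: y rule: less_induct)
  case less
  show ?case
  proof (cases "strict_mono (snth y)")
    case True
    then have "frag_of (projP y) - projP_frag (frag_of y) \<in> K0_rel S" "y \<in> incr S"
      using less(2) by (simp_all add: K0_rel_zero incr_def)
    then show ?thesis unfolding spanned_def by (intro exI[of _ "frag_of y"]) simp
  next
    case False
    then obtain a i j z where y: "y = a @- i ## j ## z" and "j \<le> i" by (rule descent)
    show ?thesis
    proof (cases "i = j")
      case True
      have "frag_of (projP y :: 'k dgobj) - 0 \<in> K0_rel S"
        using K0_rel_contractible[OF DGP_proj[OF less(2)]] contractible_projP y True by force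
      then show ?thesis by (rule spanned_cong[OF spanned_zero])
    next
      case False
      let ?w = "a @- j ## i ## z"
      have w: "?w \<in> S" using S less(2) y unfolding swap_closed_def by blast
      have "card (pinv ?w) < card (pinv y)"
        using less(2) S False \<open>j \<le> i\<close> unfolding y swap_closed_def by (intro card_pinv_swap) auto
      then have IH: "spanned S (frag_of (projP ?w :: 'k dgobj))" using w by (rule less(1))
      obtain n where n: "odd n" "heq (projP y :: 'k dgobj) (shift n (projP ?w))"
        using heq_projP_swap[OF False, of a z] y by blast
      have wD: "(projP ?w :: 'k dgobj) \<in> DGP S" using w by (rule DGP_proj)
      have "(frag_of (projP y :: 'k dgobj) - frag_of (shift n (projP ?w))) +
          (frag_of (shift n (projP ?w)) - frag_cmul (par_sign n) (frag_of (projP ?w))) \<in> K0_rel S"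
        by (intro K0_rel_add K0_rel_heq K0_rel_shift wD DGP_proj DGP_shift less(2) n(2))
      then have "frag_of (projP y :: 'k dgobj) - (- frag_of (projP ?w)) \<in> K0_rel S"
        using n(1) by (simp add: par_sign_def)
      then show ?thesis by (rule spanned_cong[OF spanned_minus[OF IH]])
    qed
  qed
qed

lemma spanned_DGP:
  assumes "swap_closed S" "M \<in> DGP S"
  shows "spanned S (frag_of M)"
  using assms(2)
proof (induction rule: DGP.induct)
  case (DGP_proj x)
  then show ?case by (rule spanned_projP[OF assms(1)])
next
  case (DGP_shift M n)
  have "spanned S (frag_cmul (par_sign n) (frag_of M))"
    using DGP_shift spanned_minus[of S "frag_of M"] by (simp add: par_sign_def)
  then show ?case by (rule spanned_cong[OF _ K0_rel_shift[OF DGP_shift(1)]])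
next
  case (DGP_cone M N f)
  have "frag_of (cone M N f) - (frag_of N - frag_of M) \<in> K0_rel S"
    using K0_rel_minus[OF K0_rel_cone[OF DGP_cone(1-3)]] by (simp add: algebra_simps)
  then show ?case by (rule spanned_cong[OF spanned_diff[OF DGP_cone(5,4)]])
qed

lemma spanned_all:
  assumes "swap_closed S" "Poly_Mapping.keys c \<subseteq> DGP S"
  shows "spanned S c"
  using assms(2)
  by (induction rule: frag_induction) (auto intro: spanned_zero spanned_diff spanned_DGP[OF assms(1)])

section \<open>Independence\<close>

text \<open>\<open>frag_extend\<close> takes values in a free abelian group; the one on a single
  generator serves as the integers.\<close>

definition chi_frag :: "int set \<Rightarrow> ('k::field_char_0 dgobj \<Rightarrow>\<^sub>0 int) \<Rightarrow> int" where
  "chi_frag A c = Poly_Mapping.lookup (frag_extend (\<lambda>M. frag_cmul (chi A M) (frag_of ())) c) ()"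

lemma chi_frag_simps [simp]:
  "chi_frag A 0 = 0" "chi_frag A (c + d) = chi_frag A c + chi_frag A d"
  "chi_frag A (c - d) = chi_frag A c - chi_frag A d" "chi_frag A (- c) = - chi_frag A c"
  "chi_frag A (frag_of M) = chi A M"
  by (simp_all add: chi_frag_def frag_extend_add frag_extend_diff frag_extend_minus lookup_add lookup_minus)

lemma chi_frag_relation:
  assumes "r \<in> K0_relations (homotopy_category (DGP S))"
  shows "chi_frag A r = 0"
proof -
  from assms consider M N u where "M \<in> DGP S" "N \<in> DGP S" "u \<in> cat_iso (ho_cat (DGP S)) M N"
      "r = frag_of M - frag_of N"
    | K M N u v w where "(K, M, N, u, v, w) \<in> ho_tri (DGP S)" "r = frag_of M - frag_of K - frag_of N"
    unfolding K0_relations_def homotopy_category_simps by blast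
  then show ?thesis
  proof cases
    case 1
    then show ?thesis using chi_heq[OF 1(1,2) cat_iso_heq[OF _ _ 1(3)]] by (simp add: DGP_dg_module)
  next
    case 2
    from 2(1) obtain X Y f where *: "X \<in> DGP S" "Y \<in> DGP S" "f \<in> dg_Z0 X Y"
      "heq K X" "heq M Y" "heq N (cone X Y f)"
      by (rule ho_tri_heq[rotated 2]) (auto intro: DGP_dg_module DGP_cone)
    have KMN: "K \<in> DGP S" "M \<in> DGP S" "N \<in> DGP S" using 2(1) by (auto simp: ho_tri_def)
    show ?thesis
      using chi_heq[OF KMN(1) *(1,4)] chi_heq[OF KMN(2) *(2,5)] chi_heq[OF KMN(3) DGP_cone[OF *(1-3)] *(6)]
        chi_cone[OF *(1-3)] 2(2) by simp
  qed
qed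

lemma chi_frag_rel:
  assumes "c \<in> K0_rel S"
  shows "chi_frag A c = 0"
  using assms unfolding K0_subgroup_def homotopy_category_simps
proof (induction rule: generate.induct)
  case (inv h)
  then have "Poly_Mapping.keys h \<subseteq> DGP S"
    using K0_relations_homotopy_category by fastforce
  then show ?case using chi_frag_relation[OF inv] by simp
qed (simp_all add: chi_frag_relation)

text \<open>If \<open>f\<close> and \<open>g\<close> agree below \<open>n\<close>, then
  \<open>g\<close> attains the value \<open>f n\<close> at a position not below \<open>n\<close>,
  whence \<open>g n \<le> f n\<close>; the reverse inequality follows by symmetry.\<close>

lemma strict_mono_range_eq:
  fixes f g :: "nat \<Rightarrow> 'a::linorder"
  assumes "strict_mono f" "strict_mono g" "range f = range g"
  shows "f = g"
proof
  have le: "g n \<le> f n" if *: "strict_mono f" "strict_mono g" "range f = range g" "\<forall>m<n. f m = g m"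
    for f g :: "nat \<Rightarrow> 'a" and n
  proof -
    obtain l where l: "f n = g l" using *(3) by (metis rangeE rangeI)
    have "\<not> l < n"
    proof
      assume "l < n"
      then have "f n = f l" using l *(4) by simp
      then show False using strict_monoD[OF *(1) \<open>l < n\<close>] by simp
    qed
    then show ?thesis using l *(2) by (simp add: strict_mono_less_eq)
  qed
  fix n show "f n = g n"
  proof (induction n rule: less_induct)
    case (less n)
    then show ?case using le[of f g n] le[of g f n] assms by (simp add: order.antisym)
  qed
qed

lemma rearr_strict_mono:
  assumes "x \<in> seqM" "strict_mono (snth x)" "y \<in> seqM" "strict_mono (snth y)"
  shows "y \<in> rearr (sset x) \<longleftrightarrow> y = x"
proof
  assume "y \<in> rearr (sset x)"
  then have "range (snth y) = range (snth x)" by (simp add: rearr_def sset_range)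
  then have "snth y = snth x" by (rule strict_mono_range_eq[OF assms(4,2)])
  then show "y = x" by (metis stream_smap_fromN)
next
  assume "y = x"
  then show "y \<in> rearr (sset x)" using assms by (simp add: rearr_def strict_mono_imp_inj_on)
qed

lemma ninv_strict_mono: "strict_mono (snth y) \<Longrightarrow> ninv y = 0"
proof -
  assume *: "strict_mono (snth y)"
  have "invs y = {}" using strict_monoD[OF *] by (fastforce simp: invs_def before_def)
  then show ?thesis by (simp add: ninv_def)
qed

text \<open>The Euler characteristic for the label set of \<open>x\<close> is the coordinate
  function at \<open>x\<close>: an increasing sequence is determined by its labels, and having no
  inversions it gets the sign 1.\<close>

lemma chi_frag_projP_frag:
  assumes "x \<in> seqIM" "Poly_Mapping.keys v \<subseteq> seqIM"
  shows "chi_frag (sset x) (projP_frag v :: 'k::field_char_0 dgobj \<Rightarrow>\<^sub>0 int) = Poly_Mapping.lookup v x"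
  using assms(2)
proof (induction rule: frag_induction)
  case (one y)
  then have "chi (sset x) (projP y :: 'k dgobj) = (if y = x then 1 else 0)"
    using rearr_strict_mono[of x y] assms(1) ninv_strict_mono[of x]
    by (simp add: chi_projP seqIM_def par_sign_def)
  then show ?case by (simp add: lookup_single when_def)
qed (simp_all add: lookup_minus)

section \<open>The isomorphism\<close>

definition K0_map :: "int stream set \<Rightarrow> (int stream \<Rightarrow>\<^sub>0 int) \<Rightarrow> ('k::field_char_0 dgobj \<Rightarrow>\<^sub>0 int) set" where
  "K0_map S v = K0_rel S #>\<^bsub>free_Abelian_group (DGP S)\<^esub> projP_frag v"

lemma K0_coset_eq_iff:
  assumes "Poly_Mapping.keys c \<subseteq> DGP S" "Poly_Mapping.keys d \<subseteq> DGP S"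
  shows "K0_rel S #>\<^bsub>free_Abelian_group (DGP S)\<^esub> c = K0_rel S #>\<^bsub>free_Abelian_group (DGP S)\<^esub> d
    \<longleftrightarrow> c - d \<in> K0_rel S"
proof -
  let ?G = "free_Abelian_group (DGP S)"
  have c: "c \<in> carrier ?G" and d: "d \<in> carrier ?G" using assms by simp_all
  have "c \<in> K0_rel S #>\<^bsub>?G\<^esub> d \<longleftrightarrow> c - d \<in> K0_rel S"
    using subgroup.rcos_module[OF subgroup_K0_rel group_free_Abelian_group d c] assms(2) by simp
  moreover have "K0_rel S #>\<^bsub>?G\<^esub> c = K0_rel S #>\<^bsub>?G\<^esub> d \<longleftrightarrow> c \<in> K0_rel S #>\<^bsub>?G\<^esub> d"
    using group.repr_independence[OF group_free_Abelian_group _ d subgroup_K0_rel, of c]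
      group.rcos_self[OF group_free_Abelian_group c subgroup_K0_rel] by blast
  ultimately show ?thesis by simp
qed

lemma keys_projP_frag: "Poly_Mapping.keys v \<subseteq> S \<Longrightarrow> Poly_Mapping.keys (projP_frag v) \<subseteq> DGP S"
proof (induction rule: frag_induction)
  case (diff a b)
  then show ?case using keys_diff[of "projP_frag a" "projP_frag b"] by auto
qed (auto intro: DGP_proj)

lemma K0_map_iso:
  assumes S: "swap_closed S"
  shows "K0_map S \<in> iso (free_Abelian_group (incr S))
    (K0 (homotopy_category (DGP S) :: ('k::field_char_0 dgobj, 'k hmap) tri_cat))"
proof -
  let ?G = "free_Abelian_group (DGP S :: 'k dgobj set)" and ?H = "K0_rel S :: ('k dgobj \<Rightarrow>\<^sub>0 int) set"
  have N: "?H \<lhd> ?G"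
    by (rule comm_group.subgroup_imp_normal[OF abelian_free_Abelian_group subgroup_K0_rel])
  have K0: "K0 (homotopy_category (DGP S) :: ('k dgobj, 'k hmap) tri_cat) = ?G Mod ?H"
    by (simp add: K0_def)
  have incr: "incr S \<subseteq> S" "incr S \<subseteq> seqIM" using S by (auto simp: incr_def swap_closed_def seqIM_def)
  have keys: "Poly_Mapping.keys (projP_frag v :: 'k dgobj \<Rightarrow>\<^sub>0 int) \<subseteq> DGP S"
    if "Poly_Mapping.keys v \<subseteq> incr S" for v
    by (rule keys_projP_frag[OF order_trans[OF that incr(1)]])
  have "K0_map S \<in> hom (free_Abelian_group (incr S)) (?G Mod ?H)"
  proof (rule homI)
    fix v assume "v \<in> carrier (free_Abelian_group (incr S))"
    then show "(K0_map S v :: ('k dgobj \<Rightarrow>\<^sub>0 int) set) \<in> carrier (?G Mod ?H)"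
      using keys by (simp add: carrier_FactGroup K0_map_def)
  next
    fix v w assume "v \<in> carrier (free_Abelian_group (incr S))" "w \<in> carrier (free_Abelian_group (incr S))"
    then show "K0_map S (v \<otimes>\<^bsub>free_Abelian_group (incr S)\<^esub> w) =
        K0_map S v \<otimes>\<^bsub>?G Mod ?H\<^esub> K0_map S w"
      using keys by (simp add: K0_map_def normal.rcos_sum[OF N])
  qed
  moreover have "inj_on (K0_map S :: _ \<Rightarrow> ('k dgobj \<Rightarrow>\<^sub>0 int) set) (carrier (free_Abelian_group (incr S)))"
  proof (rule inj_onI)
    fix v w assume "v \<in> carrier (free_Abelian_group (incr S))" "w \<in> carrier (free_Abelian_group (incr S))"
      and eq: "(K0_map S v :: ('k dgobj \<Rightarrow>\<^sub>0 int) set) = K0_map S w"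
    then have vw: "Poly_Mapping.keys v \<subseteq> incr S" "Poly_Mapping.keys w \<subseteq> incr S" by simp_all
    have d: "projP_frag v - projP_frag w \<in> ?H"
      using eq K0_coset_eq_iff[OF keys[OF vw(1)] keys[OF vw(2)]] unfolding K0_map_def by blast
    \<comment> \<open>Every coefficient of \<open>v\<close> and \<open>w\<close> is the value of
      some \<open>chi_frag\<close>, and \<open>chi_frag\<close> vanishes on the relations.\<close>
    show "v = w"
    proof (rule poly_mapping_eqI)
      fix x
      show "Poly_Mapping.lookup v x = Poly_Mapping.lookup w x"
      proof (cases "x \<in> seqIM")
        case True
        then show ?thesis
          using chi_frag_rel[OF d, of "sset x"] chi_frag_projP_frag[OF True order_trans[OF vw(1) incr(2)], where 'k = 'k]
            chi_frag_projP_frag[OF True order_trans[OF vw(2) incr(2)], where 'k = 'k] by simp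
      next
        case False
        then show ?thesis using vw incr(2) by (metis in_keys_iff subsetD)
      qed
    qed
  qed
  moreover have "C \<in> K0_map S ` carrier (free_Abelian_group (incr S))" if "C \<in> carrier (?G Mod ?H)" for C
  proof -
    obtain c where c: "Poly_Mapping.keys c \<subseteq> DGP S" "C = ?H #>\<^bsub>?G\<^esub> c"
      using \<open>C \<in> carrier (?G Mod ?H)\<close> by (auto simp: carrier_FactGroup)
    obtain v where v: "Poly_Mapping.keys v \<subseteq> incr S" "c - projP_frag v \<in> ?H"
      using spanned_all[OF S c(1)] unfolding spanned_def by blast
    have "C = K0_map S v" unfolding c(2) K0_map_def using K0_coset_eq_iff[OF c(1) keys[OF v(1)]] v(2) by blast
    then show ?thesis using v(1) by simp
  qed
  ultimately show ?thesis unfolding K0 iso_def bij_betw_def hom_def by blast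
qed

lemma swap_closed_seqM: "swap_closed seqM"
  by (auto simp: swap_closed_def seqM_shift_iff seqM_Stream)

lemma swap_closed_seqMk: "swap_closed (seqMk k)"
  unfolding swap_closed_def
proof (intro conjI allI impI)
  fix a i j z assume "a @- i ## j ## z \<in> seqMk k"
  then obtain N where M: "a @- i ## j ## z \<in> seqM"
    and N: "\<And>n. n \<ge> N \<Longrightarrow> (a @- i ## j ## z) !! n = 2 * (int n + 1) + 2 * k"
    unfolding seqMk_def by blast
  \<comment> \<open>The exchange fixes all positions from \<open>length a + 2\<close> on.\<close>
  have "(a @- j ## i ## z) !! n = 2 * (int n + 1) + 2 * k" if "n \<ge> N + length a + 2" for n
    using N[of n] that by (simp add: snth_swap[of a j i z] nswap_def)
  moreover have "a @- j ## i ## z \<in> seqM" using M swap_closed_seqM unfolding swap_closed_def by blast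
  ultimately show "a @- j ## i ## z \<in> seqMk k" unfolding seqMk_def by blast
qed (auto simp: seqMk_def)

lemma incr_seqM: "incr seqM = seqIM" and incr_seqMk: "incr (seqMk k) = seqIMk k"
  by (simp_all add: incr_def seqIM_def seqIMk_def)

lemma DGP_mono: "M \<in> DGP S \<Longrightarrow> S \<subseteq> S' \<Longrightarrow> M \<in> DGP S'"
  by (induction rule: DGP.induct) (auto intro: DGP.intros)

theorem proposition4p6:
  shows "\<exists>\<phi> :: int \<Rightarrow> ('k::field_char_0 dgobj \<Rightarrow>\<^sub>0 int) set \<Rightarrow> (int stream \<Rightarrow>\<^sub>0 int).
    (\<forall>k. \<phi> k \<in> iso (K0 (catFk k)) (V_Fk k) \<and>
         (\<forall>x\<in>seqIMk k. \<phi> k (K0_class (catFk k) (projP x)) = frag_of x)) \<and>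
    (\<exists>\<Phi>\<in>iso (K0 catF) V_F.
       \<forall>k. \<forall>M\<in>Ob (catFk k). \<Phi> (K0_class catF M) = \<phi> k (K0_class (catFk k) M))"
proof -
  define \<psi> :: "int stream set \<Rightarrow> ('k dgobj \<Rightarrow>\<^sub>0 int) set \<Rightarrow> (int stream \<Rightarrow>\<^sub>0 int)" where
    "\<psi> S = inv_into (carrier (free_Abelian_group (incr S))) (K0_map S)" for S
  have iso: "\<psi> S \<in> iso (K0 (homotopy_category (DGP S))) (free_Abelian_group (incr S))" if "swap_closed S" for S
    unfolding \<psi>_def by (rule group.iso_set_sym[OF group_free_Abelian_group K0_map_iso[OF that]])
  \<comment> \<open>To evaluate the inverse on a class it is enough to exhibit a combination of
    increasing sequences that is congruent to it.\<close>
  have val: "\<psi> S (K0_class (homotopy_category (DGP S)) M) = v"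
    if S: "swap_closed S" and M: "M \<in> DGP S" and v: "Poly_Mapping.keys v \<subseteq> incr S" "frag_of M - projP_frag v \<in> K0_rel S"
    for S M v
  proof -
    have "K0_class (homotopy_category (DGP S)) M = K0_map S v"
      unfolding K0_class_def K0_map_def homotopy_category_simps
      using K0_coset_eq_iff[of "frag_of M" S "projP_frag v"] keys_projP_frag[of v S] M v
      by (auto simp: incr_def)
    moreover have "inj_on (K0_map S :: _ \<Rightarrow> ('k dgobj \<Rightarrow>\<^sub>0 int) set) (carrier (free_Abelian_group (incr S)))"
      using K0_map_iso[OF S, where 'k = 'k] by (simp add: iso_def bij_betw_def)
    ultimately show ?thesis unfolding \<psi>_def using v(1) by simp
  qed
  have "\<psi> (seqMk k) (K0_class (catFk k) (projP x)) = frag_of x" if "x \<in> seqIMk k" for k x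
    unfolding catFk_def
    by (rule val[OF swap_closed_seqMk DGP_proj]) (use that in \<open>auto simp: incr_seqMk seqIMk_def K0_rel_zero\<close>)
  moreover have "\<psi> seqM (K0_class catF M) = \<psi> (seqMk k) (K0_class (catFk k) M)" if "M \<in> Ob (catFk k)" for k M
  proof -
    have M: "M \<in> DGP (seqMk k)" using that by (simp add: catFk_def)
    then have M': "M \<in> DGP seqM" by (rule DGP_mono) (auto simp: seqMk_def)
    obtain v where v: "Poly_Mapping.keys v \<subseteq> incr (seqMk k)" "frag_of M - projP_frag v \<in> K0_rel (seqMk k)"
      using spanned_DGP[OF swap_closed_seqMk M] unfolding spanned_def by blast
    obtain w where w: "Poly_Mapping.keys w \<subseteq> incr seqM" "frag_of M - projP_frag w \<in> K0_rel seqM"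
      using spanned_DGP[OF swap_closed_seqM M'] unfolding spanned_def by blast
    have vI: "Poly_Mapping.keys v \<subseteq> seqIM" and wI: "Poly_Mapping.keys w \<subseteq> seqIM"
      using v(1) w(1) by (auto simp: incr_def seqMk_def seqIM_def)
    \<comment> \<open>The two congruences hold modulo different groups of relations, but
      \<open>chi_frag\<close> vanishes on both. It thus recovers the coefficients of
      \<open>v\<close> and of \<open>w\<close> from the same element
      \<open>frag_of M\<close>.\<close>
    have "v = w"
    proof (rule poly_mapping_eqI)
      fix x
      show "Poly_Mapping.lookup v x = Poly_Mapping.lookup w x"
      proof (cases "x \<in> seqIM")
        case True
        then show ?thesis
          using chi_frag_rel[OF v(2), of "sset x"] chi_frag_rel[OF w(2), of "sset x"]
            chi_frag_projP_frag[OF True vI, where 'k = 'k] chi_frag_projP_frag[OF True wI, where 'k = 'k] by simp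
      next
        case False
        then show ?thesis using vI wI by (metis in_keys_iff subsetD)
      qed
    qed
    then show ?thesis unfolding catF_def catFk_def
      using val[OF swap_closed_seqMk M v] val[OF swap_closed_seqM M' w] by simp
  qed
  ultimately show ?thesis
    using iso[OF swap_closed_seqM] iso[OF swap_closed_seqMk]
    unfolding catF_def catFk_def incr_seqM incr_seqMk
    by (intro exI[of _ "\<lambda>k. \<psi> (seqMk k)"] conjI allI bexI[of _ "\<psi> seqM"]) auto
qed

end
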